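(* Let $D=\sum_{i=1}^n\beta_i p_i$ be a divisor on $S^2$ with $-1<\beta_1\le\cdots\le\beta_n\le 0$, and let $g$ be a conic metric on $S^2$ representing $D$. Set $|D|:=\sum_{i=1}^n\beta_i$, $\beta:=\min_i\beta_i$ and $\alpha:=|D|-\min_i\beta_i$. Suppose that $\beta\le\alpha$ and that the Gaussian curvature satisfies $a\le K_g\le b$ for real constants $a,b$. If $a=0$, then $$\mathrm{Vol}(S^2,g)\ \ge\ V_{0,b}:=\frac{\pi(2+|D|)^2}{b(1+\beta)}.$$ If $a<0$, then $$\mathrm{Vol}(S^2,g)\ \ge\ V_{a,b}:=2\pi\left[\frac{\beta+1}{a}+\frac{\alpha+1}{b}-\frac{\sqrt{(b-a)\left(b(\beta+1)^2-a(\alpha+1)^2\right)}}{ab}\right].$$ If $a>0$, then $V_{\min}\le \mathrm{Vol}(S^2,g)\le V_{\max}$, where $$V_{\min}:=2\pi\left[\frac{\beta+1}{a}+\frac{\alpha+1}{b}-\frac{\sqrt{(b-a)\left(b(\beta+1)^2-a(\alpha+1)^2\right)}}{ab}\right],$$ $$V_{\max}:=2\pi\left[\frac{\beta+1}{a}+\frac{\alpha+1}{b}+\frac{\sqrt{(b-a)\left(b(\beta+1)^2-a(\alpha+1)^2\right)}}{ab}\right].$$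
   Context: A metric $g$ on a closed Riemann surface has a conic singularity of order $\beta>-1$ at a point $p$ if, in a local holomorphic coordinate $z$ centered at $p$, $g=e^{2u}|z|^{2\beta}|dz|^2$ with $u$ continuous and $C^2$ away from $p$ (cone angle $2\pi(1+\beta)$). A metric $g$ represents the divisor $D=\sum_{i=1}^n\beta_ip_i$ ($p_i$ distinct points) if $g$ has conic singularities of order $\beta_i$ at $p_i$ and is smooth elsewhere; $(S^2,D,g)$ is then called a conic sphere. $K_g$ is the Gaussian curvature away from the $p_i$, and the bound $a\le K_g\le b$ is required there. $\mathrm{Vol}(S^2,g)$ is the total area. (If $n=1$, then $\alpha=0$.) *)

theory Defs
  imports "HOL-Analysis.Analysis"
begin

section \<open>The Riemann sphere\<close>

type_synonym space3 = "complex \<times> real"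

definition S2 :: "space3 set" where
  "S2 = sphere 0 1"

definition north_pole :: space3 where
  "north_pole = (0, 1)"

definition south_pole :: space3 where
  "south_pole = (0, -1)"

text \<open>Stereographic projections from the two poles. The conjugate in the second one makes the
  transition map the holomorphic map \<open>z \<mapsto> 1/z\<close>. The two maps \<open>stereoN_inv\<close>, \<open>stereoS_inv\<close> are
  the corresponding inverses, defined on the whole plane.\<close>

definition stereoN :: "space3 \<Rightarrow> complex" where
  "stereoN p = fst p /\<^sub>R (1 - snd p)"

definition stereoS :: "space3 \<Rightarrow> complex" where
  "stereoS p = cnj (fst p) /\<^sub>R (1 + snd p)"

definition stereoN_inv :: "complex \<Rightarrow> space3" where
  "stereoN_inv z =
    ((2 / (1 + (norm z)\<^sup>2)) *\<^sub>R z, ((norm z)\<^sup>2 - 1) / ((norm z)\<^sup>2 + 1))"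

definition stereoS_inv :: "complex \<Rightarrow> space3" where
  "stereoS_inv z =
    ((2 / (1 + (norm z)\<^sup>2)) *\<^sub>R cnj z, (1 - (norm z)\<^sup>2) / ((norm z)\<^sup>2 + 1))"

text \<open>Local holomorphic coordinates. No openness of the image or regularity of the inverse is
  demanded, since an injective holomorphic map on an open set is biholomorphic onto its open image.\<close>

definition holomorphic_chart :: "space3 set \<Rightarrow> (space3 \<Rightarrow> complex) \<Rightarrow> bool" where
  "holomorphic_chart U \<phi> \<longleftrightarrow>
     openin (top_of_set S2) U \<and> inj_on \<phi> U \<and>
     (\<phi> \<circ> stereoN_inv) holomorphic_on (stereoN ` (U - {north_pole})) \<and>
     (\<phi> \<circ> stereoS_inv) holomorphic_on (stereoS ` (U - {south_pole}))"

section \<open>Regularity of functions in a planar domain\<close>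

text \<open>Intended for open \<open>S\<close>: all partial derivatives up to order \<open>k\<close> exist and are continuous.\<close>

primrec Ck_on :: "nat \<Rightarrow> (complex \<Rightarrow> real) \<Rightarrow> complex set \<Rightarrow> bool" where
  "Ck_on 0 f S \<longleftrightarrow> continuous_on S f"
| "Ck_on (Suc k) f S \<longleftrightarrow>
     (\<forall>z\<in>S. f differentiable (at z)) \<and>
     (\<forall>v. Ck_on k (\<lambda>z. frechet_derivative f (at z) v) S)"

definition smooth_on :: "(complex \<Rightarrow> real) \<Rightarrow> complex set \<Rightarrow> bool" where
  "smooth_on f S \<longleftrightarrow> (\<forall>k. Ck_on k f S)"

definition laplacian :: "(complex \<Rightarrow> real) \<Rightarrow> complex \<Rightarrow> real" where
  "laplacian f z =
     (\<Sum>v\<in>{1, \<i>}. frechet_derivative (\<lambda>w. frechet_derivative f (at w) v) (at z) v)"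

section \<open>Conic metrics\<close>

text \<open>A metric tensor assigns to a point \<open>p\<close> of the sphere and two vectors tangent to the sphere
  at \<open>p\<close> a real number; its values on other arguments, and at the points of the divisor, are
  irrelevant.\<close>

type_synonym metric_tensor = "space3 \<Rightarrow> space3 \<Rightarrow> space3 \<Rightarrow> real"

text \<open>The expression of \<open>g\<close> in the coordinate whose inverse (parametrisation) is \<open>\<psi>\<close>.\<close>

definition pullback_metric ::
    "(complex \<Rightarrow> space3) \<Rightarrow> metric_tensor \<Rightarrow> complex \<Rightarrow> complex \<Rightarrow> complex \<Rightarrow> real" where
  "pullback_metric \<psi> g z h k =
     g (\<psi> z) (frechet_derivative \<psi> (at z) h) (frechet_derivative \<psi> (at z) k)"

text \<open>\<open>g = \<rho>(z) |dz|\<^sup>2\<close> at all coordinate values \<open>z \<in> W\<close>; here \<open>|dz|\<^sup>2\<close> is the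
  Euclidean inner product of the plane.\<close>

definition metric_eq_in_chart ::
    "metric_tensor \<Rightarrow> space3 set \<Rightarrow> (space3 \<Rightarrow> complex) \<Rightarrow> complex set \<Rightarrow> (complex \<Rightarrow> real) \<Rightarrow> bool" where
  "metric_eq_in_chart g U \<phi> W \<rho> \<longleftrightarrow>
     (\<forall>z\<in>W. \<forall>h k. pullback_metric (inv_into U \<phi>) g z h k = \<rho> z * (h \<bullet> k))"

definition conic_singularity :: "metric_tensor \<Rightarrow> space3 \<Rightarrow> real \<Rightarrow> bool" where
  "conic_singularity g p \<beta> \<longleftrightarrow> \<beta> > -1 \<and>
     (\<exists>U \<phi> u. holomorphic_chart U \<phi> \<and> p \<in> U \<and> \<phi> p = 0 \<and>
        continuous_on (\<phi> ` U) u \<and> Ck_on 2 u (\<phi> ` U - {0}) \<and>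
        metric_eq_in_chart g U \<phi> (\<phi> ` U - {0})
          (\<lambda>z. exp (2 * u z) * norm z powr (2 * \<beta>)))"

text \<open>As usual on a Riemann surface, metrics are compatible with the complex structure.\<close>

definition smooth_metric_at :: "metric_tensor \<Rightarrow> space3 \<Rightarrow> bool" where
  "smooth_metric_at g p \<longleftrightarrow>
     (\<exists>U \<phi> u. holomorphic_chart U \<phi> \<and> p \<in> U \<and> smooth_on u (\<phi> ` U) \<and>
        metric_eq_in_chart g U \<phi> (\<phi> ` U) (\<lambda>z. exp (2 * u z)))"

text \<open>The divisor \<open>\<Sum>i=1..n. \<beta> i \<cdot> p i\<close> with distinct points \<open>p i\<close> on the sphere.\<close>

definition represents_divisor ::
    "metric_tensor \<Rightarrow> nat \<Rightarrow> (nat \<Rightarrow> space3) \<Rightarrow> (nat \<Rightarrow> real) \<Rightarrow> bool" where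
  "represents_divisor g n p \<beta> \<longleftrightarrow>
     inj_on p {1..n} \<and> p ` {1..n} \<subseteq> S2 \<and>
     (\<forall>i\<in>{1..n}. conic_singularity g (p i) (\<beta> i)) \<and>
     (\<forall>q\<in>S2 - p ` {1..n}. smooth_metric_at g q)"

text \<open>The Gaussian curvature \<open>K = - \<Delta>(ln \<rho>) / (2 \<rho>)\<close> of a conformal metric
  \<open>\<rho> |dz|\<^sup>2\<close>, that is \<open>K = - exp (- 2 u) \<Delta>u\<close> for \<open>\<rho> = exp (2 u)\<close>. The value does not depend
  on the holomorphic coordinate, so one of the two stereographic coordinates is used at each point.\<close>

definition curvature_in_coord :: "(complex \<Rightarrow> space3) \<Rightarrow> metric_tensor \<Rightarrow> complex \<Rightarrow> real" where
  "curvature_in_coord \<psi> g z =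
     - laplacian (\<lambda>w. ln (pullback_metric \<psi> g w 1 1)) z / (2 * pullback_metric \<psi> g z 1 1)"

definition gauss_curvature :: "metric_tensor \<Rightarrow> space3 \<Rightarrow> real" where
  "gauss_curvature g q =
     (if q = north_pole then curvature_in_coord stereoS_inv g (stereoS q)
      else curvature_in_coord stereoN_inv g (stereoN q))"

text \<open>The Riemannian area \<open>\<integral> sqrt (E G - F\<^sup>2) dx dy\<close> in the stereographic coordinate, which
  misses a single point. The integrand of a conic metric is integrable, as all orders exceed \<open>-1\<close>.\<close>

definition area :: "metric_tensor \<Rightarrow> real" where
  "area g = (LINT z|lborel. sqrt
     (pullback_metric stereoN_inv g z 1 1 * pullback_metric stereoN_inv g z \<i> \<i>
      - (pullback_metric stereoN_inv g z 1 \<i>)\<^sup>2))"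

end

theory Submission
  imports Defs "HOL-Complex_Analysis.Complex_Analysis" "HOL-Real_Asymp.Real_Asymp"
begin

text \<open>
  Put the cone point of smallest order at infinity and write the metric as
  \<open>e\<^sup>2\<^sup>U |dz|\<^sup>2\<close> on the plane. Let \<open>A(t)\<close>, \<open>P(t)\<close> be the Euclidean
  and the Riemannian area of \<open>{U > t}\<close>, and \<open>F(t)\<close> its total curvature minus \<open>2 \<pi> \<alpha>\<close>.
  The divergence theorem gives that \<open>F(t)\<close> is the flux of the gradient of \<open>U\<close> through
  \<open>{U = t}\<close>, so Cauchy--Schwarz and the isoperimetric inequality give
  \<open>4 \<pi> A \<le> - A' F\<close>, where \<open>- P' = - e\<^sup>2\<^sup>t A'\<close>. Multiplied by \<open>e\<^sup>2\<^sup>t\<close> and integrated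
  over \<open>t\<close>, together with Gauss--Bonnet and \<open>a \<le> K \<le> b\<close>, this is a quadratic
  inequality for the total area whose roots are the stated bounds.

  To avoid level sets and the coarea formula, indicators of superlevel sets are replaced
  by \<open>\<eta>((U - t) / h)\<close> with a smooth step \<open>\<eta>\<close>; the isoperimetric inequality then enters as
  a lower bound for the integral of the norm of a gradient, which follows from the
  Brunn--Minkowski inequality for a set and a small disc. Only \<open>h \<rightarrow> 0\<close> is taken at the end.
\<close>

section \<open>The isoperimetric inequality in the plane\<close>

text \<open>The flux of the gradient of \<open>U\<close> registers a finite cone point of nonzero
  order only if \<open>U\<close> tends to infinity there. Orders being at most 0, such points lie
  inside all superlevel sets, so the same \<open>2 \<pi> \<alpha>\<close> occurs at every level. Let
  \<open>X\<close> be the total of the curvature excess \<open>K - a\<close> and \<open>Q(t)\<close>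
  its part above level \<open>t\<close>. Integration by parts in \<open>t\<close> leaves the term
  \<open>\<integral> P (- Q')\<close>. As \<open>K \<le> b\<close> means
  \<open>Q \<le> (b - a) P\<close>, this term is at least \<open>X^2 / (2 (b - a))\<close>;
  multiplying by \<open>b - a\<close> keeps the case \<open>a = b\<close> inside the same
  inequality. Gauss-Bonnet expresses \<open>X\<close> through the area \<open>V\<close>, and the
  result is quadratic in \<open>V\<close>. Even for smooth \<open>U\<close> single level sets may be
  irregular; the smoothed version needs only chain rules, Green's identity and dominated
  convergence. Singular points cost nothing in the isoperimetric inequality, since a cutoff at scale
  \<open>r\<close> has gradient of size \<open>1 / r\<close> on area \<open>r^2\<close>, and they
  enter Green's identity only through their coefficients of \<open>ln\<close>.\<close>

lemma nn_integral_layer_cake: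
  fixes f :: "'a \<Rightarrow> real"
  assumes [measurable]: "f \<in> borel_measurable M" and "sigma_finite_measure M"
  shows "(\<integral>\<^sup>+x. ennreal (f x) \<partial>M)
    = (\<integral>\<^sup>+t. indicator {0<..} t * emeasure M {x\<in>space M. t < f x} \<partial>lborel)"
proof -
  interpret M: sigma_finite_measure M by fact
  interpret P: pair_sigma_finite lborel M ..
  have "(\<integral>\<^sup>+x. ennreal (f x) \<partial>M) = (\<integral>\<^sup>+x. \<integral>\<^sup>+t. indicator {0<..<f x} t \<partial>lborel \<partial>M)"
    by (intro nn_integral_cong, rename_tac x, case_tac "0 \<le> f x") (simp_all add: ennreal_neg)
  also have "\<dots> = (\<integral>\<^sup>+x. \<integral>\<^sup>+t. indicator {0<..} t * indicator {x\<in>space M. t < f x} x \<partial>lborel \<partial>M)"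
    by (intro nn_integral_cong) (auto simp: indicator_def)
  also have "\<dots> = (\<integral>\<^sup>+t. \<integral>\<^sup>+x. indicator {0<..} t * indicator {x\<in>space M. t < f x} x \<partial>M \<partial>lborel)"
    by (rule P.Fubini') measurable
  also have "\<dots> = (\<integral>\<^sup>+t. indicator {0<..} t * emeasure M {x\<in>space M. t < f x} \<partial>lborel)"
    by (intro nn_integral_cong, subst nn_integral_cmult_indicator[symmetric]) auto
  finally show ?thesis .
qed

lemma emeasure_lborel_translate:
  fixes c :: "'a::euclidean_space"
  assumes [measurable]: "A \<in> sets borel"
  shows "emeasure lborel {x. x + c \<in> A} = emeasure lborel A"
proof -
  have "emeasure lborel A = emeasure (distr lborel borel ((+) c)) A"
    by (simp add: lborel_distr_plus)
  also have "\<dots> = emeasure lborel ((+) c -` A \<inter> space lborel)"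
    by (rule emeasure_distr) auto
  also have "(+) c -` A \<inter> space lborel = {x. x + c \<in> A}" by (auto simp: add.commute)
  finally show ?thesis ..
qed

section \<open>The Brunn-Minkowski inequality on the line and in the plane\<close>

lemma brunn_minkowski_real:
  fixes A B C :: "real set"
  assumes [measurable]: "A \<in> sets borel" "B \<in> sets borel" "C \<in> sets borel"
    and ne: "A \<noteq> {}" "B \<noteq> {}" and bd: "bounded A" "bounded B"
    and sum: "\<And>x y. x \<in> A \<Longrightarrow> y \<in> B \<Longrightarrow> x + y \<in> C"
  shows "emeasure lborel A + emeasure lborel B \<le> emeasure lborel C"
proof (rule ennreal_le_epsilon)
  \<comment> \<open>For \<open>a\<close> near \<open>Sup A\<close> and \<open>b\<close> near \<open>Inf B\<close> the translates \<open>A + b\<close> and \<open>a + B\<close> barely overlap.\<close>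
  fix e :: real assume "0 < e"
  have bdd: "bdd_above A" "bdd_below B" using bd by (auto simp: bounded_imp_bdd_above bounded_imp_bdd_below)
  obtain a where a: "a \<in> A" "Sup A - e/2 < a"
    using less_cSup_iff[OF ne(1) bdd(1), of "Sup A - e/2"] \<open>0 < e\<close> by auto
  obtain b where b: "b \<in> B" "b < Inf B + e/2"
    using cInf_less_iff[OF ne(2) bdd(2), of "Inf B + e/2"] \<open>0 < e\<close> by auto
  define A' where "A' = {x. x + (-b) \<in> A}"
  define B' where "B' = {x. x + (-a) \<in> B}"
  have [measurable]: "A' \<in> sets borel" "B' \<in> sets borel" unfolding A'_def B'_def by measurable
  have m: "emeasure lborel A' = emeasure lborel A" "emeasure lborel B' = emeasure lborel B"
    unfolding A'_def B'_def by (intro emeasure_lborel_translate; simp)+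
  have sub: "A' \<union> B' \<subseteq> C" using sum[OF _ b(1)] sum[OF a(1)] by (force simp: A'_def B'_def)
  have "A' \<inter> B' \<subseteq> {a + Inf B .. Sup A + b}"
  proof
    fix x assume "x \<in> A' \<inter> B'"
    then have "x - b \<in> A" "x - a \<in> B" by (auto simp: A'_def B'_def)
    then have "x - b \<le> Sup A" "Inf B \<le> x - a" using bdd by (auto intro: cSup_upper cInf_lower)
    then show "x \<in> {a + Inf B .. Sup A + b}" by auto
  qed
  then have "emeasure lborel (A' \<inter> B') \<le> emeasure lborel {a + Inf B .. Sup A + b}"
    by (intro emeasure_mono) auto
  also have "\<dots> \<le> ennreal e" using a b by (auto simp: emeasure_lborel_Icc_eq intro!: ennreal_leI)
  finally have i: "emeasure lborel (A' \<inter> B') \<le> ennreal e" .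
  have "emeasure lborel A + emeasure lborel B = emeasure lborel (A' \<union> B') + emeasure lborel (A' \<inter> B')"
    unfolding m[symmetric] by (rule emeasure_Un_Int) auto
  also have "\<dots> \<le> emeasure lborel C + ennreal e"
    by (intro add_mono i emeasure_mono sub) auto
  finally show "emeasure lborel A + emeasure lborel B \<le> emeasure lborel C + ennreal e" .
qed

text \<open>Measuring levels as fractions of an upper bound gives functions with different maxima
  the common parameter range \<open>0 < t < 1\<close>, so that their layer cakes can be added level
  by level.\<close>

lemma nn_integral_layer_cake_scaled:
  fixes f :: "real \<Rightarrow> real"
  assumes [measurable]: "f \<in> borel_measurable borel" and F: "F > 0" "\<And>x. f x \<le> F"
  shows "(\<integral>\<^sup>+x. ennreal (f x) \<partial>lborel)
    = ennreal F * (\<integral>\<^sup>+t. indicator {0<..<1} t * emeasure lborel {x. F * t < f x} \<partial>lborel)"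
proof -
  have "(\<integral>\<^sup>+x. ennreal (f x) \<partial>lborel)
      = (\<integral>\<^sup>+t. indicator {0<..} t * emeasure lborel {x. t < f x} \<partial>lborel)"
    using nn_integral_layer_cake[of f lborel] sigma_finite_lborel by simp
  also have "\<dots> = ennreal F * (\<integral>\<^sup>+t. indicator {0<..} (0 + F*t) * emeasure lborel {x. 0 + F * t < f x} \<partial>lborel)"
    using F by (subst nn_integral_real_affine[where c=F and t=0]) auto
  also have "(\<integral>\<^sup>+t. indicator {0<..} (0 + F*t) * emeasure lborel {x. 0 + F * t < f x} \<partial>lborel)
      = (\<integral>\<^sup>+t. indicator {0<..<1} t * emeasure lborel {x. F * t < f x} \<partial>lborel)"
  proof (intro nn_integral_cong)
    fix t :: real
    have "{x. F * t < f x} = {}" if "t \<ge> 1"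
    proof -
      have "F \<le> F * t" using that F by simp
      then show ?thesis using F(2) by (auto simp: not_less intro: order_trans)
    qed
    then show "indicator {0<..} (0 + F*t) * emeasure lborel {x. 0 + F * t < f x}
       = indicator {0<..<1} t * emeasure lborel {x. F * t < f x}"
      using F by (cases "t \<ge> 1") (auto simp: indicator_def zero_less_mult_iff)
  qed
  finally show ?thesis .
qed

text \<open>The defect is the perfect square \<open>(G * sqrt a - F * sqrt b)^2 / (F * G)\<close>.
  The inequality removes the unknown maximal slice lengths \<open>F\<close>, \<open>G\<close> from
  the planar Brunn-Minkowski estimate.\<close>

lemma sum_sqrt_le:
  fixes F G a b :: real
  assumes "F > 0" "G > 0" "a \<ge> 0" "b \<ge> 0"
  shows "(sqrt a + sqrt b)\<^sup>2 \<le> (F + G) * (a / F + b / G)"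
proof -
  have "0 \<le> (G * sqrt a - F * sqrt b)\<^sup>2 / (F * G)" using assms by simp
  also have "\<dots> = G * a / F + F * b / G - 2 * sqrt a * sqrt b"
    using assms by (simp add: field_simps power2_eq_square)
  finally show ?thesis using assms by (simp add: field_simps power2_eq_square)
qed

lemma slice_measure_props:
  fixes A :: "(real \<times> real) set"
  assumes [measurable]: "A \<in> sets borel" and bd: "A \<subseteq> {-r..r} \<times> {-r..r}" and r: "r > 0"
  defines "f \<equiv> \<lambda>x. measure lborel {y. (x, y) \<in> A}"
  shows "f \<in> borel_measurable borel" "f x \<le> 2 * r" "{x. f x > 0} \<subseteq> {-r..r}"
    "ennreal (f x) = emeasure lborel {y. (x, y) \<in> A}"
    "(\<integral>\<^sup>+x. ennreal (f x) \<partial>lborel) = emeasure lborel A"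
proof -
  have [measurable]: "A \<in> sets (borel \<Otimes>\<^sub>M borel)" unfolding borel_prod using assms(1) .
  have sl[measurable]: "{y. (x, y) \<in> A} \<in> sets borel" for x by measurable
  have le: "emeasure lborel {y. (x, y) \<in> A} \<le> ennreal (2*r)" for x
  proof -
    have "emeasure lborel {y. (x, y) \<in> A} \<le> emeasure lborel {-r..r}"
      using bd by (intro emeasure_mono) auto
    then show ?thesis using r by simp
  qed
  have fin: "emeasure lborel {y. (x, y) \<in> A} \<noteq> \<infinity>" for x using le[of x] by (auto simp: top_unique)
  show f: "ennreal (f x) = emeasure lborel {y. (x, y) \<in> A}" for x
    using fin unfolding f_def by (simp add: emeasure_eq_ennreal_measure)
  show "f x \<le> 2 * r" using le[of x] r unfolding f[symmetric] by (simp add: f_def)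
  show "f \<in> borel_measurable borel" unfolding f_def measure_def by measurable
  show "{x. f x > 0} \<subseteq> {-r..r}"
  proof
    fix x assume "x \<in> {x. f x > 0}"
    then have "{y. (x, y) \<in> A} \<noteq> {}" unfolding f_def by (metis (mono_tags, lifting) measure_empty mem_Collect_eq less_irrefl)
    then show "x \<in> {-r..r}" using bd by auto
  qed
  have "emeasure lborel A = emeasure (lborel \<Otimes>\<^sub>M lborel) A" by (simp add: lborel_prod)
  also have "\<dots> = (\<integral>\<^sup>+x. emeasure lborel (Pair x -` A) \<partial>lborel)"
    by (rule lborel.emeasure_pair_measure_alt) (simp add: borel_prod)
  finally show "(\<integral>\<^sup>+x. ennreal (f x) \<partial>lborel) = emeasure lborel A"
    unfolding f by (simp add: vimage_def)
qed

text \<open>Proof by slicing. The one-dimensional inequality is used twice: for vertical slices,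
  which makes slice lengths superadditive, and then for the superlevel sets of the slice
  lengths.\<close>

lemma brunn_minkowski_real_prod:
  fixes A B C :: "(real \<times> real) set"
  assumes [measurable]: "A \<in> sets borel" "B \<in> sets borel" "C \<in> sets borel"
    and bd: "bounded A" "bounded B" "bounded C"
    and pos: "measure lborel A > 0" "measure lborel B > 0"
    and sum: "\<And>x y. x \<in> A \<Longrightarrow> y \<in> B \<Longrightarrow> x + y \<in> C"
  shows "(sqrt (measure lborel A) + sqrt (measure lborel B))\<^sup>2 \<le> measure lborel C"
proof -
  have [measurable]: "A \<in> sets (borel \<Otimes>\<^sub>M borel)" "B \<in> sets (borel \<Otimes>\<^sub>M borel)"
    "C \<in> sets (borel \<Otimes>\<^sub>M borel)" unfolding borel_prod using assms(1,2,3) by auto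
  have "bounded (A \<union> B \<union> C)" using bd by simp
  then obtain r0 where r0: "\<And>x. x \<in> A \<union> B \<union> C \<Longrightarrow> norm x \<le> r0" by (auto simp: bounded_iff)
  define r where "r = max r0 1"
  have r: "r > 0" by (simp add: r_def)
  have box: "S \<subseteq> {-r..r} \<times> {-r..r}" if "S \<subseteq> A \<union> B \<union> C" for S
  proof
    fix z assume "z \<in> S"
    then have "norm z \<le> r" using r0[of z] that by (auto simp: r_def)
    moreover have "\<bar>fst z\<bar> \<le> norm z" "\<bar>snd z\<bar> \<le> norm z"
      using norm_fst_le[of "fst z" "snd z"] norm_snd_le[of "snd z" "fst z"] by auto
    ultimately show "z \<in> {-r..r} \<times> {-r..r}" by (cases z) auto
  qed
  define f where "f = (\<lambda>x. measure lborel {y. (x, y) \<in> A})"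
  define g where "g = (\<lambda>x. measure lborel {y. (x, y) \<in> B})"
  define h where "h = (\<lambda>x. measure lborel {y. (x, y) \<in> C})"
  have bA: "A \<subseteq> {-r..r} \<times> {-r..r}" and bB: "B \<subseteq> {-r..r} \<times> {-r..r}" and bC: "C \<subseteq> {-r..r} \<times> {-r..r}"
    by (rule box; blast)+
  have fp: "f \<in> borel_measurable borel" "\<And>x. f x \<le> 2 * r" "{x. f x > 0} \<subseteq> {-r..r}"
    "\<And>x. ennreal (f x) = emeasure lborel {y. (x, y) \<in> A}"
    "(\<integral>\<^sup>+x. ennreal (f x) \<partial>lborel) = emeasure lborel A"
    unfolding f_def by (rule slice_measure_props[OF assms(1) bA r])+
  have gp: "g \<in> borel_measurable borel" "\<And>x. g x \<le> 2 * r" "{x. g x > 0} \<subseteq> {-r..r}"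
    "\<And>x. ennreal (g x) = emeasure lborel {y. (x, y) \<in> B}"
    "(\<integral>\<^sup>+x. ennreal (g x) \<partial>lborel) = emeasure lborel B"
    unfolding g_def by (rule slice_measure_props[OF assms(2) bB r])+
  have hp: "h \<in> borel_measurable borel" "\<And>x. h x \<le> 2 * r" "{x. h x > 0} \<subseteq> {-r..r}"
    "\<And>x. ennreal (h x) = emeasure lborel {y. (x, y) \<in> C}"
    "(\<integral>\<^sup>+x. ennreal (h x) \<partial>lborel) = emeasure lborel C"
    unfolding h_def by (rule slice_measure_props[OF assms(3) bC r])+
  have [measurable]: "f \<in> borel_measurable borel" "g \<in> borel_measurable borel" "h \<in> borel_measurable borel"
    using fp(1) gp(1) hp(1) by auto
  have nn: "f x \<ge> 0" "g x \<ge> 0" "h x \<ge> 0" for x by (simp_all add: f_def g_def h_def)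
  have fin: "emeasure lborel S \<noteq> top" if "bounded S" for S :: "(real\<times>real) set"
    using emeasure_bounded_finite[OF that] by auto
  have eA: "emeasure lborel A = ennreal (measure lborel A)" "emeasure lborel B = ennreal (measure lborel B)"
     "emeasure lborel C = ennreal (measure lborel C)"
    using fin bd by (auto intro!: emeasure_eq_ennreal_measure)
  define F where "F = Sup (range f)"
  define G where "G = Sup (range g)"
  have bddf: "bdd_above (range f)" using fp(2) by (auto intro!: bdd_aboveI)
  have bddg: "bdd_above (range g)" using gp(2) by (auto intro!: bdd_aboveI)
  have fF: "f x \<le> F" for x unfolding F_def using bddf by (auto intro: cSup_upper)
  have gG: "g x \<le> G" for x unfolding G_def using bddg by (auto intro: cSup_upper)
  have F: "F > 0"
  proof (rule ccontr)
    assume "\<not> F > 0"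
    then have "f x = 0" for x using fF[of x] nn(1)[of x] by linarith
    then have "emeasure lborel A = 0" using fp(5) assms by simp
    then show False using pos by (simp add: measure_def)
  qed
  have G: "G > 0"
  proof (rule ccontr)
    assume "\<not> G > 0"
    then have "g x = 0" for x using gG[of x] nn(2)[of x] by linarith
    then have "emeasure lborel B = 0" using gp(5) assms by simp
    then show False using pos by (simp add: measure_def)
  qed
  have hfg: "f x + g y \<le> h (x + y)" if "f x > 0" "g y > 0" for x y
  proof -
    have "{u. (x, u) \<in> A} \<noteq> {}" "{u. (y, u) \<in> B} \<noteq> {}"
      using that unfolding f_def g_def by (metis (mono_tags, lifting) measure_empty less_irrefl)+
    then have "emeasure lborel {u. (x, u) \<in> A} + emeasure lborel {u. (y, u) \<in> B}
       \<le> emeasure lborel {u. (x + y, u) \<in> C}"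
    proof (intro brunn_minkowski_real)
      show "bounded {u. (x, u) \<in> A}" "bounded {u. (y, u) \<in> B}"
        by (rule bounded_subset[OF bounded_closed_interval[of "-r" r]], use bA bB in blast)+
      show "a + b \<in> {u. (x + y, u) \<in> C}" if "a \<in> {u. (x, u) \<in> A}" "b \<in> {u. (y, u) \<in> B}" for a b
        using sum[of "(x, a)" "(y, b)"] that by simp
    qed auto
    then have "ennreal (f x) + ennreal (g y) \<le> ennreal (h (x + y))"
      using fp(4) gp(4) hp(4) assms by simp
    then show ?thesis using nn by (metis ennreal_le_iff ennreal_plus)
  qed
  \<comment> \<open>Scaling the levels by the suprema makes both superlevel sets nonempty for all \<open>t < 1\<close>.\<close>
  have Fup: "\<exists>x. F * t < f x" if "t < 1" for t
  proof -
    have "F * t < F" using F that by simp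
    then show ?thesis using less_cSup_iff[OF _ bddf, of "F*t"] by (auto simp: F_def)
  qed
  have Gup: "\<exists>x. G * t < g x" if "t < 1" for t
  proof -
    have "G * t < G" using G that by simp
    then show ?thesis using less_cSup_iff[OF _ bddg, of "G*t"] by (auto simp: G_def)
  qed
  \<comment> \<open>Cutting \<open>h\<close> off at \<open>F + G\<close> gives it the upper bound
    that the scaled layer cake formula requires; levels below \<open>F + G\<close> do not notice the
    cut.\<close>
  have lev: "emeasure lborel {x. F * t < f x} + emeasure lborel {x. G * t < g x}
     \<le> emeasure lborel {x. (F + G) * t < min (h x) (F+G)}" if t: "0 < t" "t < 1" for t
  proof (rule brunn_minkowski_real)
    have Ft: "0 < F * t" "0 < G * t" using F G t by simp_all
    have "{x. F * t < f x} \<subseteq> {x. f x > 0}" "{x. G * t < g x} \<subseteq> {x. g x > 0}"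
      using less_trans[OF Ft(1)] less_trans[OF Ft(2)] by blast+
    then show "bounded {x. F * t < f x}" "bounded {x. G * t < g x}"
      using fp(3) gp(3) by (meson bounded_subset bounded_closed_interval subset_trans)+
    fix x y assume xy: "x \<in> {x. F * t < f x}" "y \<in> {x. G * t < g x}"
    then have "f x > 0" "g y > 0" using F G t by (auto intro: less_trans[of 0 "F*t"] less_trans[of 0 "G*t"])
    from hfg[OF this] xy have "(F + G) * t < h (x + y)" by (auto simp: algebra_simps)
    moreover have "(F + G) * t < F + G" using F G t by simp
    ultimately show "x + y \<in> {x. (F + G) * t < min (h x) (F+G)}" by simp
  qed (use Fup Gup t in auto)
  define I1 where "I1 = (\<integral>\<^sup>+t. indicator {0<..<1} t * emeasure lborel {x. F * t < f x} \<partial>lborel)"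
  define I2 where "I2 = (\<integral>\<^sup>+t. indicator {0<..<1} t * emeasure lborel {x. G * t < g x} \<partial>lborel)"
  define I3 where "I3 = (\<integral>\<^sup>+t. indicator {0<..<1} t * emeasure lborel {x. (F + G) * t < min (h x) (F+G)} \<partial>lborel)"
  have I1e: "emeasure lborel A = ennreal F * I1"
    unfolding I1_def fp(5)[symmetric] by (rule nn_integral_layer_cake_scaled[OF fp(1) F fF])
  have "ennreal (measure lborel A / F) = ennreal (1 / F) * ennreal (measure lborel A)"
    using F by (simp flip: ennreal_mult)
  also have "\<dots> = (ennreal (1 / F) * ennreal F) * I1"
    unfolding eA[symmetric] I1e by (rule mult.assoc[symmetric])
  also have "ennreal (1 / F) * ennreal F = 1"
    using F by (simp flip: ennreal_mult)
  finally have I1: "ennreal (measure lborel A / F) = I1" by simp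
  have I2e: "emeasure lborel B = ennreal G * I2"
    unfolding I2_def gp(5)[symmetric] by (rule nn_integral_layer_cake_scaled[OF gp(1) G gG])
  have "ennreal (measure lborel B / G) = ennreal (1 / G) * ennreal (measure lborel B)"
    using G by (simp flip: ennreal_mult)
  also have "\<dots> = (ennreal (1 / G) * ennreal G) * I2"
    unfolding eA[symmetric] I2e by (rule mult.assoc[symmetric])
  also have "ennreal (1 / G) * ennreal G = 1"
    using G by (simp flip: ennreal_mult)
  finally have I2: "ennreal (measure lborel B / G) = I2" by simp
  have "I1 + I2 = (\<integral>\<^sup>+t. indicator {0<..<1} t * emeasure lborel {x. F * t < f x}
          + indicator {0<..<1} t * emeasure lborel {x. G * t < g x} \<partial>lborel)"
    unfolding I1_def I2_def by (rule nn_integral_add[symmetric]) measurable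
  also have "\<dots> \<le> I3"
    unfolding I3_def
  proof (intro nn_integral_mono)
    fix t :: real
    show "indicator {0<..<1} t * emeasure lborel {x. F * t < f x}
          + indicator {0<..<1} t * emeasure lborel {x. G * t < g x}
        \<le> indicator {0<..<1} t * emeasure lborel {x. (F + G) * t < min (h x) (F+G)}"
      using lev[of t] by (cases "0 < t"; cases "t < 1") simp_all
  qed
  finally have I12: "I1 + I2 \<le> I3" .
  have "ennreal ((F + G) * (measure lborel A / F + measure lborel B / G)) = ennreal (F + G) * (I1 + I2)"
    using F G by (simp add: I1[symmetric] I2[symmetric] ennreal_mult[symmetric] ennreal_plus[symmetric] del: ennreal_plus)
  also have "\<dots> \<le> ennreal (F + G) * I3" by (intro mult_left_mono I12) simp
  also have "ennreal (F + G) * I3 = (\<integral>\<^sup>+x. ennreal (min (h x) (F+G)) \<partial>lborel)"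
    unfolding I3_def using F G by (intro nn_integral_layer_cake_scaled[symmetric]) auto
  also have "\<dots> \<le> (\<integral>\<^sup>+x. ennreal (h x) \<partial>lborel)" by (intro nn_integral_mono ennreal_leI) auto
  also have "\<dots> = ennreal (measure lborel C)" using hp(5) by (simp add: eA)
  finally have "(F + G) * (measure lborel A / F + measure lborel B / G) \<le> measure lborel C"
    by (simp add: mult_left_mono ennreal_le_iff)
  moreover have "(sqrt (measure lborel A) + sqrt (measure lborel B))\<^sup>2
      \<le> (F + G) * (measure lborel A / F + measure lborel B / G)"
    using F G by (intro sum_sqrt_le) auto
  ultimately show ?thesis by simp
qed


section \<open>From Brunn-Minkowski to a lower bound for the integral of a gradient norm\<close>

lemma distr_Complex: "distr lborel borel (\<lambda>(x, y). Complex x y) = (lborel :: complex measure)"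
proof (rule lborel_eqI[symmetric])
  have [measurable]: "(\<lambda>(x, y). Complex x y) \<in> borel \<rightarrow>\<^sub>M borel"
    by (intro borel_measurable_continuous_onI) (auto simp: Complex_eq split_beta intro!: continuous_intros)
  fix l u :: complex assume le: "\<And>b. b \<in> Basis \<Longrightarrow> l \<bullet> b \<le> u \<bullet> b"
  have le': "Re l \<le> Re u" "Im l \<le> Im u" using le[of 1] le[of \<i>] by (auto simp: Basis_complex_def)
  have eq: "(\<lambda>(x, y). Complex x y) -` box l u = box (Re l, Im l) (Re u, Im u)"
    by (auto simp: box_def Basis_complex_def Basis_prod_def)
  have "emeasure (distr lborel borel (\<lambda>(x, y). Complex x y)) (box l u)
     = emeasure lborel (box (Re l, Im l) (Re u, Im u))"
    by (subst emeasure_distr) (auto simp: eq)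
  also have "\<dots> = (\<Prod>b\<in>Basis. (u - l) \<bullet> b)"
    using le' by (subst emeasure_lborel_box)
     (auto simp: Basis_complex_def Basis_prod_def)
  finally show "emeasure (distr lborel borel (\<lambda>(x, y). Complex x y)) (box l u) = (\<Prod>b\<in>Basis. (u - l) \<bullet> b)" .
qed simp

lemma measure_ball_complex: "e \<ge> 0 \<Longrightarrow> measure lborel (ball (z::complex) e) = pi * e\<^sup>2"
  by (simp add: content_ball unit_ball_vol_2)

text \<open>Expanding Brunn-Minkowski for \<open>E\<close> and a disc of radius \<open>e\<close>
  gives the terms \<open>|E|\<close>, \<open>2 e sqrt (pi |E|)\<close> and \<open>pi e^2\<close>.
  The last one is dropped: only the first order in \<open>e\<close> matters for perimeter.\<close>

lemma isoperimetric_neighbourhood: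
  fixes E C :: "complex set"
  assumes [measurable]: "E \<in> sets borel" "C \<in> sets borel" and bd: "bounded E" "bounded C" and e: "e > 0"
    and nb: "\<And>x y. x \<in> E \<Longrightarrow> norm y < e \<Longrightarrow> x + y \<in> C"
  shows "measure lborel E + 2 * e * sqrt (pi * measure lborel E) \<le> measure lborel C"
proof (cases "measure lborel E > 0")
  case False
  then show ?thesis using measure_nonneg[of lborel E] by simp
next
  case True
  define T where "T = (\<lambda>(x::real, y::real). Complex x y)"
  have T[measurable]: "T \<in> borel \<rightarrow>\<^sub>M borel" unfolding T_def
    by (intro borel_measurable_continuous_onI) (auto simp: Complex_eq split_beta intro!: continuous_intros)
  have TB: "T -` S \<in> sets borel" if "S \<in> sets borel" for S
    using measurable_sets[OF T that] by simp
  have m: "measure lborel (T -` S) = measure lborel S" if "S \<in> sets borel" for S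
    using that by (simp add: distr_Complex[folded T_def, symmetric] measure_distr)
  have nT: "norm (T p) = norm p" for p by (simp add: T_def norm_prod_def split_beta complex_norm)
  have bT: "bounded (T -` S)" if "bounded S" for S
    using that unfolding bounded_iff by (metis nT vimageE)
  have Tplus: "T (p + q) = T p + T q" for p q by (simp add: T_def split_beta complex_eq_iff)
  have "(sqrt (measure lborel (T -` E)) + sqrt (measure lborel (T -` ball 0 e)))\<^sup>2 \<le> measure lborel (T -` C)"
    using bd True e nb by (intro brunn_minkowski_real_prod TB bT) (auto simp: m measure_ball_complex Tplus)
  then have *: "(sqrt (measure lborel E) + sqrt (pi * e\<^sup>2))\<^sup>2 \<le> measure lborel C"
    using e by (simp add: m measure_ball_complex)
  have "(sqrt (measure lborel E) + sqrt (pi * e\<^sup>2))\<^sup>2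
    = measure lborel E + 2 * e * sqrt (pi * measure lborel E) + pi * e\<^sup>2"
    using e True by (simp add: power2_sum real_sqrt_mult power_mult_distrib)
  then show ?thesis using * by (simp add: add_increasing2) (smt (verit) pi_ge_zero zero_le_mult_iff zero_le_power2)
qed

text \<open>The disc neighbourhood of \<open>{f > t}\<close> lies in \<open>{F > t}\<close>, so
  every level gains a perimeter term. For \<open>t < 1\<close> the gain is at least that of the
  smaller set \<open>{f \<ge> 1}\<close>, and these levels have total length 1.\<close>

lemma nn_integral_add_lborel_ge:
  fixes f F p :: "complex \<Rightarrow> real"
  assumes f: "continuous_on UNIV f" "\<And>z. f z \<ge> 0" and [measurable]: "F \<in> borel_measurable borel"
    and bd: "\<And>z. norm z \<ge> R \<Longrightarrow> f z = 0" "\<And>z. norm z \<ge> R \<Longrightarrow> F z = 0" and e: "e > 0"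
    and nb: "\<And>x y. f x > 0 \<Longrightarrow> norm y < e \<Longrightarrow> f x \<le> F (x + y)"
  shows "(\<integral>\<^sup>+z. ennreal (f z) \<partial>lborel) + ennreal (2 * e * sqrt (pi * measure lborel {z. f z \<ge> 1}))
    \<le> (\<integral>\<^sup>+z. ennreal (F z) \<partial>lborel)"
proof -
  have [measurable]: "f \<in> borel_measurable borel" using f(1) by (rule borel_measurable_continuous_onI)
  have bounded: "bounded {z. t < f z}" "bounded {z. t < F z}" if "t \<ge> 0" for t
    using that bd by (auto simp: bounded_iff intro!: exI[of _ R]) (metis linorder_not_less nle_le)+
  have b1: "bounded {z. 1 \<le> f z}"
    using bounded(1)[of "1/2"] by (rule bounded_subset) auto
  have fin: "emeasure lborel S = ennreal (measure lborel S)" if "bounded S" for S :: "complex set"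
    using emeasure_bounded_finite[OF that] by (intro emeasure_eq_ennreal_measure) auto
  define c where "c = 2 * e * sqrt (pi * measure lborel {z. f z \<ge> 1})"
  have c: "c \<ge> 0" using e by (simp add: c_def)
  have lev: "emeasure lborel {z. t < f z} + (if t < 1 then ennreal c else 0) \<le> emeasure lborel {z. t < F z}"
    if t: "t > 0" for t
  proof -
    have "measure lborel {z. t < f z} + 2 * e * sqrt (pi * measure lborel {z. t < f z}) \<le> measure lborel {z. t < F z}"
      using t nb bounded[of t] e
      by (intro isoperimetric_neighbourhood) (auto intro: less_le_trans order.strict_trans)
    moreover have "c \<le> 2 * e * sqrt (pi * measure lborel {z. t < f z})" if "t < 1"
      unfolding c_def using e t bounded[of t] that emeasure_bounded_finite[OF bounded(1)[of t]]
      by (intro mult_left_mono real_sqrt_le_mono measure_mono_fmeasurable)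
         (auto intro: order.strict_trans2 simp: fmeasurable_def emeasure_bounded_finite)
    moreover have "0 \<le> 2 * e * sqrt (pi * measure lborel {z. t < f z})" using e by simp
    ultimately have "measure lborel {z. t < f z} + (if t < 1 then c else 0) \<le> measure lborel {z. t < F z}"
      by (auto split: if_splits)
    then have "ennreal (measure lborel {z. t < f z} + (if t < 1 then c else 0)) \<le> ennreal (measure lborel {z. t < F z})"
      by (rule ennreal_leI)
    then show ?thesis using t c bounded[of t] by (auto simp: fin split: if_splits)
  qed
  have "(\<integral>\<^sup>+z. ennreal (f z) \<partial>lborel) + ennreal c
     = (\<integral>\<^sup>+t. indicator {0<..} t * emeasure lborel {z. t < f z} \<partial>lborel) + (\<integral>\<^sup>+t. ennreal c * indicator {0<..<1::real} t \<partial>lborel)"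
    using nn_integral_layer_cake[of f lborel] sigma_finite_lborel by (subst nn_integral_cmult_indicator) auto
  also have "\<dots> = (\<integral>\<^sup>+t. indicator {0<..} t * emeasure lborel {z. t < f z} + ennreal c * indicator {0<..<1::real} t \<partial>lborel)"
    by (rule nn_integral_add[symmetric]) measurable
  also have "\<dots> \<le> (\<integral>\<^sup>+t. indicator {0<..} t * emeasure lborel {z. t < F z} \<partial>lborel)"
  proof (intro nn_integral_mono)
    fix t :: real
    show "indicator {0<..} t * emeasure lborel {z. t < f z} + ennreal c * indicator {0<..<1} t
       \<le> indicator {0<..} t * emeasure lborel {z. t < F z}"
      using lev[of t] by (cases "t > 0"; cases "t < 1") (simp_all add: indicator_def)
  qed
  also have "\<dots> = (\<integral>\<^sup>+z. ennreal (F z) \<partial>lborel)"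
    by (subst nn_integral_layer_cake) (use sigma_finite_lborel in simp_all)
  finally show ?thesis unfolding c_def .
qed

text \<open>To first order the supremum of \<open>f\<close> over discs of radius \<open>e\<close> is
  \<open>f + e |p|\<close>. The previous estimate, after cancelling the integral of \<open>f\<close>
  and the factor \<open>e\<close>, therefore bounds the integral of \<open>|p|\<close> from
  below.\<close>

lemma isoperimetric_C1:
  fixes f :: "complex \<Rightarrow> real" and p :: "complex \<Rightarrow> complex"
  assumes der: "\<And>z. (f has_derivative (\<lambda>v. p z \<bullet> v)) (at z)" and cp: "continuous_on UNIV p"
    and nn: "\<And>z. f z \<ge> 0" and bd: "\<And>z. norm z \<ge> R \<Longrightarrow> f z = 0"
  shows "ennreal (2 * sqrt (pi * measure lborel {z. f z \<ge> 1})) \<le> (\<integral>\<^sup>+z. ennreal (norm (p z)) \<partial>lborel)"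
proof (rule ennreal_le_epsilon)
  fix d0 :: real assume "d0 > 0"
  have [measurable]: "p \<in> borel_measurable borel" using cp by (rule borel_measurable_continuous_onI)
  have cf: "continuous_on UNIV f"
    by (intro continuous_at_imp_continuous_on ballI has_derivative_continuous[OF der])
  have [measurable]: "f \<in> borel_measurable borel" using cf by (rule borel_measurable_continuous_onI)
  define R' where "R' = max R 0 + 1"
  define M where "M = measure lborel (ball (0::complex) R')"
  have M: "emeasure lborel (ball (0::complex) R') = ennreal M"
    unfolding M_def using emeasure_bounded_finite[OF bounded_ball, of "0::complex" R']
    by (intro emeasure_eq_ennreal_measure) auto
  have "M > 0" by (simp add: M_def measure_ball_complex R'_def)
  \<comment> \<open>The oscillation of \<open>p\<close> allowed at scale \<open>e\<close> is spread
    over a disc of area \<open>M\<close>, so it adds exactly \<open>d0\<close> to the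
    integral.\<close>
  define d where "d = d0 / M"
  have d: "d > 0" using \<open>d0 > 0\<close> \<open>M > 0\<close> by (simp add: d_def)
  have "uniformly_continuous_on (cball 0 (R'+1)) p"
    by (intro compact_uniformly_continuous continuous_on_subset[OF cp]) auto
  then obtain e0 where e0: "e0 > 0" "\<And>x y. x \<in> cball 0 (R'+1) \<Longrightarrow> y \<in> cball 0 (R'+1) \<Longrightarrow> dist x y < e0 \<Longrightarrow> dist (p x) (p y) < d"
    unfolding uniformly_continuous_on_def using d by metis
  define e where "e = min e0 1"
  have e: "e > 0" "e \<le> e0" "e \<le> 1" using e0 by (auto simp: e_def)
  define F where "F = (\<lambda>z. f z + e * (norm (p z) + d) * indicator (ball 0 R') z)"
  have [measurable]: "ball 0 R' \<in> sets borel" for R' :: real and z :: complex by simp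
  have [measurable]: "F \<in> borel_measurable borel" unfolding F_def
    by (intro borel_measurable_add borel_measurable_times borel_measurable_indicator) auto
  have nb: "f x \<le> F (x + y)" if "f x > 0" "norm y < e" for x y
  proof -
    have x: "norm x < R" using that(1) bd[of x] by fastforce
    have z: "x + y \<in> ball 0 R'" using x that(2) e norm_triangle_ineq[of x y] by (simp add: R'_def)
    have "norm (f x - f (x + y)) \<le> (norm (p (x + y)) + d) * norm (x - (x + y))"
    proof (rule differentiable_bound[where S="ball (x + y) e" and f'="\<lambda>w v. p w \<bullet> v"])
      show "(f has_derivative (\<lambda>v. p w \<bullet> v)) (at w within ball (x + y) e)" for w
        by (rule has_derivative_at_withinI[OF der])
      show "onorm (\<lambda>v. p w \<bullet> v) \<le> norm (p (x + y)) + d" if "w \<in> ball (x + y) e" for w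
      proof -
        have "norm w \<le> norm (x + y) + norm (w - (x + y))" by (metis norm_triangle_sub)
        moreover have "norm (w - (x + y)) < e" "norm (x + y) < R'"
          using that z by (simp_all add: dist_norm norm_minus_commute add.commute)
        ultimately have "norm w \<le> R' + 1" "norm (x + y) \<le> R' + 1" using e by linarith+
        then have "w \<in> cball 0 (R' + 1)" "x + y \<in> cball 0 (R' + 1)" by auto
        then have "dist (p w) (p (x + y)) < d"
          using e0(2) that e by (auto simp: dist_commute)
        then have "norm (p w) \<le> norm (p (x + y)) + d"
          using norm_triangle_sub[of "p w" "p (x + y)"] by (simp add: dist_norm)
        then show ?thesis
          by (intro onorm_le) (metis Cauchy_Schwarz_ineq2 mult_right_mono norm_ge_zero order_trans real_norm_def)
      qed
    qed (use that e in \<open>auto simp: dist_norm\<close>)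
    also have "\<dots> \<le> (norm (p (x + y)) + d) * e"
      using that d by (intro mult_left_mono) auto
    finally show "f x \<le> F (x + y)" using z by (simp add: F_def mult.commute)
  qed
  have "(\<integral>\<^sup>+z. ennreal (f z) \<partial>lborel) + ennreal (2 * e * sqrt (pi * measure lborel {z. f z \<ge> 1}))
    \<le> (\<integral>\<^sup>+z. ennreal (F z) \<partial>lborel)"
    using bd nb e by (intro nn_integral_add_lborel_ge[OF cf nn, where R=R']) (auto simp: F_def R'_def)
  also have "\<dots> \<le> (\<integral>\<^sup>+z. ennreal (f z) + ennreal e * (ennreal (norm (p z)) + ennreal d * indicator (ball 0 R') z) \<partial>lborel)"
  proof (intro nn_integral_mono)
    fix z
    have "F z \<le> f z + e * (norm (p z) + d * indicator (ball 0 R') z)"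
      using e d by (auto simp: F_def indicator_def)
    then have "ennreal (F z) \<le> ennreal (f z + e * (norm (p z) + d * indicator (ball 0 R') z))" by (rule ennreal_leI)
    also have "\<dots> = ennreal (f z) + ennreal e * (ennreal (norm (p z)) + ennreal d * indicator (ball 0 R') z)"
      using e d nn by (auto simp: indicator_def ennreal_mult)
    finally show "ennreal (F z) \<le> ennreal (f z) + ennreal e * (ennreal (norm (p z)) + ennreal d * indicator (ball 0 R') z)" .
  qed
  also have "\<dots> = (\<integral>\<^sup>+z. ennreal (f z) \<partial>lborel) + ennreal e * ((\<integral>\<^sup>+z. ennreal (norm (p z)) \<partial>lborel) + ennreal d * ennreal M)"
    by (simp add: nn_integral_add nn_integral_cmult nn_integral_cmult_indicator M)
  also have "ennreal d * ennreal M = ennreal d0"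
    using d \<open>M > 0\<close> by (simp add: ennreal_mult[symmetric] d_def)
  finally have *: "(\<integral>\<^sup>+z. ennreal (f z) \<partial>lborel) + ennreal (2 * e * sqrt (pi * measure lborel {z. f z \<ge> 1}))
    \<le> (\<integral>\<^sup>+z. ennreal (f z) \<partial>lborel) + ennreal e * ((\<integral>\<^sup>+z. ennreal (norm (p z)) \<partial>lborel) + ennreal d0)" .
  \<comment> \<open>Finiteness is what permits cancelling this integral in
    \<open>ennreal\<close>.\<close>
  have fin: "(\<integral>\<^sup>+z. ennreal (f z) \<partial>lborel) < top"
  proof -
    have "compact (f ` cball 0 R)" by (intro compact_continuous_image continuous_on_subset[OF cf]) auto
    then obtain B where B: "\<And>z. z \<in> cball 0 R \<Longrightarrow> norm (f z) \<le> B"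
      using compact_imp_bounded[of "f ` cball 0 R"] unfolding bounded_iff by blast
    have le: "ennreal (f z) \<le> ennreal B * indicator (cball 0 R) z" for z
      using B[of z] bd[of z] by (auto simp: indicator_def intro!: ennreal_leI)
    have "(\<integral>\<^sup>+z. ennreal (f z) \<partial>lborel) \<le> (\<integral>\<^sup>+(z::complex). ennreal B * indicator (cball 0 R) z \<partial>lborel)"
      by (intro nn_integral_mono le)
    also have "\<dots> < top" using emeasure_bounded_finite[OF bounded_cball, of "0::complex" R]
      by (simp add: nn_integral_cmult_indicator ennreal_mult_less_top)
    finally show ?thesis .
  qed
  have "ennreal e * ennreal (2 * sqrt (pi * measure lborel {z. f z \<ge> 1}))
     \<le> ennreal e * ((\<integral>\<^sup>+z. ennreal (norm (p z)) \<partial>lborel) + ennreal d0)"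
    using * less_imp_neq[OF fin] e by (simp add: ennreal_add_left_cancel_le ennreal_mult[symmetric] mult.assoc mult.left_commute)
  then show "ennreal (2 * sqrt (pi * measure lborel {z. f z \<ge> 1})) \<le> (\<integral>\<^sup>+z. ennreal (norm (p z)) \<partial>lborel) + ennreal d0"
    using e by (subst (asm) ennreal_mult_le_mult_iff) auto
qed

section \<open>Spline cutoffs\<close>

lemma continuous_on_compact_bounded:
  fixes f :: "'a::topological_space \<Rightarrow> 'b::real_normed_vector"
  assumes "compact S" "continuous_on S f"
  shows "\<exists>B\<ge>0. \<forall>x\<in>S. norm (f x) \<le> B"
proof -
  have "bounded (f ` S)" using assms by (intro compact_imp_bounded compact_continuous_image)
  then obtain B where "\<forall>x\<in>S. norm (f x) \<le> B" by (auto simp: bounded_iff)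
  then show ?thesis by (intro exI[of _ "max B 0"]) (auto simp: le_max_iff_disj)
qed

text \<open>The exponents start at 2 because the truncated first power has a kink at 0.\<close>

lemma DERIV_max_power:
  "((\<lambda>x::real. max 0 x ^ Suc (Suc k)) has_real_derivative real (k + 2) * max 0 x ^ Suc k) (at x)"
proof -
  consider "x < 0" | "x > 0" | "x = 0" by linarith
  then show ?thesis
  proof cases
    case 1
    have "((\<lambda>x::real. 0) has_real_derivative 0) (at x)" by simp
    then have "((\<lambda>x::real. max 0 x ^ Suc (Suc k)) has_real_derivative 0) (at x)"
      by (rule has_field_derivative_transform_within_open[where S="{..<0}"]) (use 1 in auto)
    then show ?thesis using 1 by simp
  next
    case 2
    have "((\<lambda>x::real. x ^ Suc (Suc k)) has_real_derivative real (k + 2) * x ^ Suc k) (at x)"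
      using DERIV_pow[of "Suc (Suc k)" x] by simp
    then have "((\<lambda>x::real. max 0 x ^ Suc (Suc k)) has_real_derivative real (k + 2) * x ^ Suc k) (at x)"
      by (rule has_field_derivative_transform_within_open[where S="{0<..}"]) (use 2 in auto)
    then show ?thesis using 2 by simp
  next
    case 3
    have "((\<lambda>h::real. max 0 h ^ Suc (Suc k) / h) \<longlongrightarrow> 0) (at 0)"
    proof (rule Lim_null_comparison)
      show "\<forall>\<^sub>F h in at (0::real). norm (max 0 h ^ Suc (Suc k) / h) \<le> max 0 h ^ Suc k"
        by (auto simp: eventually_at_filter max_def intro!: always_eventually)
      have "((\<lambda>h::real. max 0 h ^ Suc k) \<longlongrightarrow> max 0 0 ^ Suc k) (at 0)" by (intro tendsto_intros)
      then show "((\<lambda>h::real. max 0 h ^ Suc k) \<longlongrightarrow> 0) (at 0)" by simp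
    qed
    then show ?thesis using 3 by (simp add: DERIV_def)
  qed
qed

text \<open>\<open>spline 3\<close> is a \<open>C\<^sup>2\<close> step from \<open>0\<close> to \<open>1\<close> on \<open>[0, 3]\<close>: the primitive of the quadratic B-spline
  \<open>spline 2\<close>. Its primitive \<open>spline 4\<close> is \<open>x - 3/2\<close> for \<open>x \<ge> 3\<close>.\<close>

definition spline :: "nat \<Rightarrow> real \<Rightarrow> real" where
  "spline k x = (max 0 x ^ k - 3 * max 0 (x - 1) ^ k + 3 * max 0 (x - 2) ^ k - max 0 (x - 3) ^ k) / fact k"

lemma DERIV_spline:
  "(spline (Suc (Suc k)) has_real_derivative spline (Suc k) x) (at x)"
proof -
  have *: "((\<lambda>x::real. max 0 (x - c) ^ Suc (Suc k)) has_real_derivative real (k + 2) * max 0 (x - c) ^ Suc k) (at x)" for c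
  proof -
    have "((\<lambda>x. x - c) has_real_derivative 1) (at x)" by (auto intro!: derivative_eq_intros)
    from DERIV_chain2[where f="\<lambda>x. max 0 x ^ Suc (Suc k)" and g="\<lambda>x. x - c", OF DERIV_max_power[of k "x - c"] this]
    show ?thesis by (simp only: mult_1_right)
  qed
  have "((\<lambda>x. (max 0 (x - 0) ^ Suc (Suc k) - 3 * max 0 (x - 1) ^ Suc (Suc k) + 3 * max 0 (x - 2) ^ Suc (Suc k)
       - max 0 (x - 3) ^ Suc (Suc k)) / fact (Suc (Suc k))) has_real_derivative
    (real (k + 2) * max 0 (x - 0) ^ Suc k - 3 * (real (k + 2) * max 0 (x - 1) ^ Suc k)
       + 3 * (real (k + 2) * max 0 (x - 2) ^ Suc k) - real (k + 2) * max 0 (x - 3) ^ Suc k) / fact (Suc (Suc k))) (at x)"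
    by (intro DERIV_cdivide DERIV_diff DERIV_add DERIV_cmult *)
  moreover have "(real (k + 2) * a - 3 * (real (k + 2) * b) + 3 * (real (k + 2) * c) - real (k + 2) * d) / fact (Suc (Suc k))
     = (a - 3 * b + 3 * c - d) / fact (Suc k)" for a b c d :: real
  proof -
    have "fact (Suc (Suc k)) = real (k + 2) * fact (Suc k)" by (simp add: algebra_simps)
    moreover have "real (k + 2) * a - 3 * (real (k + 2) * b) + 3 * (real (k + 2) * c) - real (k + 2) * d
      = real (k + 2) * (a - 3 * b + 3 * c - d)" by (simp add: algebra_simps)
    ultimately show ?thesis by (metis mult_divide_mult_cancel_left of_nat_0_eq_iff add_is_0 zero_neq_numeral)
  qed
  ultimately show ?thesis unfolding spline_def[abs_def] by simp
qed

lemma continuous_spline [continuous_intros]: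
  "continuous_on S f \<Longrightarrow> continuous_on S (\<lambda>x. spline k (f x))"
  unfolding spline_def by (intro continuous_intros) auto

lemma spline_le_0: "x \<le> 0 \<Longrightarrow> k > 0 \<Longrightarrow> spline k x = 0"
  by (simp add: spline_def)

text \<open>Beyond the last knot all truncations disappear and a third finite difference remains. It
  annihilates quadratics and turns \<open>x^3 / 3!\<close> into 1 and \<open>x^4 / 4!\<close> into
  \<open>x - 3/2\<close>.\<close>

lemma spline_ge_3:
  assumes "x \<ge> 3"
  shows "spline 2 x = 0" "spline 3 x = 1" "spline 4 x = x - 3/2"
  using assms by (simp_all add: spline_def max_def fact_numeral power2_eq_square power3_eq_cube power4_eq_xxxx
      field_simps)

lemma spline_2_nonneg: "spline 2 x \<ge> 0"
proof -
  consider "x \<le> 0" | "0 < x" "x \<le> 1" | "1 < x" "x \<le> 2" | "2 < x" "x < 3" | "x \<ge> 3" by linarith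
  then show ?thesis
  proof cases
    case 3
    have "spline 2 x = (3/2 - 2 * (x - 3/2)\<^sup>2) / 2" using 3
      by (simp add: spline_def max_def power2_eq_square field_simps)
    moreover have "(x - 3/2)\<^sup>2 \<le> (1/2)\<^sup>2" using 3 by (intro power2_le_iff_abs_le[THEN iffD2]) (auto simp: abs_if)
    ultimately show ?thesis by (simp add: power2_eq_square)
  next
    case 4
    have "spline 2 x = (x - 3)\<^sup>2 / 2" using 4
      by (simp add: spline_def max_def power2_eq_square field_simps)
    also have "\<dots> \<ge> 0" by simp
    finally show ?thesis .
  qed (auto simp: spline_le_0 spline_ge_3, simp_all add: spline_def max_def)
qed

lemma DERIV_spline_3: "(spline 3 has_real_derivative spline 2 x) (at x)"
  and DERIV_spline_4: "(spline 4 has_real_derivative spline 3 x) (at x)"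
  and DERIV_spline_2: "(spline 2 has_real_derivative spline 1 x) (at x)"
  using DERIV_spline[of 1 x] DERIV_spline[of 2 x] DERIV_spline[of 0 x] by (simp_all add: numeral_eq_Suc)

lemma spline_mono_3:
  assumes "x \<le> y"
  shows "spline 3 x \<le> spline 3 y"
  by (rule DERIV_nonneg_imp_nondecreasing[OF assms]) (use DERIV_spline_3 spline_2_nonneg in blast)

lemma spline_3_bounds: "0 \<le> spline 3 x" "spline 3 x \<le> 1"
proof -
  show "0 \<le> spline 3 x" using spline_mono_3[of "min x 0" x] spline_le_0[of "min x 0" 3] by simp
  show "spline 3 x \<le> 1" using spline_mono_3[of x "max x 3"] spline_ge_3(2)[of "max x 3"] by simp
qed

lemma spline_bounded:
  assumes "k \<in> {1, 2}"
  obtains B where "B > 0" "\<And>x. \<bar>spline k x\<bar> \<le> B"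
proof -
  obtain B where B: "\<forall>x\<in>{0..3}. norm (spline k x) \<le> B"
    using continuous_on_compact_bounded[OF _ continuous_spline[OF continuous_on_id], of "{0..3}" k]
    by auto
  have "\<bar>spline k x\<bar> \<le> max B 1" for x
  proof (cases "x \<in> {0..3}")
    case False
    then have "x \<le> 0 \<or> x \<ge> 3" by auto
    then have "spline k x = 0" using assms spline_le_0[of x k] spline_ge_3[of x]
      by (auto simp: spline_def)
    then show ?thesis by simp
  qed (use B in \<open>auto simp: le_max_iff_disj\<close>)
  then show thesis by (intro that[of "max B 1"]) auto
qed

text \<open>Translation invariance of Lebesgue measure, applied to difference quotients, replaces Fubini.\<close>

lemma integral_deriv_compact_support:
  fixes f f' :: "complex \<Rightarrow> real"
  assumes der: "\<And>z. ((\<lambda>t. f (z + t *\<^sub>R v)) has_real_derivative f' z) (at 0)"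
    and cf: "continuous_on UNIV f" and cf': "continuous_on UNIV f'"
    and bd: "\<And>z. norm z \<ge> R \<Longrightarrow> f z = 0"
  shows "integrable lborel f'" "(\<integral>z. f' z \<partial>lborel) = 0"
proof -
  have [measurable]: "f \<in> borel_measurable borel" "f' \<in> borel_measurable borel"
    using cf cf' by (auto intro: borel_measurable_continuous_onI)
  \<comment> \<open>Outside radius \<open>R1\<close> both ends of every difference quotient have
    norm at least \<open>R\<close>. Inside, the mean value point may move by \<open>norm v\<close>,
    hence the larger ball in the bound \<open>B0\<close>.\<close>
  define R1 where "R1 = \<bar>R\<bar> + norm v + 1"
  obtain B0 where B0: "\<And>z. z \<in> cball 0 (R1 + norm v) \<Longrightarrow> \<bar>f' z\<bar> \<le> B0"
    using continuous_on_compact_bounded[OF compact_cball continuous_on_subset[OF cf']]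
    by (metis real_norm_def subset_UNIV)
  define B where "B = max B0 0"
  have der': "((\<lambda>t. f (z + t *\<^sub>R v)) has_real_derivative f' (z + s *\<^sub>R v)) (at s)" for z s
  proof -
    have "((\<lambda>t. f (z + s *\<^sub>R v + (t - s) *\<^sub>R v)) has_real_derivative f' (z + s *\<^sub>R v) * 1) (at s)"
      using der[of "z + s *\<^sub>R v"]
      by (intro DERIV_chain2[where f="\<lambda>t. f (z + s *\<^sub>R v + t *\<^sub>R v)" and g="\<lambda>t. t - s"])
        (auto intro!: derivative_eq_intros)
    then show ?thesis by (simp add: algebra_simps)
  qed
  define h where "h = (\<lambda>n::nat. 1 / real (Suc n))"
  have h: "h n > 0" "h n \<le> 1" for n by (auto simp: h_def)
  define q where "q = (\<lambda>n z. (f (z + h n *\<^sub>R v) - f z) / h n)"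
  have [measurable]: "q n \<in> borel_measurable lborel" for n unfolding q_def by measurable
  have f'0: "f' z = 0" if "norm z > R1" for z
  proof -
    have "((\<lambda>t. f (z + t *\<^sub>R v)) has_real_derivative 0) (at 0)"
    proof (rule has_field_derivative_transform_within[of "\<lambda>_. 0" _ _ _ 1])
      fix t :: real assume "dist t 0 < 1"
      then have "norm (t *\<^sub>R v) \<le> norm v" by (auto intro: mult_left_le_one_le)
      then have "norm (z + t *\<^sub>R v) \<ge> R" using that norm_diff_ineq[of z "t *\<^sub>R v"] by (simp add: R1_def)
      then show "0 = f (z + t *\<^sub>R v)" using bd by simp
    qed auto
    then show ?thesis using der[of z] DERIV_unique by blast
  qed
  have qb: "norm (q n z) \<le> B * indicator (cball 0 R1) z" for n z
  proof (cases "z \<in> cball 0 R1")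
    case True
    have "\<exists>s. 0 < s \<and> s < h n \<and> f (z + h n *\<^sub>R v) - f (z + 0 *\<^sub>R v) = (h n - 0) * f' (z + s *\<^sub>R v)"
      by (rule MVT2) (use h der' in auto)
    then obtain s where s: "0 < s" "s < h n" "f (z + h n *\<^sub>R v) - f z = h n * f' (z + s *\<^sub>R v)" by auto
    have "norm (s *\<^sub>R v) \<le> norm v" using s h[of n] by (auto intro: mult_left_le_one_le)
    then have "z + s *\<^sub>R v \<in> cball 0 (R1 + norm v)" using True norm_triangle_ineq[of z "s *\<^sub>R v"] by auto
    then have "\<bar>f' (z + s *\<^sub>R v)\<bar> \<le> B" using B0 by (simp add: B_def le_max_iff_disj)
    moreover have "q n z = f' (z + s *\<^sub>R v)" using s h[of n] by (simp add: q_def)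
    ultimately show ?thesis using True by simp
  next
    case False
    have "norm (h n *\<^sub>R v) \<le> norm v" using h[of n] by (auto intro: mult_left_le_one_le)
    moreover have "norm z > R1" using False by simp
    ultimately have "norm (z + h n *\<^sub>R v) \<ge> R" "norm z \<ge> R"
      using norm_diff_ineq[of z "h n *\<^sub>R v"] norm_ge_zero[of v] unfolding R1_def by linarith+
    then show ?thesis using False bd by (simp add: q_def)
  qed
  have iB: "integrable lborel (\<lambda>z::complex. B * indicator (cball 0 R1) z)"
    by (intro integrable_mult_right integrable_real_indicator) (use emeasure_lborel_cball_finite in auto)
  have lim: "(\<lambda>n. q n z) \<longlonglongrightarrow> f' z" for z
  proof -
    have "h \<longlonglongrightarrow> 0" using LIMSEQ_inverse_real_of_nat by (simp add: h_def[abs_def] inverse_eq_divide)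
    then have "filterlim h (at 0) sequentially"
      unfolding filterlim_at using h(1) by (auto intro!: always_eventually simp: less_imp_neq[THEN not_sym])
    from filterlim_compose[OF der[of z, unfolded DERIV_def] this]
    show ?thesis by (simp add: q_def)
  qed
  have dc: "integrable lborel f' \<and> (\<lambda>n. \<integral>z. q n z \<partial>lborel) \<longlonglongrightarrow> (\<integral>z. f' z \<partial>lborel)"
    using integrable_dominated_convergence[of f' lborel q, OF _ _ iB AE_I2[OF lim] AE_I2[OF qb]]
      integral_dominated_convergence[of f' lborel q, OF _ _ iB AE_I2[OF lim] AE_I2[OF qb]]
    by simp
  then show "integrable lborel f'" ..
  from dc have "(\<lambda>n. \<integral>z. q n z \<partial>lborel) \<longlonglongrightarrow> (\<integral>z. f' z \<partial>lborel)" ..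
  moreover have "(\<integral>z. q n z \<partial>lborel) = 0" for n
  proof -
    obtain M where M: "\<And>z. z \<in> cball 0 R \<Longrightarrow> \<bar>f z\<bar> \<le> M"
      using continuous_on_compact_bounded[OF compact_cball continuous_on_subset[OF cf]]
      by (metis real_norm_def subset_UNIV)
    have f: "integrable lborel f"
    proof (rule Bochner_Integration.integrable_bound[of _ "\<lambda>z::complex. M * indicator (cball 0 R) z"])
      show "AE z in lborel. norm (f z) \<le> norm (M * indicator (cball 0 R) z)"
      proof (intro AE_I2)
        fix z show "norm (f z) \<le> norm (M * indicator (cball 0 R) z)"
          using M[of z] bd[of z] by (cases "norm z \<le> R") auto
      qed
    qed (use emeasure_lborel_cball_finite in \<open>auto intro!: integrable_mult_right integrable_real_indicator\<close>)
    have d: "lborel = distr lborel borel (\<lambda>z. z + h n *\<^sub>R v)"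
    proof -
      have "(\<lambda>z. z + h n *\<^sub>R v) = (+) (h n *\<^sub>R v)" by (auto simp: add.commute)
      then show ?thesis by (simp add: lborel_distr_plus)
    qed
    have "(\<integral>z. f z \<partial>lborel) = (\<integral>z. f (z + h n *\<^sub>R v) \<partial>lborel)"
      by (subst d, subst integral_distr) auto
    moreover have "integrable lborel (\<lambda>z. f (z + h n *\<^sub>R v))"
      using f by (subst (asm) d) (simp add: integrable_distr_eq)
    ultimately show ?thesis using f by (simp add: q_def)
  qed
  ultimately show "(\<integral>z. f' z \<partial>lborel) = 0" by (simp add: LIMSEQ_const_iff)
qed

section \<open>Gradients, Laplacians and the Green identity\<close>

text \<open>Gradients are complex numbers: \<open>p\<close> is the gradient of \<open>f\<close> and \<open>p'\<close> the derivative of \<open>p\<close>,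
  so that \<open>tr (p' z)\<close> is the Laplacian of \<open>f\<close> at \<open>z\<close>.\<close>

definition C2_grad :: "complex set \<Rightarrow> (complex \<Rightarrow> real) \<Rightarrow> (complex \<Rightarrow> complex) \<Rightarrow> (complex \<Rightarrow> complex \<Rightarrow> complex) \<Rightarrow> bool" where
  "C2_grad S f p p' \<longleftrightarrow>
     (\<forall>z\<in>S. (f has_derivative (\<lambda>v. p z \<bullet> v)) (at z)) \<and>
     (\<forall>z\<in>S. (p has_derivative p' z) (at z)) \<and>
     (\<forall>v. continuous_on S (\<lambda>z. p' z v))"

definition tr :: "(complex \<Rightarrow> complex) \<Rightarrow> real" where
  "tr L = Re (L 1) + Im (L \<i>)"

lemma C2_gradD:
  assumes "C2_grad S f p p'"
  shows "z \<in> S \<Longrightarrow> (f has_derivative (\<lambda>v. p z \<bullet> v)) (at z)"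
    "z \<in> S \<Longrightarrow> (p has_derivative p' z) (at z)"
    "continuous_on S (\<lambda>z. p' z v)"
    "continuous_on S f" "continuous_on S p" "continuous_on S (\<lambda>z. tr (p' z))"
    "z \<in> S \<Longrightarrow> linear (p' z)"
proof -
  have 1: "z \<in> S \<Longrightarrow> (f has_derivative (\<lambda>v. p z \<bullet> v)) (at z)" for z
    using assms by (auto simp: C2_grad_def)
  have 2: "z \<in> S \<Longrightarrow> (p has_derivative p' z) (at z)" for z
    using assms by (auto simp: C2_grad_def)
  have 3: "continuous_on S (\<lambda>z. p' z v)" for v
    using assms by (auto simp: C2_grad_def)
  show "z \<in> S \<Longrightarrow> (f has_derivative (\<lambda>v. p z \<bullet> v)) (at z)" "z \<in> S \<Longrightarrow> (p has_derivative p' z) (at z)"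
    "continuous_on S (\<lambda>z. p' z v)" by (fact 1 2 3)+
  show "continuous_on S f" "continuous_on S p"
    using 1 2 by (auto intro!: continuous_at_imp_continuous_on has_derivative_continuous)
  show "continuous_on S (\<lambda>z. tr (p' z))" unfolding tr_def by (intro continuous_intros 3)
  show "z \<in> S \<Longrightarrow> linear (p' z)" using 2 has_derivative_linear by blast
qed

lemma C2_grad_subset: "C2_grad S f p p' \<Longrightarrow> T \<subseteq> S \<Longrightarrow> C2_grad T f p p'"
  unfolding C2_grad_def by (meson continuous_on_subset subsetD)

lemma C2_grad_transform:
  assumes "C2_grad S f p p'" "open S" "\<And>z. z \<in> S \<Longrightarrow> g z = f z"
  shows "C2_grad S g p p'"
  unfolding C2_grad_def using C2_gradD[OF assms(1)] assms(2,3)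
  by (auto intro!: has_derivative_transform_within_open[OF C2_gradD(1)[OF assms(1)] assms(2)])

lemma C2_grad_add:
  assumes "C2_grad S f p p'" "C2_grad S g q q'"
  shows "C2_grad S (\<lambda>z. f z + g z) (\<lambda>z. p z + q z) (\<lambda>z v. p' z v + q' z v)"
  using assms unfolding C2_grad_def
  by (auto intro!: derivative_eq_intros continuous_intros simp: inner_add_left)

lemma C2_grad_cmult:
  assumes "C2_grad S f p p'"
  shows "C2_grad S (\<lambda>z. k * f z) (\<lambda>z. k *\<^sub>R p z) (\<lambda>z v. k *\<^sub>R p' z v)"
  using assms unfolding C2_grad_def
  by (auto intro!: derivative_eq_intros continuous_intros)

lemma C2_grad_const: "C2_grad S (\<lambda>z. k) (\<lambda>z. 0) (\<lambda>z v. 0)"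
proof -
  have "(\<bullet>) 0 = (\<lambda>v::complex. 0::real)" by auto
  then show ?thesis unfolding C2_grad_def by auto
qed

lemma C2_grad_sum:
  assumes "\<And>i. i \<in> I \<Longrightarrow> C2_grad S (f i) (p i) (p' i)"
  shows "C2_grad S (\<lambda>z. \<Sum>i\<in>I. f i z) (\<lambda>z. \<Sum>i\<in>I. p i z) (\<lambda>z v. \<Sum>i\<in>I. p' i z v)"
  using assms
proof (induction I rule: infinite_finite_induct)
  case (insert i I)
  then show ?case using C2_grad_add[of S "f i" "p i" "p' i"] by simp
qed (simp_all add: C2_grad_const)

lemma tr_add: "tr (\<lambda>v. f v + g v) = tr f + tr g"
  and tr_scale: "tr (\<lambda>v. k *\<^sub>R f v) = k * tr f"
  and tr_sum: "tr (\<lambda>v. \<Sum>i\<in>I. h i v) = (\<Sum>i\<in>I. tr (h i))"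
  by (simp_all add: tr_def algebra_simps Re_sum Im_sum sum.distrib)

lemma C2_grad_compose_real:
  assumes "C2_grad S f p p'"
    and d1: "\<And>x. x \<in> f ` S \<Longrightarrow> (\<phi> has_real_derivative \<phi>1 x) (at x)"
    and d2: "\<And>x. x \<in> f ` S \<Longrightarrow> (\<phi>1 has_real_derivative \<phi>2 x) (at x)"
    and c2: "continuous_on (f ` S) \<phi>2"
  shows "C2_grad S (\<lambda>z. \<phi> (f z)) (\<lambda>z. \<phi>1 (f z) *\<^sub>R p z)
     (\<lambda>z v. (\<phi>2 (f z) * (p z \<bullet> v)) *\<^sub>R p z + \<phi>1 (f z) *\<^sub>R p' z v)"
proof -
  note D = C2_gradD[OF assms(1)]
  have h1: "((\<lambda>z. \<phi> (f z)) has_derivative (\<lambda>v. \<phi>1 (f z) * (p z \<bullet> v))) (at z)" if "z \<in> S" for z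
    using has_derivative_compose[OF D(1)[OF that] d1[unfolded has_field_derivative_def, of "f z"]] that by simp
  have h2: "((\<lambda>z. \<phi>1 (f z)) has_derivative (\<lambda>v. \<phi>2 (f z) * (p z \<bullet> v))) (at z)" if "z \<in> S" for z
    using has_derivative_compose[OF D(1)[OF that] d2[unfolded has_field_derivative_def, of "f z"]] that by simp
  have c1: "continuous_on (f ` S) \<phi>1" using d2 by (intro continuous_at_imp_continuous_on) (auto intro: DERIV_isCont)
  show ?thesis unfolding C2_grad_def
  proof (intro conjI ballI allI)
    fix z assume z: "z \<in> S"
    show "((\<lambda>z. \<phi> (f z)) has_derivative (\<lambda>v. (\<phi>1 (f z) *\<^sub>R p z) \<bullet> v)) (at z)" using h1[OF z] by simp
    show "((\<lambda>z. \<phi>1 (f z) *\<^sub>R p z) has_derivative (\<lambda>v. (\<phi>2 (f z) * (p z \<bullet> v)) *\<^sub>R p z + \<phi>1 (f z) *\<^sub>R p' z v)) (at z)"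
      using has_derivative_scaleR[OF h2[OF z] D(2)[OF z]] by (simp add: add.commute)
  next
    fix v
    show "continuous_on S (\<lambda>z. (\<phi>2 (f z) * (p z \<bullet> v)) *\<^sub>R p z + \<phi>1 (f z) *\<^sub>R p' z v)"
      by (intro continuous_intros D continuous_on_compose2[OF c2] continuous_on_compose2[OF c1]) auto
  qed
qed

text \<open>The Laplacian of a composition is \<open>\<phi>''(f) |grad f|^2 + \<phi>'(f)\<close>
  times the Laplacian of \<open>f\<close>. For a truncation of \<open>U\<close> the first term
  becomes the energy concentrated near a level.\<close>

lemma tr_compose_real:
  "tr (\<lambda>v. (a * (q \<bullet> v)) *\<^sub>R q + b *\<^sub>R L v) = a * (norm q)\<^sup>2 + b * tr L"
  by (simp add: tr_def cmod_power2 inner_complex_def algebra_simps) (simp add: power2_eq_square algebra_simps)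

lemma linear_complex_decomp:
  fixes L :: "complex \<Rightarrow> 'a::real_vector"
  assumes "linear L"
  shows "L v = Re v *\<^sub>R L 1 + Im v *\<^sub>R L \<i>"
proof -
  have "v = Re v *\<^sub>R 1 + Im v *\<^sub>R \<i>" by (simp add: complex_eq_iff)
  then have "L v = L (Re v *\<^sub>R 1 + Im v *\<^sub>R \<i>)" by (rule arg_cong)
  also have "\<dots> = Re v *\<^sub>R L 1 + Im v *\<^sub>R L \<i>"
    by (simp only: linear_add[OF assms] linear_cmul[OF assms])
  finally show ?thesis .
qed

text \<open>Multiplication by \<open>cnj (deriv h z)\<close> is the adjoint of multiplication by
  \<open>deriv h z\<close>, which explains the gradient; the product rule then produces the term
  with the second derivative of \<open>h\<close>.\<close>

lemma C2_grad_compose_holo: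
  assumes C: "C2_grad S f p p'" and h: "h holomorphic_on T" "open T" "h ` T \<subseteq> S"
  shows "C2_grad T (\<lambda>z. f (h z)) (\<lambda>z. cnj (deriv h z) * p (h z))
     (\<lambda>z v. cnj (deriv (deriv h) z * v) * p (h z) + cnj (deriv h z) * p' (h z) (deriv h z * v))"
proof -
  note D = C2_gradD[OF C]
  have hd: "(h has_derivative (\<lambda>v. deriv h z * v)) (at z)" if "z \<in> T" for z
    using holomorphic_derivI[OF h(1,2) that] by (simp add: has_field_derivative_def)
  have hh: "deriv h holomorphic_on T" using h by (simp add: holomorphic_deriv)
  have hd2: "(deriv h has_derivative (\<lambda>v. deriv (deriv h) z * v)) (at z)" if "z \<in> T" for z
    using holomorphic_derivI[OF hh h(2) that] by (simp add: has_field_derivative_def)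
  have c0: "continuous_on T h" and c1: "continuous_on T (deriv h)" and c2: "continuous_on T (deriv (deriv h))"
    using h hh by (auto intro!: holomorphic_on_imp_continuous_on holomorphic_deriv)
  show ?thesis unfolding C2_grad_def
  proof (intro conjI ballI allI)
    fix z assume z: "z \<in> T"
    then have hz: "h z \<in> S" using h by auto
    have "((\<lambda>z. f (h z)) has_derivative (\<lambda>v. p (h z) \<bullet> (deriv h z * v))) (at z)"
      using has_derivative_compose[OF hd[OF z] D(1)[OF hz]] .
    moreover have "p (h z) \<bullet> (deriv h z * v) = (cnj (deriv h z) * p (h z)) \<bullet> v" for v
      by (simp add: inner_complex_def algebra_simps)
    ultimately show "((\<lambda>z. f (h z)) has_derivative (\<lambda>v. (cnj (deriv h z) * p (h z)) \<bullet> v)) (at z)" by simp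
    have "((\<lambda>z. cnj (deriv h z)) has_derivative (\<lambda>v. cnj (deriv (deriv h) z * v))) (at z)"
      by (rule bounded_linear.has_derivative[OF bounded_linear_cnj hd2[OF z]])
    from has_derivative_mult[OF this has_derivative_compose[OF hd[OF z] D(2)[OF hz]]]
    show "((\<lambda>z. cnj (deriv h z) * p (h z)) has_derivative
       (\<lambda>v. cnj (deriv (deriv h) z * v) * p (h z) + cnj (deriv h z) * p' (h z) (deriv h z * v))) (at z)"
      by (simp add: add.commute)
  next
    fix v
    have eq: "p' (h z) (deriv h z * v) = Re (deriv h z * v) *\<^sub>R p' (h z) 1 + Im (deriv h z * v) *\<^sub>R p' (h z) \<i>"
      if "z \<in> T" for z
      by (rule linear_complex_decomp) (use D(7) that h in auto)
    have "continuous_on T (\<lambda>z. cnj (deriv (deriv h) z * v) * p (h z)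
       + cnj (deriv h z) * (Re (deriv h z * v) *\<^sub>R p' (h z) 1 + Im (deriv h z * v) *\<^sub>R p' (h z) \<i>))"
      by (intro continuous_intros c0 c1 c2 continuous_on_compose2[OF D(5) c0 h(3)]
        continuous_on_compose2[OF D(3) c0 h(3)])
    then show "continuous_on T (\<lambda>z. cnj (deriv (deriv h) z * v) * p (h z) + cnj (deriv h z) * p' (h z) (deriv h z * v))"
      by (rule continuous_on_eq) (simp add: eq)
  qed
qed

text \<open>This is the conformal behaviour of the Laplacian. The term with the second derivative of
  the map is antilinear in \<open>v\<close>, hence traceless; composing \<open>L\<close> with
  \<open>a\<close> and with its adjoint scales the trace by \<open>|a|^2\<close>.\<close>

lemma tr_compose_holo:
  assumes "linear L"
  shows "tr (\<lambda>v. cnj (b * v) * q + cnj a * L (a * v)) = (norm a)\<^sup>2 * tr L"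
proof -
  note eq = linear_complex_decomp[OF assms]
  show ?thesis
    by (simp add: tr_def eq[of "\<i> * a"] eq[of "a * \<i>"] eq[of a] cmod_power2 algebra_simps)
      (simp add: power2_eq_square algebra_simps)
qed

text \<open>The gradient \<open>z / |z|^2\<close> is written as \<open>1 / cnj z\<close>, an
  antiholomorphic function. Its derivative is antilinear and therefore traceless, which is the
  harmonicity of \<open>ln |z|\<close>.\<close>

lemma C2_grad_ln_norm:
  "C2_grad (-{0}) (\<lambda>z. ln (norm z)) (\<lambda>z. inverse (cnj z)) (\<lambda>z v. - (inverse (cnj z) * cnj v * inverse (cnj z)))"
  unfolding C2_grad_def
proof (intro conjI ballI allI)
  fix z :: complex assume z: "z \<in> -{0}"
  have "((\<lambda>z. ln (norm z)) has_derivative (\<lambda>v. (v \<bullet> sgn z) / norm z)) (at z)"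
    using z by (auto intro!: derivative_eq_intros has_derivative_norm simp: field_simps)
  moreover have "(v \<bullet> sgn z) / norm z = inverse (cnj z) \<bullet> v" for v
  proof -
    have "cnj z * ((1 / (norm z)\<^sup>2) *\<^sub>R z) = 1"
      using z complex_norm_square[of z] by (simp add: scaleR_conv_of_real field_simps)
    then have "inverse (cnj z) = (1 / (norm z)\<^sup>2) *\<^sub>R z" by (rule inverse_unique)
    then show ?thesis by (simp add: sgn_div_norm inner_commute power2_eq_square field_simps)
  qed
  ultimately show "((\<lambda>z. ln (norm z)) has_derivative (\<lambda>v. inverse (cnj z) \<bullet> v)) (at z)" by simp
  have "(cnj has_derivative cnj) (at z)" by (rule bounded_linear_imp_has_derivative[OF bounded_linear_cnj])
  from Deriv.has_derivative_inverse[OF _ this] z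
  show "((\<lambda>z. inverse (cnj z)) has_derivative (\<lambda>v. - (inverse (cnj z) * cnj v * inverse (cnj z)))) (at z)" by simp
qed (auto intro!: continuous_intros)

lemma tr_ln_norm: "tr (\<lambda>v. - (a * cnj v * a)) = 0"
  by (simp add: tr_def)

lemma C2_grad_norm_square: "C2_grad S (\<lambda>z. (norm z)\<^sup>2) (\<lambda>z. 2 * z) (\<lambda>z v. 2 * v)"
  unfolding C2_grad_def power2_norm_eq_inner
  by (auto intro!: derivative_eq_intros simp: inner_commute inner_complex_def algebra_simps)

lemma integrable_continuous_compact_support:
  fixes f :: "complex \<Rightarrow> real"
  assumes "continuous_on UNIV f" "\<And>z. norm z \<ge> R \<Longrightarrow> f z = 0"
  shows "integrable lborel f"
proof -
  obtain M where M: "\<forall>z\<in>cball 0 R. norm (f z) \<le> M"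
    using continuous_on_compact_bounded[OF compact_cball continuous_on_subset[OF assms(1)]] by blast
  show ?thesis
  proof (rule Bochner_Integration.integrable_bound[of _ "\<lambda>z::complex. M * indicator (cball 0 R) z"])
    show "AE z in lborel. norm (f z) \<le> norm (M * indicator (cball 0 R) z)"
    proof (intro AE_I2)
      fix z show "norm (f z) \<le> norm (M * indicator (cball 0 R) z)"
        using bspec[OF M, of z] assms(2)[of z] by (cases "norm z \<le> R") auto
    qed
  qed (use assms(1) in \<open>auto intro!: integrable_mult_right integrable_real_indicator emeasure_lborel_cball_finite[unfolded infinity_ennreal_def] borel_measurable_continuous_onI\<close>)
qed

text \<open>The field \<open>c p - m q\<close> has compact support, and the products of first
  derivatives cancel in its divergence. Since \<open>c\<close> vanishes near the complement of
  \<open>S\<close>, singularities of \<open>m\<close> there never enter.\<close>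

lemma green_identity:
  assumes m: "C2_grad S m p p'" "open S" and c: "C2_grad UNIV c q q'"
    and N: "open N" "- S \<subseteq> N" "\<And>z. z \<in> N \<Longrightarrow> c z = 0" and R: "\<And>z. norm z \<ge> R \<Longrightarrow> c z = 0"
  shows "integrable lborel (\<lambda>z. c z * tr (p' z))" "integrable lborel (\<lambda>z. m z * tr (q' z))"
    "(\<integral>z. c z * tr (p' z) \<partial>lborel) = (\<integral>z. m z * tr (q' z) \<partial>lborel)"
proof -
  note Dm = C2_gradD[OF m(1)] and Dc = C2_gradD[OF c]
  have zero: "q z = 0 \<and> q' z = (\<lambda>v. 0)" if "open W" "z \<in> W" "\<And>z. z \<in> W \<Longrightarrow> c z = 0" for W z
  proof -
    have q0: "q w = 0" if "w \<in> W" for w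
    proof -
      have "((\<lambda>z. 0) has_derivative (\<lambda>v. q w \<bullet> v)) (at w)"
        using Dc(1)[of w] that \<open>\<And>z. z \<in> W \<Longrightarrow> c z = 0\<close>
        by (auto intro: has_derivative_transform_within_open[OF _ \<open>open W\<close>])
      then have "(\<lambda>v. q w \<bullet> v) = (\<lambda>v. 0)" using has_derivative_unique has_derivative_const by blast
      then show ?thesis by (metis inner_eq_zero_iff)
    qed
    have "((\<lambda>z. 0) has_derivative q' z) (at z)"
      using Dc(2)[of z] that(1,2) q0 by (auto intro: has_derivative_transform_within_open[OF _ \<open>open W\<close>])
    then have "q' z = (\<lambda>v. 0)" using has_derivative_unique has_derivative_const by blast
    then show ?thesis using q0 that by blast
  qed
  have N0: "q z = 0 \<and> q' z = (\<lambda>v. 0)" if "z \<in> N" for z by (rule zero[OF N(1) that N(3)])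
  have R0: "q z = 0 \<and> q' z = (\<lambda>v. 0)" if "norm z \<ge> R + 1" for z
    by (rule zero[of "- cball 0 R"]) (use that R in auto)
  \<comment> \<open>\<open>S\<close> and \<open>N\<close> are open and cover the plane, so a
    function continuous on \<open>S\<close> and zero on \<open>N\<close> is continuous everywhere,
    whatever \<open>m\<close> does outside \<open>S\<close>.\<close>
  have cov: "continuous_on UNIV F" if "continuous_on S F" "\<And>z. z \<in> N \<Longrightarrow> F z = 0" for F :: "complex \<Rightarrow> real"
  proof -
    have "continuous_on N F" by (rule continuous_on_eq[of _ "\<lambda>_. 0"]) (use that in auto)
    then have "continuous_on (S \<union> N) F" using m(2) N(1) that by (intro continuous_on_open_Un)
    moreover have "S \<union> N = UNIV" using N(2) by auto
    ultimately show ?thesis by simp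
  qed
  note cS = continuous_on_subset[OF _ subset_UNIV]
  have "continuous_on UNIV (\<lambda>z. c z * tr (p' z))"
    by (rule cov) (use N(3) in \<open>auto intro!: continuous_intros cS[OF Dc(4)] Dm\<close>)
  then show i1: "integrable lborel (\<lambda>z. c z * tr (p' z))"
    by (rule integrable_continuous_compact_support[of _ R]) (simp add: R)
  have "continuous_on UNIV (\<lambda>z. m z * tr (q' z))"
    by (rule cov) (use N0 in \<open>auto simp: tr_def intro!: continuous_intros cS[OF Dc(3)] Dm\<close>)
  then show i2: "integrable lborel (\<lambda>z. m z * tr (q' z))"
    by (rule integrable_continuous_compact_support[of _ "R + 1"]) (use R0 in \<open>auto simp: tr_def\<close>)
  \<comment> \<open>The divergence is treated one direction at a time: the \<open>v\<close>
    component of the field is differentiated along \<open>v\<close>.\<close>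
  have key: "integrable lborel (\<lambda>z. c z * (p' z v \<bullet> v) - m z * (q' z v \<bullet> v)) \<and>
      (\<integral>z. c z * (p' z v \<bullet> v) - m z * (q' z v \<bullet> v) \<partial>lborel) = 0" for v
  proof -
    define f where "f = (\<lambda>z. c z * (p z \<bullet> v) - m z * (q z \<bullet> v))"
    define f' where "f' = (\<lambda>z. c z * (p' z v \<bullet> v) - m z * (q' z v \<bullet> v))"
    have cf: "continuous_on UNIV f" unfolding f_def
      by (rule cov) (use N0 N in \<open>auto intro!: continuous_intros cS[OF Dc(4)] cS[OF Dc(5)] Dm\<close>)
    have cf': "continuous_on UNIV f'" unfolding f'_def
      by (rule cov) (use N0 N in \<open>auto intro!: continuous_intros cS[OF Dc(4)] cS[OF Dc(3)] Dm\<close>)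
    have f0: "f z = 0" if "norm z \<ge> R + 1" for z using that R R0 by (simp add: f_def)
    have der: "((\<lambda>t. f (z + t *\<^sub>R v)) has_real_derivative f' z) (at 0)" for z
    proof -
      have line: "((\<lambda>t::real. z + t *\<^sub>R v) has_derivative (\<lambda>t. t *\<^sub>R v)) (at 0)" by (auto intro!: derivative_eq_intros)
      have "(f has_derivative (\<lambda>w. c z * (p' z w \<bullet> v) + (q z \<bullet> w) * (p z \<bullet> v) - (m z * (q' z w \<bullet> v) + (p z \<bullet> w) * (q z \<bullet> v)))) (at z)"
      proof (cases "z \<in> S")
        case True
        show ?thesis unfolding f_def
          by (intro has_derivative_diff has_derivative_mult has_derivative_inner_left Dc Dm True UNIV_I)
      next
        case False
        then have z: "z \<in> N" using N by auto
        have "((\<lambda>_. 0) has_derivative (\<lambda>_. 0)) (at z)" by simp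
        then have "(f has_derivative (\<lambda>_. 0)) (at z)"
          by (rule has_derivative_transform_within_open[OF _ N(1) z]) (use N0 N in \<open>simp add: f_def\<close>)
        then show ?thesis using N0[OF z] N(3)[OF z] by simp
      qed
      then have "(f has_derivative (\<lambda>w. c z * (p' z w \<bullet> v) + (q z \<bullet> w) * (p z \<bullet> v) - (m z * (q' z w \<bullet> v) + (p z \<bullet> w) * (q z \<bullet> v)))) (at (z + 0 *\<^sub>R v))"
        by simp
      from has_derivative_compose[OF line this]
      have d: "((\<lambda>t. f (z + t *\<^sub>R v)) has_derivative (\<lambda>t. c z * (p' z (t *\<^sub>R v) \<bullet> v) + (q z \<bullet> (t *\<^sub>R v)) * (p z \<bullet> v)
         - (m z * (q' z (t *\<^sub>R v) \<bullet> v) + (p z \<bullet> (t *\<^sub>R v)) * (q z \<bullet> v)))) (at 0)" .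
      have 1: "c z * (p' z (t *\<^sub>R v) \<bullet> v) = t * (c z * (p' z v \<bullet> v))" for t
      proof (cases "z \<in> S")
        case True then show ?thesis using linear_cmul[OF Dm(7)[OF True]] by simp
      next
        case False then show ?thesis using N by auto
      qed
      have 2: "q' z (t *\<^sub>R v) = t *\<^sub>R q' z v" for t using linear_cmul[OF Dc(7)] by simp
      have "(\<lambda>t. c z * (p' z (t *\<^sub>R v) \<bullet> v) + (q z \<bullet> (t *\<^sub>R v)) * (p z \<bullet> v)
         - (m z * (q' z (t *\<^sub>R v) \<bullet> v) + (p z \<bullet> (t *\<^sub>R v)) * (q z \<bullet> v))) = (*) (f' z)"
        unfolding 1 2 f'_def by (simp add: fun_eq_iff algebra_simps)
      with d show ?thesis unfolding has_field_derivative_def by simp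
    qed
    show ?thesis using integral_deriv_compact_support[OF der cf cf' f0] by (simp add: f'_def)
  qed
  have "(\<integral>z. (c z * (p' z 1 \<bullet> 1) - m z * (q' z 1 \<bullet> 1)) + (c z * (p' z \<i> \<bullet> \<i>) - m z * (q' z \<i> \<bullet> \<i>)) \<partial>lborel) = 0"
    using key[of 1] key[of \<i>] by (subst Bochner_Integration.integral_add) auto
  then have "(\<integral>z. c z * tr (p' z) - m z * tr (q' z) \<partial>lborel) = 0"
    by (simp add: tr_def inner_complex_def algebra_simps)
  then show "(\<integral>z. c z * tr (p' z) \<partial>lborel) = (\<integral>z. m z * tr (q' z) \<partial>lborel)"
    using i1 i2 by simp
qed

section \<open>The flux of a logarithmic singularity\<close>

text \<open>A disc of squared radius \<open>s\<close> has area \<open>pi * s\<close>, so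
  \<open>|z|^2\<close> has constant density \<open>pi\<close>; this takes the place of polar
  coordinates. The sign is reversed because measures are compared on half-lines
  \<open>{x<..}\<close>, which must have finite mass.\<close>

lemma distr_neg_norm_square:
  "distr lborel borel (\<lambda>z::complex. - (norm z)\<^sup>2) = density lborel (\<lambda>s. ennreal (pi * indicator {..0} s))"
proof (rule measure_eqI_lessThan)
  fix x :: real
  have "(\<lambda>z::complex. - (norm z)\<^sup>2) -` {x<..} = ball 0 (sqrt (max 0 (- x)))"
  proof (intro set_eqI)
    fix z :: complex
    have "x < - (norm z)\<^sup>2 \<longleftrightarrow> (norm z)\<^sup>2 < max 0 (- x)" using zero_le_power2[of "norm z"] by linarith
    also have "\<dots> \<longleftrightarrow> sqrt ((norm z)\<^sup>2) < sqrt (max 0 (- x))" by (rule real_sqrt_less_iff[symmetric])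
    finally show "z \<in> (\<lambda>z::complex. - (norm z)\<^sup>2) -` {x<..} \<longleftrightarrow> z \<in> ball 0 (sqrt (max 0 (- x)))" by simp
  qed
  then have e: "emeasure (distr lborel borel (\<lambda>z::complex. - (norm z)\<^sup>2)) {x<..} = ennreal (pi * max 0 (-x))"
    by (simp add: emeasure_distr emeasure_ball unit_ball_vol_2 ennreal_mult)
  then show "emeasure (distr lborel borel (\<lambda>z::complex. - (norm z)\<^sup>2)) {x<..} < \<infinity>" by simp
  have "emeasure (density lborel (\<lambda>s. ennreal (pi * indicator {..0} s))) {x<..}
     = (\<integral>\<^sup>+s. ennreal pi * indicator {x<..0} s \<partial>lborel)"
    by (subst emeasure_density) (auto intro!: nn_integral_cong simp: indicator_def)
  also have "\<dots> = ennreal pi * ennreal (max 0 (- x))"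
    by (subst nn_integral_cmult_indicator) (cases "x \<le> 0", auto simp: ennreal_neg max_def)
  finally show "emeasure (distr lborel borel (\<lambda>z::complex. - (norm z)\<^sup>2)) {x<..}
     = emeasure (density lborel (\<lambda>s. ennreal (pi * indicator {..0} s))) {x<..}"
    by (simp add: e ennreal_mult)
qed auto

lemma radial_integral:
  fixes g :: "real \<Rightarrow> real"
  assumes [measurable]: "g \<in> borel_measurable borel"
  shows "integrable lborel (\<lambda>z::complex. g ((norm z)\<^sup>2)) \<longleftrightarrow> integrable lborel (\<lambda>s. indicator {0..} s * g s)"
    "(\<integral>z. g ((norm (z::complex))\<^sup>2) \<partial>lborel) = pi * (\<integral>s. indicator {0..} s * g s \<partial>lborel)"
proof -
  have ind: "indicator {..0} (0 + -1 * s) = (indicator {0..} s :: real)" for s :: real by (auto simp: indicator_def)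
  have "integrable lborel (\<lambda>z::complex. g ((norm z)\<^sup>2))
     \<longleftrightarrow> integrable (distr lborel borel (\<lambda>z::complex. - (norm z)\<^sup>2)) (\<lambda>s. g (- s))"
    by (subst integrable_distr_eq) auto
  also have "\<dots> \<longleftrightarrow> integrable lborel (\<lambda>s. (pi * indicator {..0} s) *\<^sub>R g (- s))"
    unfolding distr_neg_norm_square by (rule integrable_density) auto
  also have "\<dots> \<longleftrightarrow> integrable lborel (\<lambda>s. indicator {..0} s * g (- s))"
    by (simp add: mult.assoc)
  also have "\<dots> \<longleftrightarrow> integrable lborel (\<lambda>s. indicator {0..} s * g s)"
    using lborel_integrable_real_affine_iff[of "-1" "\<lambda>s. indicator {..0} s * g (- s)" 0]
    unfolding ind by simp
  finally show "integrable lborel (\<lambda>z::complex. g ((norm z)\<^sup>2)) \<longleftrightarrow> integrable lborel (\<lambda>s. indicator {0..} s * g s)" .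
  have "(\<integral>z. g ((norm (z::complex))\<^sup>2) \<partial>lborel) = (\<integral>s. g (- s) \<partial>distr lborel borel (\<lambda>z::complex. - (norm z)\<^sup>2))"
    by (subst integral_distr) auto
  also have "\<dots> = (\<integral>s. (pi * indicator {..0} s) *\<^sub>R g (- s) \<partial>lborel)"
    unfolding distr_neg_norm_square by (rule integral_density) auto
  also have "\<dots> = pi * (\<integral>s. indicator {..0} s * g (- s) \<partial>lborel)"
    by (simp add: mult.assoc)
  also have "(\<integral>s. indicator {..0} s * g (- s) \<partial>lborel) = (\<integral>s. indicator {0..} s * g s \<partial>lborel)"
    using lborel_integral_real_affine[of "-1" "\<lambda>s. indicator {..0} s * g (- s)" 0]
    unfolding ind by simp
  finally show "(\<integral>z. g ((norm (z::complex))\<^sup>2) \<partial>lborel) = pi * (\<integral>s. indicator {0..} s * g s \<partial>lborel)" .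
qed

text \<open>Equal to 1 for \<open>|w| \<le> 1/2\<close> and to 0 for \<open>|w| \<ge> 1\<close>:
  between these radii \<open>4 |w|^2 - 1\<close> runs from 0 to 3, where the step rises. Dependence
  on \<open>|w|^2\<close> makes the radial integrals elementary.\<close>

definition cutoff :: "complex \<Rightarrow> real" where
  "cutoff w = 1 - spline 3 (4 * (norm w)\<^sup>2 - 1)"

text \<open>The Laplacian of \<open>cutoff\<close> at \<open>w\<close> is \<open>cutlap (|w|\<^sup>2)\<close>.\<close>

definition cutlap :: "real \<Rightarrow> real" where
  "cutlap s = - (64 * s * spline 1 (4 * s - 1)) - 16 * spline 2 (4 * s - 1)"

lemma spline_1_ge_3: "x \<ge> 3 \<Longrightarrow> spline 1 x = 0"
  by (simp add: spline_def)

lemma cutlap_0: "s \<le> 1/4 \<or> 1 \<le> s \<Longrightarrow> cutlap s = 0"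
  by (auto simp: cutlap_def spline_le_0 spline_ge_3 spline_1_ge_3 simp del: One_nat_def)

lemma cutoff_1: "norm w \<le> 1/2 \<Longrightarrow> cutoff w = 1"
  using power_mono[of "norm w" "1/2" 2] by (simp add: cutoff_def spline_le_0 power2_eq_square)

lemma cutoff_0: "norm w \<ge> 1 \<Longrightarrow> cutoff w = 0"
  using power_mono[of 1 "norm w" 2] by (simp add: cutoff_def spline_ge_3)

lemma cutoff_bounds: "0 \<le> cutoff w" "cutoff w \<le> 1"
  using spline_3_bounds[of "4 * (norm w)\<^sup>2 - 1"] by (simp_all add: cutoff_def)

lemma continuous_cutlap [continuous_intros]:
  "continuous_on S f \<Longrightarrow> continuous_on S (\<lambda>x. cutlap (f x))"
  unfolding cutlap_def by (intro continuous_intros)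

lemma cutlap_measurable [measurable]: "cutlap \<in> borel_measurable borel"
  by (intro borel_measurable_continuous_onI continuous_cutlap continuous_on_id)

lemma DERIV_spline_affine:
  "((\<lambda>s. spline 3 (4 * s - 1)) has_real_derivative 4 * spline 2 (4 * s - 1)) (at s)"
  "((\<lambda>s. spline 2 (4 * s - 1)) has_real_derivative 4 * spline 1 (4 * s - 1)) (at s)"
proof -
  have d: "((\<lambda>s. 4 * s - 1) has_real_derivative 4) (at s)" by (auto intro!: derivative_eq_intros)
  show "((\<lambda>s. spline 3 (4 * s - 1)) has_real_derivative 4 * spline 2 (4 * s - 1)) (at s)"
    using DERIV_chain2[where f="spline 3", OF DERIV_spline_3 d] by (simp add: mult.commute)
  show "((\<lambda>s. spline 2 (4 * s - 1)) has_real_derivative 4 * spline 1 (4 * s - 1)) (at s)"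
    using DERIV_chain2[where f="spline 2", OF DERIV_spline_2 d] by (simp add: mult.commute)
qed

lemma C2_grad_cutoff:
  "\<exists>q q'. C2_grad UNIV (\<lambda>z. cutoff ((z - z0) /\<^sub>R e)) q q' \<and> (\<forall>z. tr (q' z) = cutlap ((norm ((z - z0) /\<^sub>R e))\<^sup>2) / e\<^sup>2)"
proof -
  have "C2_grad UNIV cutoff (\<lambda>z. (- 4 * spline 2 (4 * (norm z)\<^sup>2 - 1)) *\<^sub>R (2 * z))
      (\<lambda>z v. (- 16 * spline 1 (4 * (norm z)\<^sup>2 - 1) * ((2 * z) \<bullet> v)) *\<^sub>R (2 * z) + (- 4 * spline 2 (4 * (norm z)\<^sup>2 - 1)) *\<^sub>R (2 * v))"
    unfolding cutoff_def[abs_def]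
  proof (rule C2_grad_compose_real[OF C2_grad_norm_square])
    fix s :: real
    show "((\<lambda>s. 1 - spline 3 (4 * s - 1)) has_real_derivative - 4 * spline 2 (4 * s - 1)) (at s)"
      by (auto intro!: derivative_eq_intros DERIV_spline_affine)
    show "((\<lambda>s. - 4 * spline 2 (4 * s - 1)) has_real_derivative - 16 * spline 1 (4 * s - 1)) (at s)"
      using DERIV_cmult[OF DERIV_spline_affine(2), of "-4" s] by simp
  qed (intro continuous_intros)
  note C = C2_grad_compose_holo[OF this, of "\<lambda>z. (z - z0) /\<^sub>R e" UNIV]
  have hd: "((\<lambda>z. (z - z0) /\<^sub>R e) has_field_derivative of_real (inverse e)) (at z)" for z :: complex
    unfolding scaleR_conv_of_real by (auto intro!: derivative_eq_intros)
  then have der: "deriv (\<lambda>z::complex. (z - z0) /\<^sub>R e) = (\<lambda>z. of_real (inverse e))"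
    by (auto intro: DERIV_imp_deriv)
  have hol: "(\<lambda>z::complex. (z - z0) /\<^sub>R e) holomorphic_on UNIV"
    using hd by (auto simp: holomorphic_on_def field_differentiable_def intro: has_field_derivative_at_within)
  note C = C[OF hol open_UNIV subset_UNIV, unfolded der]
  have tr: "tr (\<lambda>v. (- 16 * spline 1 (4 * (norm w)\<^sup>2 - 1) * ((2 * w) \<bullet> v)) *\<^sub>R (2 * w) + (- 4 * spline 2 (4 * (norm w)\<^sup>2 - 1)) *\<^sub>R (2 * v))
     = cutlap ((norm w)\<^sup>2)" for w
    unfolding tr_compose_real by (simp add: cutlap_def tr_def norm_mult power_mult_distrib)
  have lin: "linear (\<lambda>v::complex. (- 16 * spline 1 (4 * (norm w)\<^sup>2 - 1) * ((2 * w) \<bullet> v)) *\<^sub>R (2 * w) + (- 4 * spline 2 (4 * (norm w)\<^sup>2 - 1)) *\<^sub>R (2 * v))" for w :: complex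
    by (auto intro!: linearI simp: inner_add_right algebra_simps)
  show ?thesis
    by (rule exI, rule exI, rule conjI[OF C], unfold tr_compose_holo[OF lin] tr)
       (auto simp: divide_inverse norm_inverse power_inverse)
qed

text \<open>The value \<open>2 * pi\<close> is the identity
  \<open>\<Delta> ln |z| = 2 \<pi> \<delta>\<close> tested against \<open>cutoff\<close>, which is 1
  at the origin. The vanishing of the first integral makes additive constants invisible.\<close>

lemma integral_cutlap:
  "(\<integral>z. cutlap ((norm (z::complex))\<^sup>2) \<partial>lborel) = 0"
  "(\<integral>z. ln (norm (z::complex)) * cutlap ((norm z)\<^sup>2) \<partial>lborel) = 2 * pi"
  "integrable lborel (\<lambda>z::complex. cutlap ((norm z)\<^sup>2))"
  "integrable lborel (\<lambda>z::complex. ln (norm z) * cutlap ((norm z)\<^sup>2))"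
proof -
  have ind: "indicator {0..} s * (1/2 * ln s * cutlap s) = 1/2 * ln s * cutlap s * indicator {1/4..1} s" for s
    using cutlap_0[of s] by (auto simp: indicator_def)
  have ind0: "indicator {0..} s * cutlap s = cutlap s * indicator {1/4..1} s" for s
    using cutlap_0[of s] by (auto simp: indicator_def)
  \<comment> \<open>In \<open>s = |z|^2\<close> the Laplacian of a radial function \<open>g\<close>
    is \<open>4 (s g')'\<close>, so for \<open>g = 1 - spline 3 (4 s - 1)\<close> a primitive is
    \<open>4 s g'\<close>. \<open>F2\<close> is integration by parts against
    \<open>ln s / 2\<close>, which is \<open>ln |z|\<close>.\<close>
  have F1: "((\<lambda>s. - 16 * (s * spline 2 (4 * s - 1))) has_real_derivative 1 * cutlap s) (at s)" for s
    by (rule DERIV_cong[OF DERIV_cmult[OF DERIV_mult[OF DERIV_ident DERIV_spline_affine(2)]]])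
      (simp add: cutlap_def algebra_simps)
  have F2: "((\<lambda>s. - 8 * (ln s * (s * spline 2 (4 * s - 1))) + 2 * spline 3 (4 * s - 1)) has_real_derivative (1/2 * ln s) * cutlap s) (at s)"
    if "s > 0" for s
    by (rule DERIV_cong[OF DERIV_add[OF DERIV_cmult[OF DERIV_mult[OF DERIV_ln_divide[OF that] DERIV_mult[OF DERIV_ident DERIV_spline_affine(2)]]]
       DERIV_cmult[OF DERIV_spline_affine(1)]]])
      (use that in \<open>simp add: cutlap_def field_simps\<close>)
  have cc: "isCont cutlap s" for s
    using continuous_cutlap[OF continuous_on_id, of UNIV] continuous_on_eq_continuous_at by blast
  have h1: "has_bochner_integral lborel (\<lambda>s. (1 * cutlap s) * indicator {1/4..1} s) 0"
    using has_bochner_integral_FTC_Icc_real[OF _ F1, of "1/4" 1] cc by (simp add: spline_le_0 spline_ge_3)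
  have h2: "has_bochner_integral lborel (\<lambda>s. ((1/2 * ln s) * cutlap s) * indicator {1/4..1} s) 2"
  proof -
    have "isCont (\<lambda>s. 1/2 * ln s * cutlap s) s" if "1/4 \<le> s" "s \<le> 1" for s
      using that cc[of s] by (intro continuous_intros) auto
    from has_bochner_integral_FTC_Icc_real[OF _ F2 this, of "1/4" 1]
    show ?thesis by (simp add: spline_le_0 spline_ge_3)
  qed
  show "(\<integral>z. cutlap ((norm (z::complex))\<^sup>2) \<partial>lborel) = 0" "integrable lborel (\<lambda>z::complex. cutlap ((norm z)\<^sup>2))"
    using h1 radial_integral[OF cutlap_measurable] unfolding ind0 by (simp_all add: has_bochner_integral_iff)
  have ln: "ln (norm z) * cutlap ((norm z)\<^sup>2) = (1/2 * ln ((norm z)\<^sup>2)) * cutlap ((norm z)\<^sup>2)" for z :: complex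
    by (cases "z = 0") (auto simp: ln_realpow)
  have m: "(\<lambda>s. (1/2 * ln s) * cutlap s) \<in> borel_measurable borel" by measurable
  show "(\<integral>z. ln (norm (z::complex)) * cutlap ((norm z)\<^sup>2) \<partial>lborel) = 2 * pi"
    "integrable lborel (\<lambda>z::complex. ln (norm z) * cutlap ((norm z)\<^sup>2))"
    unfolding ln using h2 radial_integral[OF m] unfolding ind by (simp_all add: has_bochner_integral_iff)
qed

text \<open>After rescaling by \<open>e n\<close>, the function \<open>m\<close> is
  \<open>\<mu> ln (e n)\<close>, plus \<open>\<mu> ln |w|\<close>, plus a bounded convergent
  remainder. Constants integrate to 0 against \<open>cutlap\<close>, the logarithm to
  \<open>2 pi \<mu>\<close>. No limit of \<open>e\<close> is prescribed, so small discs about a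
  singularity and large discs are treated alike.\<close>

lemma flux_term:
  fixes m :: "complex \<Rightarrow> real" and e :: "nat \<Rightarrow> real"
  assumes [measurable]: "m \<in> borel_measurable borel" and e: "\<And>n. e n > 0"
    and lim: "\<And>w. w \<noteq> 0 \<Longrightarrow> (\<lambda>n. m (z0 + e n *\<^sub>R w) - \<mu> * ln (e n * norm w)) \<longlonglongrightarrow> L"
    and bd: "\<And>n w. 1/2 \<le> norm w \<Longrightarrow> norm w \<le> 1 \<Longrightarrow> \<bar>m (z0 + e n *\<^sub>R w) - \<mu> * ln (e n * norm w)\<bar> \<le> B"
  shows "integrable lborel (\<lambda>z. m z * (cutlap ((norm ((z - z0) /\<^sub>R e n))\<^sup>2) / (e n)\<^sup>2))"
    "(\<lambda>n. \<integral>z. m z * (cutlap ((norm ((z - z0) /\<^sub>R e n))\<^sup>2) / (e n)\<^sup>2) \<partial>lborel) \<longlonglongrightarrow> 2 * pi * \<mu>"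
proof -
  define T where "T = (\<lambda>w::complex. cutlap ((norm w)\<^sup>2))"
  have [measurable]: "T \<in> borel_measurable borel" unfolding T_def by measurable
  have T0: "T w = 0" if "norm w < 1/2 \<or> 1 < norm w" for w
    unfolding T_def using that power_mono[of "norm w" "1/2" 2] power_mono[of 1 "norm w" 2]
    by (intro cutlap_0) (auto simp: power2_eq_square)
  define D where "D = (\<lambda>n w. (m (z0 + e n *\<^sub>R w) - \<mu> * ln (e n * norm w)) * T w)"
  have [measurable]: "D n \<in> borel_measurable lborel" for n unfolding D_def by measurable
  have Dbd: "norm (D n w) \<le> B * \<bar>T w\<bar>" for n w
    using bd[of w n] T0[of w] by (cases "norm w < 1/2 \<or> 1 < norm w") (auto simp: D_def abs_mult intro: mult_right_mono)
  have iT: "integrable lborel T" "(\<integral>w. T w \<partial>lborel) = 0" using integral_cutlap by (auto simp: T_def)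
  have ilT: "integrable lborel (\<lambda>w. ln (norm w) * T w)" "(\<integral>w. ln (norm w) * T w \<partial>lborel) = 2 * pi"
    using integral_cutlap by (auto simp: T_def)
  have iB: "integrable lborel (\<lambda>w. B * \<bar>T w\<bar>)" using iT by simp
  have iD: "integrable lborel (D n)" for n
    by (rule Bochner_Integration.integrable_bound[OF iB]) (use Dbd[of n] in \<open>auto intro!: AE_I2 order_trans[OF _ abs_ge_self]\<close>)
  have Dlim: "(\<lambda>n. D n w) \<longlonglongrightarrow> L * T w" for w
    using lim[of w] T0[of w] unfolding D_def by (cases "w = 0") (auto intro!: tendsto_mult)
  have "(\<lambda>n. \<integral>w. D n w \<partial>lborel) \<longlonglongrightarrow> (\<integral>w. L * T w \<partial>lborel)"
    by (rule integral_dominated_convergence[OF _ _ iB AE_I2[OF Dlim] AE_I2[OF Dbd]]) auto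
  then have D0: "(\<lambda>n. \<integral>w. D n w \<partial>lborel) \<longlonglongrightarrow> 0" using iT by simp
  have split: "m (z0 + e n *\<^sub>R w) * T w = D n w + (\<mu> * ln (e n) * T w + \<mu> * (ln (norm w) * T w))" for n w
    using T0[of w] e[of n] by (cases "w = 0") (auto simp: D_def ln_mult algebra_simps)
  have i1: "integrable lborel (\<lambda>w. m (z0 + e n *\<^sub>R w) * T w)" for n
    unfolding split by (intro Bochner_Integration.integrable_add iD integrable_mult_right iT ilT)
  have I1: "(\<integral>w. m (z0 + e n *\<^sub>R w) * T w \<partial>lborel) = (\<integral>w. D n w \<partial>lborel) + 2 * pi * \<mu>" for n
    unfolding split using iD iT ilT by simp
  define G where "G = (\<lambda>n z. m z * (T ((z - z0) /\<^sub>R e n) / (e n)\<^sup>2))"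
  have [measurable]: "G n \<in> borel_measurable borel" for n unfolding G_def by measurable
  have aff: "lborel = density (distr lborel borel (\<lambda>x. z0 + e n *\<^sub>R x)) (\<lambda>_. ennreal ((e n)\<^sup>2))" for n
    using lborel_affine[of "e n" z0] e[of n] by simp
  have Gs: "(e n)\<^sup>2 *\<^sub>R G n (z0 + e n *\<^sub>R w) = m (z0 + e n *\<^sub>R w) * T w" for n w
    using e[of n] by (simp add: G_def)
  have iG: "integrable lborel (G n)" for n
  proof -
    have "G n (z0 + e n *\<^sub>R w) = inverse ((e n)\<^sup>2) * (m (z0 + e n *\<^sub>R w) * T w)" for w
      using e[of n] by (simp add: G_def divide_inverse)
    then have "integrable lborel (\<lambda>w. G n (z0 + e n *\<^sub>R w))" using i1 by simp
    then show ?thesis by (subst aff[of n], subst integrable_density) (auto simp: integrable_distr_eq)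
  qed
  have IG: "(\<integral>z. G n z \<partial>lborel) = (\<integral>w. m (z0 + e n *\<^sub>R w) * T w \<partial>lborel)" for n
    by (subst aff[of n], subst integral_density) (auto simp: integral_distr simp flip: Gs)
  show "integrable lborel (\<lambda>z. m z * (cutlap ((norm ((z - z0) /\<^sub>R e n))\<^sup>2) / (e n)\<^sup>2))"
    using iG[of n] by (simp add: G_def T_def)
  have "(\<lambda>n. \<integral>z. G n z \<partial>lborel) \<longlonglongrightarrow> 0 + 2 * pi * \<mu>"
    unfolding IG I1 by (intro tendsto_add D0 tendsto_const)
  then show "(\<lambda>n. \<integral>z. m z * (cutlap ((norm ((z - z0) /\<^sub>R e n))\<^sup>2) / (e n)\<^sup>2) \<partial>lborel) \<longlonglongrightarrow> 2 * pi * \<mu>"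
    by (simp add: G_def T_def)
qed

lemma filterlim_scale_at:
  fixes z0 w :: complex
  assumes e: "e \<longlonglongrightarrow> 0" "\<And>n. e n > (0::real)" and "w \<noteq> 0"
  shows "filterlim (\<lambda>n. z0 + e n *\<^sub>R w) (at z0) sequentially"
proof -
  have "(\<lambda>n. z0 + e n *\<^sub>R w) \<longlonglongrightarrow> z0 + 0 *\<^sub>R w" by (intro tendsto_intros e)
  moreover have "z0 + e n *\<^sub>R w \<noteq> z0" for n using e(2)[of n] assms(3) by auto
  ultimately show ?thesis unfolding filterlim_at by auto
qed

text \<open>Green's identity with cutoffs turns each logarithm into \<open>2 pi\<close> times its
  coefficient. The integrability of \<open>P\<close> is part of the conclusion: its cutoff integrals
  converge because those of \<open>P - Q\<close> and \<open>Q\<close> do, Fatou's lemma then gives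
  integrability, and only afterwards does dominated convergence identify the integral.\<close>

lemma flux_theorem:
  fixes Z :: "complex set" and m P Q :: "complex \<Rightarrow> real"
  assumes Z: "finite Z" and C: "C2_grad (- Z) m p p'"
    and sing: "\<And>z. z \<in> Z \<Longrightarrow> ((\<lambda>w. m w - \<mu> z * ln (norm (w - z))) \<longlongrightarrow> L z) (at z)"
    and inf: "((\<lambda>w. m w + \<gamma> * ln (norm w)) \<longlongrightarrow> Linf) at_infinity"
    and PQ: "\<And>z. z \<notin> Z \<Longrightarrow> tr (p' z) = P z - Q z"
    and P: "P \<in> borel_measurable borel" "\<And>z. P z \<ge> 0" and Q: "integrable lborel Q"
  shows "integrable lborel P" "(\<integral>z. P z \<partial>lborel) = (\<integral>z. Q z \<partial>lborel) - 2 * pi * (\<gamma> + (\<Sum>z\<in>Z. \<mu> z))"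
proof -
  have [measurable]: "P \<in> borel_measurable borel" by fact
  have mm[measurable]: "m \<in> borel_measurable borel"
    by (rule borel_measurable_continuous_countable_exceptions[OF countable_finite[OF Z] C2_gradD(4)[OF C]])
  have aux: "\<bar>x\<bar> < \<bar>y\<bar> + 1" if "dist x y < 1" for x y :: real
    using that unfolding dist_real_def by linarith
  have "\<forall>z\<in>Z. \<exists>d>0. \<forall>w. w \<noteq> z \<and> dist w z < d \<longrightarrow> \<bar>m w - \<mu> z * ln (norm (w - z))\<bar> < \<bar>L z\<bar> + 1"
  proof
    fix z assume "z \<in> Z"
    from tendstoD[OF sing[OF this], of 1] show "\<exists>d>0. \<forall>w. w \<noteq> z \<and> dist w z < d \<longrightarrow> \<bar>m w - \<mu> z * ln (norm (w - z))\<bar> < \<bar>L z\<bar> + 1"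
      unfolding eventually_at by (auto intro: aux)
  qed
  then obtain d where d: "\<And>z. z \<in> Z \<Longrightarrow> d z > 0"
    "\<And>z w. z \<in> Z \<Longrightarrow> w \<noteq> z \<Longrightarrow> dist w z < d z \<Longrightarrow> \<bar>m w - \<mu> z * ln (norm (w - z))\<bar> < \<bar>L z\<bar> + 1"
    by metis
  from tendstoD[OF inf, of 1] obtain R0 where R0: "\<And>w. norm w \<ge> R0 \<Longrightarrow> \<bar>m w + \<gamma> * ln (norm w)\<bar> < \<bar>Linf\<bar> + 1"
    unfolding eventually_at_infinity by (auto intro: aux)
  obtain s where s: "s > 0" "\<And>x y. x \<in> Z \<Longrightarrow> y \<in> Z \<Longrightarrow> x \<noteq> y \<Longrightarrow> s \<le> dist x y"
  proof -
    define D where "D = insert 1 ((\<lambda>(x, y). dist x y) ` {(x, y) \<in> Z \<times> Z. x \<noteq> y})"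
    have "finite {(x, y) \<in> Z \<times> Z. x \<noteq> y}" by (rule finite_subset[of _ "Z \<times> Z"]) (use Z in auto)
    then have f: "finite D" "D \<noteq> {}" by (auto simp: D_def)
    have "\<forall>x\<in>D. 0 < x" by (auto simp: D_def)
    then have "Min D > 0" using f by simp
    moreover have "Min D \<le> dist x y" if "x \<in> Z" "y \<in> Z" "x \<noteq> y" for x y
      using that by (intro Min_le f(1)) (auto simp: D_def)
    ultimately show thesis using that by blast
  qed
  obtain B0 where B0: "\<And>z. z \<in> Z \<Longrightarrow> norm z \<le> B0"
    using finite_imp_bounded[OF Z] by (auto simp: bounded_iff)
  \<comment> \<open>From this \<open>N\<close> on, the discs of radius \<open>1 / N\<close> about
    \<open>Z\<close> are disjoint, lie where the expansions at \<open>Z\<close> hold, and lie in the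
    half-radius disc on which the outer cutoff is 1. The transition annulus of the outer cutoff lies
    where the expansion at infinity holds.\<close>
  have "eventually (\<lambda>N. real N > 0 \<and> real N \<ge> 2 * R0 \<and> 2 / real N < s \<and> real N \<ge> 2 * B0 + 2 \<and> (\<forall>z\<in>Z. 1 / real N < d z)) sequentially"
  proof (intro eventually_conj eventually_ball_finite Z ballI)
    have big: "eventually (\<lambda>N. real N \<ge> c) sequentially" for c
      using filterlim_real_sequentially by (simp add: filterlim_at_top)
    show "eventually (\<lambda>N. real N \<ge> 2 * R0) sequentially" "eventually (\<lambda>N. real N \<ge> 2 * B0 + 2) sequentially"
      by (rule big)+
    show "eventually (\<lambda>N. real N > 0) sequentially" using big[of 1] by eventually_elim simp
    show "eventually (\<lambda>N. 2 / real N < s) sequentially"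
      using big[of "2 / s + 1"]
    proof eventually_elim
      case (elim N)
      moreover have "2 / s > 0" using s by simp
      ultimately have "2 / s < real N" "real N > 0" by linarith+
      then show ?case using s by (simp add: field_simps)
    qed
    show "eventually (\<lambda>N. 1 / real N < d z) sequentially" if "z \<in> Z" for z
      using big[of "1 / d z + 1"]
    proof eventually_elim
      case (elim N)
      moreover have "1 / d z > 0" using d(1)[OF that] by simp
      ultimately have "1 / d z < real N" "real N > 0" by linarith+
      then show ?case using d(1)[OF that] by (simp add: field_simps)
    qed
  qed
  then obtain N where N: "real N > 0" "real N \<ge> 2 * R0" "2 / real N < s" "real N \<ge> 2 * B0 + 2" "\<And>z. z \<in> Z \<Longrightarrow> 1 / real N < d z"
    unfolding eventually_sequentially by blast
  have N3: "2 * (1 / real N) < s" using N(3) by simp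
  define r where "r = (\<lambda>n. real (n + N))"
  define e where "e = (\<lambda>n. 1 / r n)"
  have r: "r n \<ge> real N" "r n > 0" for n using N(1) by (auto simp: r_def)
  have e: "e n > 0" "e n \<le> 1 / real N" for n using r[of n] N(1) by (auto simp: e_def field_simps)
  have rinf: "filterlim r at_top sequentially"
    unfolding r_def by (rule filterlim_compose[OF filterlim_real_sequentially filterlim_add_const_nat_at_top])
  have e1: "e n \<le> 1 \<and> 2 \<le> real N" if "z \<in> Z" for z n
  proof -
    have "2 \<le> real N" using N(4) B0[OF that] norm_ge_zero[of z] by linarith
    moreover from this have "1 / real N \<le> 1" by simp
    ultimately show ?thesis using e(2)[of n] by linarith
  qed
  have e0: "e \<longlonglongrightarrow> 0"
    unfolding e_def using tendsto_divide_0[OF tendsto_const filterlim_at_top_imp_at_infinity[OF rinf], of 1] by simp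
  have fz: "integrable lborel (\<lambda>w. m w * (cutlap ((norm ((w - z) /\<^sub>R e n))\<^sup>2) / (e n)\<^sup>2)) \<and>
    (\<lambda>n. \<integral>w. m w * (cutlap ((norm ((w - z) /\<^sub>R e n))\<^sup>2) / (e n)\<^sup>2) \<partial>lborel) \<longlonglongrightarrow> 2 * pi * \<mu> z" if z: "z \<in> Z" for z n
  proof -
    have 1: "(\<lambda>n. m (z + e n *\<^sub>R w) - \<mu> z * ln (e n * norm w)) \<longlonglongrightarrow> L z" if "w \<noteq> 0" for w
      using filterlim_compose[OF sing[OF z] filterlim_scale_at[OF e0 e(1) that]] e(1)
      by (simp add: less_imp_le)
    have 2: "\<bar>m (z + e n *\<^sub>R w) - \<mu> z * ln (e n * norm w)\<bar> \<le> \<bar>L z\<bar> + 1" if "1/2 \<le> norm w" "norm w \<le> 1" for n w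
    proof -
      have "dist (z + e n *\<^sub>R w) z = e n * norm w" using e(1)[of n] by (simp add: dist_norm)
      also have "\<dots> \<le> e n * 1" using e(1)[of n] that by (intro mult_left_mono) auto
      also have "\<dots> < d z" using e(2)[of n] N(5)[OF z] by linarith
      finally have "dist (z + e n *\<^sub>R w) z < d z" .
      moreover have "z + e n *\<^sub>R w \<noteq> z" using e(1)[of n] that by auto
      ultimately show ?thesis using d(2)[OF z, of "z + e n *\<^sub>R w"] e(1)[of n] by simp
    qed
    show ?thesis using flux_term[OF mm e(1) 1 2] by blast
  qed
  have finf: "integrable lborel (\<lambda>w. m w * (cutlap ((norm ((w - 0) /\<^sub>R r n))\<^sup>2) / (r n)\<^sup>2)) \<and>
    (\<lambda>n. \<integral>w. m w * (cutlap ((norm ((w - 0) /\<^sub>R r n))\<^sup>2) / (r n)\<^sup>2) \<partial>lborel) \<longlonglongrightarrow> 2 * pi * (- \<gamma>)" for n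
  proof -
    have 1: "(\<lambda>n. m (0 + r n *\<^sub>R w) - (- \<gamma>) * ln (r n * norm w)) \<longlonglongrightarrow> Linf" if "w \<noteq> 0" for w
    proof -
      have "filterlim (\<lambda>n. norm (r n *\<^sub>R w)) at_top sequentially"
        using that r(2) by (simp add: less_imp_le filterlim_tendsto_pos_mult_at_top[OF tendsto_const _ rinf] mult.commute)
      then have "filterlim (\<lambda>n. r n *\<^sub>R w) at_infinity sequentially"
        by (rule filterlim_norm_at_top_imp_at_infinity)
      from filterlim_compose[OF inf this] r(2) show ?thesis by (simp add: less_imp_le)
    qed
    have 2: "\<bar>m (0 + r n *\<^sub>R w) - (- \<gamma>) * ln (r n * norm w)\<bar> \<le> \<bar>Linf\<bar> + 1" if "1/2 \<le> norm w" "norm w \<le> 1" for n w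
    proof -
      have "r n * (1/2) \<le> r n * norm w" using r(2)[of n] that by (intro mult_left_mono) auto
      moreover have "norm (r n *\<^sub>R w) = r n * norm w" using r(2)[of n] by simp
      ultimately have "norm (r n *\<^sub>R w) \<ge> R0" using r(1)[of n] N(2) by linarith
      then show ?thesis using R0[of "r n *\<^sub>R w"] r(2)[of n] by simp
    qed
    show ?thesis using flux_term[OF mm r(2) 1 2] by blast
  qed
  have nsc: "norm (v /\<^sub>R t) = norm v / t" if "t > 0" for v :: complex and t
    using that by (simp add: divide_inverse mult.commute)
  \<comment> \<open>Cutoffs to the complement of small discs around \<open>Z\<close> in a large disc; the discs are disjoint,
    so a sum of cutoffs suffices.\<close>
  define \<xi> where "\<xi> = (\<lambda>n z. cutoff ((z - 0) /\<^sub>R r n) + (\<Sum>\<zeta>\<in>Z. (-1) * cutoff ((z - \<zeta>) /\<^sub>R e n)))"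
  have sing1: "(\<exists>\<zeta>\<in>Z. \<xi> n z = 1 - cutoff ((z - \<zeta>) /\<^sub>R e n) \<and> dist z \<zeta> < e n) \<or>
     (\<xi> n z = cutoff (z /\<^sub>R r n) \<and> (\<forall>\<zeta>\<in>Z. dist z \<zeta> \<ge> e n))" for n z
  proof (cases "\<exists>\<zeta>\<in>Z. dist z \<zeta> < e n")
    case True
    then obtain \<zeta> where \<zeta>: "\<zeta> \<in> Z" "dist z \<zeta> < e n" by auto
    have "cutoff ((z - x) /\<^sub>R e n) = 0" if "x \<in> Z" "x \<noteq> \<zeta>" for x
    proof -
      have "s \<le> dist x \<zeta>" using s(2) that \<zeta> by auto
      also have "\<dots> \<le> dist z x + dist z \<zeta>" by (metis dist_commute dist_triangle)
      finally have "dist z x \<ge> e n" using \<zeta>(2) e(2)[of n] N3 by linarith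
      then show ?thesis using e(1)[of n] by (intro cutoff_0) (simp add: nsc dist_norm le_divide_eq del: norm_scaleR)
    qed
    then have "(\<Sum>x\<in>Z. (-1) * cutoff ((z - x) /\<^sub>R e n)) = (-1) * cutoff ((z - \<zeta>) /\<^sub>R e n)"
      using \<zeta>(1) Z by (subst sum.remove[of _ \<zeta>]) auto
    moreover have "cutoff (z /\<^sub>R r n) = 1"
    proof (rule cutoff_1)
      have "norm z \<le> norm \<zeta> + dist z \<zeta>" by (metis dist_norm norm_triangle_sub)
      moreover have "e n \<le> 1" "real N \<ge> 2" using e1[OF \<zeta>(1)] by auto
      ultimately have "2 * norm z \<le> r n" using B0[OF \<zeta>(1)] \<zeta>(2) N(4) r(1)[of n] by linarith
      then show "norm (z /\<^sub>R r n) \<le> 1/2" using r(2)[of n] by (simp add: nsc divide_le_eq del: norm_scaleR)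
    qed
    ultimately show ?thesis using \<zeta> by (auto simp: \<xi>_def)
  next
    case False
    have "cutoff ((z - x) /\<^sub>R e n) = 0" if "x \<in> Z" for x
    proof -
      have "dist z x \<ge> e n" using False that by auto
      then show ?thesis using e(1)[of n] by (intro cutoff_0) (simp add: nsc dist_norm le_divide_eq del: norm_scaleR)
    qed
    then show ?thesis using False by (auto simp: \<xi>_def not_less)
  qed
  have \<xi>b: "0 \<le> \<xi> n z" "\<xi> n z \<le> 1" for n z
    using sing1[of n z] cutoff_bounds[of "(z - _) /\<^sub>R e n"] cutoff_bounds[of "z /\<^sub>R r n"] by auto
  have \<xi>lim: "(\<lambda>n. \<xi> n z) \<longlonglongrightarrow> 1" if "z \<notin> Z" for z
  proof (rule tendsto_eventually)
    have "eventually (\<lambda>n. e n < dist z x) sequentially" if "x \<in> Z" for x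
      using order_tendstoD(2)[OF e0, of "dist z x"] that \<open>z \<notin> Z\<close> by auto
    then have "eventually (\<lambda>n. \<forall>x\<in>Z. e n < dist z x) sequentially"
      using Z by (intro eventually_ball_finite) auto
    moreover have "eventually (\<lambda>n. r n \<ge> 2 * norm z) sequentially"
      using rinf by (simp add: filterlim_at_top)
    ultimately show "eventually (\<lambda>n. \<xi> n z = 1) sequentially"
    proof eventually_elim
      case (elim n)
      then have "norm (z /\<^sub>R r n) \<le> 1/2" using r(2)[of n] by (simp add: nsc divide_le_eq del: norm_scaleR)
      then show ?case using sing1[of n z] elim by (auto simp: cutoff_1)
    qed
  qed
  have "\<exists>q q'. C2_grad UNIV (\<xi> n) q q' \<and> (\<forall>z. tr (q' z) = cutlap ((norm ((z - 0) /\<^sub>R r n))\<^sup>2) / (r n)\<^sup>2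
      + (\<Sum>\<zeta>\<in>Z. (-1) * (cutlap ((norm ((z - \<zeta>) /\<^sub>R e n))\<^sup>2) / (e n)\<^sup>2)))" for n
  proof -
    obtain q0 q0' where q0: "C2_grad UNIV (\<lambda>z. cutoff ((z - 0) /\<^sub>R r n)) q0 q0'"
      "\<And>z. tr (q0' z) = cutlap ((norm ((z - 0) /\<^sub>R r n))\<^sup>2) / (r n)\<^sup>2"
      using C2_grad_cutoff[where ?z0.0=0 and e="r n"] by blast
    obtain q q' where q: "\<And>x. C2_grad UNIV (\<lambda>z. cutoff ((z - x) /\<^sub>R e n)) (q x) (q' x)"
      "\<And>x z. tr (q' x z) = cutlap ((norm ((z - x) /\<^sub>R e n))\<^sup>2) / (e n)\<^sup>2"
      using C2_grad_cutoff[where e="e n"] by metis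
    show ?thesis unfolding \<xi>_def
      by (rule exI, rule exI, rule conjI[OF C2_grad_add[OF q0(1) C2_grad_sum[OF C2_grad_cmult[OF q(1)]]]])
        (simp only: tr_add tr_sum tr_scale q q0 simp_thms)
  qed
  then obtain q q' where q: "\<And>n. C2_grad UNIV (\<xi> n) (q n) (q' n)"
    "\<And>n z. tr (q' n z) = cutlap ((norm ((z - 0) /\<^sub>R r n))\<^sup>2) / (r n)\<^sup>2
      + (\<Sum>\<zeta>\<in>Z. (-1) * (cutlap ((norm ((z - \<zeta>) /\<^sub>R e n))\<^sup>2) / (e n)\<^sup>2))" by metis
  have green: "integrable lborel (\<lambda>z. \<xi> n z * tr (p' z)) \<and>
     (\<integral>z. \<xi> n z * tr (p' z) \<partial>lborel) = (\<integral>z. m z * tr (q' n z) \<partial>lborel)" for n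
  proof -
    have o: "open (- Z)" using Z by (simp add: finite_imp_closed open_Compl)
    have n1: "open (\<Union>\<zeta>\<in>Z. ball \<zeta> (e n / 2))" "- (- Z) \<subseteq> (\<Union>\<zeta>\<in>Z. ball \<zeta> (e n / 2))" using e(1)[of n] by auto
    have n2: "\<xi> n z = 0" if zin: "z \<in> (\<Union>\<zeta>\<in>Z. ball \<zeta> (e n / 2))" for z
    proof -
      obtain \<zeta> where \<zeta>0: "\<zeta> \<in> Z" "z \<in> ball \<zeta> (e n / 2)" using zin by blast
      then have \<zeta>: "\<zeta> \<in> Z" "dist z \<zeta> < e n / 2" by (simp_all add: dist_commute)
      then have lt: "dist z \<zeta> < e n" using e(1)[of n] by linarith
      then obtain x where x: "x \<in> Z" "\<xi> n z = 1 - cutoff ((z - x) /\<^sub>R e n)" "dist z x < e n"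
        using sing1[of n z] \<zeta> by force
      have "x = \<zeta>"
      proof (rule ccontr)
        assume "x \<noteq> \<zeta>"
        then have "s \<le> dist x \<zeta>" using s(2) x \<zeta> by auto
        also have "\<dots> \<le> dist z x + dist z \<zeta>" by (metis dist_commute dist_triangle)
        finally show False using x(3) lt e(2)[of n] N3 by linarith
      qed
      moreover have "cutoff ((z - \<zeta>) /\<^sub>R e n) = 1"
        using \<zeta> e(1)[of n] by (intro cutoff_1) (simp add: nsc dist_norm divide_le_eq del: norm_scaleR)
      ultimately show ?thesis using x by simp
    qed
    have n3: "\<xi> n z = 0" if "norm z \<ge> r n" for z
    proof -
      have "dist z x \<ge> e n" if "x \<in> Z" for x
      proof -
        have "e n \<le> 1" "real N \<ge> 2" using e1[OF that] by auto
        moreover have "norm z \<le> norm x + dist z x" by (metis dist_norm norm_triangle_sub)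
        ultimately show ?thesis using B0[OF that] N(4) r(1)[of n] \<open>norm z \<ge> r n\<close> norm_ge_zero[of x] by linarith
      qed
      then have "\<xi> n z = cutoff (z /\<^sub>R r n)" using sing1[of n z] by force
      also have "\<dots> = 0" using that r(2)[of n] by (intro cutoff_0) (simp add: nsc le_divide_eq del: norm_scaleR)
      finally show ?thesis .
    qed
    show ?thesis using green_identity[OF C o q(1) n1 n2 n3] by blast
  qed
  have [measurable]: "\<xi> n \<in> borel_measurable borel" for n
    using C2_gradD(4)[OF q(1)] by (rule borel_measurable_continuous_onI)
  have limq: "(\<lambda>n. \<integral>z. m z * tr (q' n z) \<partial>lborel) \<longlonglongrightarrow> 2 * pi * (- \<gamma>) + (\<Sum>\<zeta>\<in>Z. (-1) * (2 * pi * \<mu> \<zeta>))"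
  proof -
    have "(\<integral>z. m z * tr (q' n z) \<partial>lborel) = (\<integral>w. m w * (cutlap ((norm ((w - 0) /\<^sub>R r n))\<^sup>2) / (r n)\<^sup>2) \<partial>lborel)
      + (\<Sum>z\<in>Z. (-1) * (\<integral>w. m w * (cutlap ((norm ((w - z) /\<^sub>R e n))\<^sup>2) / (e n)\<^sup>2) \<partial>lborel))" for n
    proof -
      have "(\<integral>z. m z * tr (q' n z) \<partial>lborel) = (\<integral>w. m w * (cutlap ((norm ((w - 0) /\<^sub>R r n))\<^sup>2) / (r n)\<^sup>2)
        + (\<Sum>z\<in>Z. (-1) * (m w * (cutlap ((norm ((w - z) /\<^sub>R e n))\<^sup>2) / (e n)\<^sup>2))) \<partial>lborel)"
        unfolding q(2) by (simp add: distrib_left sum_distrib_left sum_negf right_diff_distrib)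
      also have "\<dots> = (\<integral>w. m w * (cutlap ((norm ((w - 0) /\<^sub>R r n))\<^sup>2) / (r n)\<^sup>2) \<partial>lborel)
         + (\<integral>w. (\<Sum>z\<in>Z. (-1) * (m w * (cutlap ((norm ((w - z) /\<^sub>R e n))\<^sup>2) / (e n)\<^sup>2))) \<partial>lborel)"
        using fz finf by (intro Bochner_Integration.integral_add Bochner_Integration.integrable_sum integrable_mult_right) auto
      also have "(\<integral>w. (\<Sum>z\<in>Z. (-1) * (m w * (cutlap ((norm ((w - z) /\<^sub>R e n))\<^sup>2) / (e n)\<^sup>2))) \<partial>lborel)
        = (\<Sum>z\<in>Z. (\<integral>w. (-1) * (m w * (cutlap ((norm ((w - z) /\<^sub>R e n))\<^sup>2) / (e n)\<^sup>2)) \<partial>lborel))"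
        using fz by (intro Bochner_Integration.integral_sum integrable_mult_right) auto
      finally show ?thesis by simp
    qed
    then have eq: "(\<lambda>n. \<integral>z. m z * tr (q' n z) \<partial>lborel) = (\<lambda>n. (\<integral>w. m w * (cutlap ((norm ((w - 0) /\<^sub>R r n))\<^sup>2) / (r n)\<^sup>2) \<partial>lborel)
      + (\<Sum>z\<in>Z. (-1) * (\<integral>w. m w * (cutlap ((norm ((w - z) /\<^sub>R e n))\<^sup>2) / (e n)\<^sup>2) \<partial>lborel)))" by (rule ext)
    show ?thesis unfolding eq
      by (intro tendsto_add tendsto_sum tendsto_mult tendsto_const conjunct2[OF fz] conjunct2[OF finf])
  qed
  have lim1: "(\<lambda>n. \<integral>z. \<xi> n z * tr (p' z) \<partial>lborel) \<longlonglongrightarrow> - 2 * pi * (\<gamma> + (\<Sum>z\<in>Z. \<mu> z))"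
  proof -
    have "(\<Sum>\<zeta>\<in>Z. (-1) * (2 * pi * \<mu> \<zeta>)) = - (2 * pi * (\<Sum>z\<in>Z. \<mu> z))"
      by (simp add: sum_distrib_left sum_negf)
    then have "2 * pi * (- \<gamma>) + (\<Sum>\<zeta>\<in>Z. (-1) * (2 * pi * \<mu> \<zeta>)) = - 2 * pi * (\<gamma> + (\<Sum>z\<in>Z. \<mu> z))"
      by (simp only:) (simp add: algebra_simps)
    with limq have "(\<lambda>n. \<integral>z. m z * tr (q' n z) \<partial>lborel) \<longlonglongrightarrow> - 2 * pi * (\<gamma> + (\<Sum>z\<in>Z. \<mu> z))"
      by (simp only:)
    then show ?thesis using green by simp
  qed
  have AEZ: "AE z in lborel. z \<notin> Z"
    by (rule AE_not_in[OF finite_imp_null_set_lborel[OF Z]])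
  have iQ: "integrable lborel (\<lambda>z. \<xi> n z * Q z)" for n
    by (rule Bochner_Integration.integrable_bound[OF Q])
      (use \<xi>b Q in \<open>auto intro!: AE_I2 mult_left_le_one_le simp: abs_mult\<close>)
  have lim2: "(\<lambda>n. \<integral>z. \<xi> n z * Q z \<partial>lborel) \<longlonglongrightarrow> (\<integral>z. Q z \<partial>lborel)"
  proof (rule integral_dominated_convergence[where w="\<lambda>z. \<bar>Q z\<bar>"])
    show "AE z in lborel. (\<lambda>n. \<xi> n z * Q z) \<longlonglongrightarrow> Q z"
      using AEZ by eventually_elim (use tendsto_mult[OF \<xi>lim tendsto_const] in force)
  qed (use \<xi>b Q in \<open>auto intro!: AE_I2 mult_left_le_one_le simp: abs_mult\<close>)
  have AEP: "AE z in lborel. \<xi> n z * tr (p' z) + \<xi> n z * Q z = \<xi> n z * P z" for n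
    using AEZ by eventually_elim (simp add: PQ algebra_simps)
  have iP: "integrable lborel (\<lambda>z. \<xi> n z * P z)" for n
    by (rule integrable_cong_AE_imp[OF Bochner_Integration.integrable_add[OF conjunct1[OF green] iQ]])
      (use AEP[of n] in auto)
  have IP: "(\<integral>z. \<xi> n z * P z \<partial>lborel) = (\<integral>z. \<xi> n z * tr (p' z) \<partial>lborel) + (\<integral>z. \<xi> n z * Q z \<partial>lborel)" for n
  proof -
    have "(\<integral>z. \<xi> n z * P z \<partial>lborel) = (\<integral>z. \<xi> n z * tr (p' z) + \<xi> n z * Q z \<partial>lborel)"
      by (rule integral_cong_AE) (use AEP[of n] iP[of n] Bochner_Integration.integrable_add[OF conjunct1[OF green] iQ, of n n] in \<open>auto elim: eventually_mono\<close>)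
    also have "\<dots> = (\<integral>z. \<xi> n z * tr (p' z) \<partial>lborel) + (\<integral>z. \<xi> n z * Q z \<partial>lborel)"
      using green iQ by (intro Bochner_Integration.integral_add) auto
    finally show ?thesis .
  qed
  define \<Lambda> where "\<Lambda> = (\<integral>z. Q z \<partial>lborel) - 2 * pi * (\<gamma> + (\<Sum>z\<in>Z. \<mu> z))"
  have limP: "(\<lambda>n. \<integral>z. \<xi> n z * P z \<partial>lborel) \<longlonglongrightarrow> \<Lambda>"
    unfolding IP using tendsto_add[OF lim1 lim2] by (simp add: \<Lambda>_def)
  have "(\<integral>\<^sup>+z. ennreal (P z) \<partial>lborel) = (\<integral>\<^sup>+z. liminf (\<lambda>n. ennreal (\<xi> n z * P z)) \<partial>lborel)"
  proof (rule nn_integral_cong_AE)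
    show "AE z in lborel. ennreal (P z) = liminf (\<lambda>n. ennreal (\<xi> n z * P z))"
      using AEZ
    proof eventually_elim
      case (elim z)
      have "(\<lambda>n. ennreal (\<xi> n z * P z)) \<longlonglongrightarrow> ennreal (1 * P z)"
        by (intro tendsto_ennrealI tendsto_mult \<xi>lim elim tendsto_const)
      then show ?case using lim_imp_Liminf[OF sequentially_bot] by fastforce
    qed
  qed
  also have "\<dots> \<le> liminf (\<lambda>n. \<integral>\<^sup>+z. ennreal (\<xi> n z * P z) \<partial>lborel)"
    by (rule nn_integral_liminf) measurable
  also have "\<dots> = liminf (\<lambda>n. ennreal (\<integral>z. \<xi> n z * P z \<partial>lborel))"
    using iP \<xi>b P(2) by (subst nn_integral_eq_integral) auto
  also have "\<dots> = ennreal \<Lambda>"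
    by (rule lim_imp_Liminf[OF sequentially_bot tendsto_ennrealI[OF limP]])
  finally have "(\<integral>\<^sup>+z. ennreal (P z) \<partial>lborel) < \<infinity>" by (simp add: le_less_trans)
  then show iPP: "integrable lborel P"
    using P(2) by (intro integrableI_nonneg) auto
  have "(\<lambda>n. \<integral>z. \<xi> n z * P z \<partial>lborel) \<longlonglongrightarrow> (\<integral>z. P z \<partial>lborel)"
  proof (rule integral_dominated_convergence[where w=P])
    show "AE z in lborel. (\<lambda>n. \<xi> n z * P z) \<longlonglongrightarrow> P z"
      using AEZ by eventually_elim (use tendsto_mult[OF \<xi>lim tendsto_const] in force)
  qed (use \<xi>b P iPP in \<open>auto intro!: AE_I2 mult_left_le_one_le simp: abs_mult\<close>)
  with limP have "(\<integral>z. P z \<partial>lborel) = \<Lambda>" using LIMSEQ_unique by blast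
  then show "(\<integral>z. P z \<partial>lborel) = (\<integral>z. Q z \<partial>lborel) - 2 * pi * (\<gamma> + (\<Sum>z\<in>Z. \<mu> z))" by (simp add: \<Lambda>_def)
qed

section \<open>The isoperimetric inequality with isolated singularities\<close>

lemma cutoff_gradient:
  obtains B where "B > 0" "\<And>z0 e. e > 0 \<Longrightarrow> \<exists>q. (\<forall>z. ((\<lambda>z. cutoff ((z - z0) /\<^sub>R e)) has_derivative (\<lambda>v. q z \<bullet> v)) (at z))
     \<and> continuous_on UNIV q \<and> (\<forall>z. norm (q z) \<le> B / e * indicator (cball z0 e) z)"
proof -
  obtain B2 where B2: "B2 > 0" "\<And>x. \<bar>spline 2 x\<bar> \<le> B2" using spline_bounded[of 2] by auto
  have "\<exists>q. (\<forall>z. ((\<lambda>z. cutoff ((z - z0) /\<^sub>R e)) has_derivative (\<lambda>v. q z \<bullet> v)) (at z))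
     \<and> continuous_on UNIV q \<and> (\<forall>z. norm (q z) \<le> (8 * B2) / e * indicator (cball z0 e) z)" if e: "e > 0" for z0 and e :: real
  proof -
    define g where "g = (\<lambda>w::complex. (- 8 * spline 2 (4 * (norm w)\<^sup>2 - 1)) *\<^sub>R w)"
    define q where "q = (\<lambda>z. g ((z - z0) /\<^sub>R e) /\<^sub>R e)"
    have d: "(cutoff has_derivative (\<lambda>v. g w \<bullet> v)) (at w)" for w
    proof -
      have n: "((\<lambda>z::complex. (norm z)\<^sup>2) has_derivative (\<lambda>v. (2 * w) \<bullet> v)) (at w)"
        using C2_gradD(1)[OF C2_grad_norm_square, of w UNIV] by simp
      have "((\<lambda>s. 1 - spline 3 (4 * s - 1)) has_real_derivative - 4 * spline 2 (4 * s - 1)) (at s)" for s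
        by (auto intro!: derivative_eq_intros DERIV_spline_affine)
      from has_derivative_compose[OF n this[unfolded has_field_derivative_def]]
      show ?thesis by (simp add: cutoff_def[abs_def] g_def inner_complex_def algebra_simps)
    qed
    have "((\<lambda>z. cutoff ((z - z0) /\<^sub>R e)) has_derivative (\<lambda>v. q z \<bullet> v)) (at z)" for z
    proof -
      have "((\<lambda>z. (z - z0) /\<^sub>R e) has_derivative (\<lambda>v. v /\<^sub>R e)) (at z)" by (auto intro!: derivative_eq_intros)
      from has_derivative_compose[OF this d] show ?thesis by (simp add: q_def)
    qed
    moreover have "continuous_on UNIV q" unfolding q_def g_def by (intro continuous_intros)
    moreover have "norm (q z) \<le> (8 * B2) / e * indicator (cball z0 e) z" for z
    proof (cases "dist z z0 \<le> e")
      case True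
      define w where "w = (z - z0) /\<^sub>R e"
      have "norm w = dist z z0 / e" using e by (simp add: w_def dist_norm divide_inverse mult.commute)
      then have w: "norm w \<le> 1" using True e by simp
      have "norm (g w) = 8 * \<bar>spline 2 (4 * (norm w)\<^sup>2 - 1)\<bar> * norm w" by (simp add: g_def abs_mult)
      also have "\<dots> \<le> 8 * B2 * 1" using B2 w by (intro mult_mono) auto
      finally have "norm (g w) / e \<le> (8 * B2) / e" using e by (simp add: divide_right_mono)
      moreover have "norm (q z) = norm (g w) / e" using e by (simp add: q_def w_def divide_inverse mult.commute)
      ultimately show ?thesis using True by (simp add: dist_commute)
    next
      case False
      define w where "w = (z - z0) /\<^sub>R e"
      have "norm w = dist z z0 / e" using e by (simp add: w_def dist_norm divide_inverse mult.commute)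
      then have "norm w \<ge> 1" using False e by simp
      then have "1 \<le> (norm w)\<^sup>2" using power_mono[of 1 "norm w" 2] by simp
      then have "g w = 0" by (simp add: g_def spline_ge_3)
      then have "q z = 0" by (simp only: q_def w_def[symmetric] scaleR_zero_right)
      then show ?thesis using e B2 by simp
    qed
    ultimately show ?thesis by blast
  qed
  then show thesis using B2(1) by (intro that[of "8 * B2"]) auto
qed

text \<open>A gradient of size \<open>B / e\<close> on a disc of area \<open>pi * e^2\<close> has an
  integral of order \<open>e\<close>. In this sense finitely many points have zero capacity, and
  removing them does not affect perimeter in the limit.\<close>

lemma cutoff_family:
  obtains C where "C > 0" "\<And>(Z::complex set) e. finite Z \<Longrightarrow> e > 0 \<Longrightarrow> \<exists>c q.
     (\<forall>z. (c has_derivative (\<lambda>v. q z \<bullet> v)) (at z)) \<and> continuous_on UNIV q \<and> (\<forall>z. 0 \<le> c z \<and> c z \<le> 1) \<and>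
     (\<forall>z. (\<exists>\<zeta>\<in>Z. dist z \<zeta> < e / 2) \<longrightarrow> c z = 0) \<and> (\<forall>z. (\<forall>\<zeta>\<in>Z. dist z \<zeta> \<ge> e) \<longrightarrow> c z = 1) \<and>
     (\<integral>\<^sup>+z. ennreal (norm (q z)) \<partial>lborel) \<le> ennreal (real (card Z) * (C * e))"
proof -
  obtain B where B: "B > 0" "\<And>z0 e. e > 0 \<Longrightarrow> \<exists>q. (\<forall>z. ((\<lambda>z. cutoff ((z - z0) /\<^sub>R e)) has_derivative (\<lambda>v. q z \<bullet> v)) (at z))
     \<and> continuous_on UNIV q \<and> (\<forall>z. norm (q z) \<le> B / e * indicator (cball z0 e) z)"
    using cutoff_gradient by blast
  have "\<exists>c q.
     (\<forall>z. (c has_derivative (\<lambda>v. q z \<bullet> v)) (at z)) \<and> continuous_on UNIV q \<and> (\<forall>z. 0 \<le> c z \<and> c z \<le> 1) \<and>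
     (\<forall>z. (\<exists>\<zeta>\<in>Z. dist z \<zeta> < e / 2) \<longrightarrow> c z = 0) \<and> (\<forall>z. (\<forall>\<zeta>\<in>Z. dist z \<zeta> \<ge> e) \<longrightarrow> c z = 1) \<and>
     (\<integral>\<^sup>+z. ennreal (norm (q z)) \<partial>lborel) \<le> ennreal (real (card Z) * ((pi * B) * e))"
    if "finite Z" and e: "e > 0" for Z :: "complex set" and e :: real
    using \<open>finite Z\<close>
  proof (induction Z rule: finite_induct)
    case empty
    have "(\<bullet>) 0 = (\<lambda>v::complex. 0::real)" by auto
    then show ?case by (intro exI[of _ "\<lambda>_. 1"] exI[of _ "\<lambda>_. 0"]) auto
  next
    case (insert x F)
    then obtain c q where c: "\<And>z. (c has_derivative (\<lambda>v. q z \<bullet> v)) (at z)" "continuous_on UNIV q"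
      "\<And>z. 0 \<le> c z" "\<And>z. c z \<le> 1" "\<And>z. (\<exists>\<zeta>\<in>F. dist z \<zeta> < e / 2) \<Longrightarrow> c z = 0"
      "\<And>z. (\<forall>\<zeta>\<in>F. dist z \<zeta> \<ge> e) \<Longrightarrow> c z = 1"
      "(\<integral>\<^sup>+z. ennreal (norm (q z)) \<partial>lborel) \<le> ennreal (real (card F) * ((pi * B) * e))" by blast
    obtain r where r: "\<And>z. ((\<lambda>z. cutoff ((z - x) /\<^sub>R e)) has_derivative (\<lambda>v. r z \<bullet> v)) (at z)"
      "continuous_on UNIV r" "\<And>z. norm (r z) \<le> B / e * indicator (cball x e) z" using B(2)[OF e, of x] by blast
    define d where "d = (\<lambda>z. 1 - cutoff ((z - x) /\<^sub>R e))"
    have d: "0 \<le> d z" "d z \<le> 1" for z using cutoff_bounds by (auto simp: d_def)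
    have nw: "norm ((z - x) /\<^sub>R e) = dist z x / e" for z using e by (simp add: dist_norm divide_inverse mult.commute)
    have cc: "continuous_on UNIV c" by (intro continuous_at_imp_continuous_on ballI has_derivative_continuous[OF c(1)])
    have cd: "continuous_on UNIV d" unfolding d_def
      by (intro continuous_intros continuous_at_imp_continuous_on ballI has_derivative_continuous[OF r(1)])
    have [measurable]: "q \<in> borel_measurable borel" "r \<in> borel_measurable borel"
      using c(2) r(2) by (auto intro: borel_measurable_continuous_onI)
    \<comment> \<open>The discs may overlap for this \<open>e\<close>, so the cutoffs are multiplied
      instead of summed. As both factors lie between 0 and 1, the bounds for the gradients simply
      add up.\<close>
    define Q where "Q = (\<lambda>z. d z *\<^sub>R q z - c z *\<^sub>R r z)"
    have "((\<lambda>z. c z * d z) has_derivative (\<lambda>v. Q z \<bullet> v)) (at z)" for z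
    proof -
      have "(d has_derivative (\<lambda>v. 0 - r z \<bullet> v)) (at z)" unfolding d_def
        by (intro has_derivative_diff has_derivative_const r)
      from has_derivative_mult[OF c(1) this] show ?thesis
        by (simp add: Q_def inner_diff_left algebra_simps)
    qed
    moreover have "continuous_on UNIV Q" unfolding Q_def by (intro continuous_intros cc cd c r)
    moreover have "0 \<le> c z * d z \<and> c z * d z \<le> 1" for z using c(3,4)[of z] d[of z] by (simp add: mult_le_one)
    moreover have "c z * d z = 0" if "\<exists>\<zeta>\<in>insert x F. dist z \<zeta> < e / 2" for z
    proof (cases "\<exists>\<zeta>\<in>F. dist z \<zeta> < e / 2")
      case False
      then have "dist z x < e / 2" using that by auto
      then have "d z = 0" using e unfolding d_def by (subst cutoff_1) (simp_all add: nw divide_le_eq del: norm_scaleR)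
      then show ?thesis by simp
    qed (simp add: c)
    moreover have "c z * d z = 1" if "\<forall>\<zeta>\<in>insert x F. dist z \<zeta> \<ge> e" for z
    proof -
      have "d z = 1" using e that unfolding d_def by (subst cutoff_0) (simp_all add: nw le_divide_eq del: norm_scaleR)
      then show ?thesis using that c(6) by simp
    qed
    moreover have "(\<integral>\<^sup>+z. ennreal (norm (Q z)) \<partial>lborel) \<le> ennreal (real (card (insert x F)) * ((pi * B) * e))"
    proof -
      have "ennreal (norm (Q z)) \<le> ennreal (norm (q z)) + ennreal (B / e) * indicator (cball x e) z" for z
      proof -
        have "norm (Q z) \<le> \<bar>d z\<bar> * norm (q z) + \<bar>c z\<bar> * norm (r z)"
          unfolding Q_def by (metis norm_scaleR norm_triangle_ineq4)
        also have "\<dots> \<le> 1 * norm (q z) + 1 * norm (r z)" using c(3,4)[of z] d[of z] by (intro add_mono mult_right_mono) auto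
        also have "\<dots> \<le> norm (q z) + B / e * indicator (cball x e) z" using r(3)[of z] by simp
        finally have "ennreal (norm (Q z)) \<le> ennreal (norm (q z) + B / e * indicator (cball x e) z)" by (rule ennreal_leI)
        then show ?thesis using B(1) e by (auto simp: indicator_def split: if_splits)
      qed
      then have "(\<integral>\<^sup>+z. ennreal (norm (Q z)) \<partial>lborel) \<le> (\<integral>\<^sup>+z. ennreal (norm (q z)) + ennreal (B / e) * indicator (cball x e) z \<partial>lborel)"
        by (rule nn_integral_mono)
      also have "\<dots> = (\<integral>\<^sup>+z. ennreal (norm (q z)) \<partial>lborel) + ennreal (B / e) * emeasure lborel (cball x e)"
      proof -
        have [measurable]: "cball x e \<in> sets borel" by simp
        have "(\<lambda>z. ennreal (B / e) * indicator (cball x e) z) \<in> borel_measurable lborel"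
          by (intro borel_measurable_times_ennreal borel_measurable_const borel_measurable_indicator) simp
        then show ?thesis by (subst nn_integral_add) (auto simp: nn_integral_cmult_indicator)
      qed
      also have "emeasure lborel (cball x e) = ennreal (pi * e\<^sup>2)"
        using e by (simp add: emeasure_cball unit_ball_vol_2 ennreal_mult)
      also have "ennreal (B / e) * ennreal (pi * e\<^sup>2) = ennreal ((pi * B) * e)"
        using B e by (subst ennreal_mult[symmetric]) (auto simp: power2_eq_square)
      also have "(\<integral>\<^sup>+z. ennreal (norm (q z)) \<partial>lborel) + ennreal ((pi * B) * e) \<le> ennreal (real (card F) * ((pi * B) * e)) + ennreal ((pi * B) * e)"
        by (intro add_mono c) simp
      also have "\<dots> = ennreal (real (card (insert x F)) * ((pi * B) * e))"
        using insert(1,2) B(1) e by (subst ennreal_plus[symmetric]) (auto simp: algebra_simps)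
      finally show ?thesis .
    qed
    ultimately show ?case by blast
  qed
  then show thesis using B(1) by (intro that[of "pi * B"]) auto
qed

text \<open>The function may be discontinuous on \<open>Z\<close>. A cutoff at scale
  \<open>e\<close> makes the product \<open>C^1\<close>, adds \<open>O(e)\<close> to the gradient
  integral because \<open>f \<le> 1\<close>, and loses \<open>O(e^2)\<close> of area; both errors
  vanish in the limit.\<close>

lemma isoperimetric_singular:
  fixes f :: "complex \<Rightarrow> real" and p :: "complex \<Rightarrow> complex"
  assumes Z: "finite Z" and der: "\<And>z. z \<notin> Z \<Longrightarrow> (f has_derivative (\<lambda>v. p z \<bullet> v)) (at z)"
    and cp: "continuous_on (- Z) p" and nn: "\<And>z. 0 \<le> f z" "\<And>z. f z \<le> 1"
    and bd: "\<And>z. z \<notin> Z \<Longrightarrow> norm z \<ge> R \<Longrightarrow> f z = 0" and ip: "integrable lborel (\<lambda>z. norm (p z))"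
  shows "4 * pi * measure lborel {z. z \<notin> Z \<and> f z \<ge> 1} \<le> (\<integral>z. norm (p z) \<partial>lborel)\<^sup>2"
proof -
  have oZ: "open (- Z)" using Z by (simp add: finite_imp_closed open_Compl)
  have cf: "continuous_on (- Z) f" using der by (intro continuous_at_imp_continuous_on ballI) (auto dest: has_derivative_continuous)
  have fm[measurable]: "f \<in> borel_measurable borel" and pm[measurable]: "p \<in> borel_measurable borel"
    using borel_measurable_continuous_countable_exceptions[OF countable_finite[OF Z]] cf cp by auto
  have Zm[measurable]: "Z \<in> sets borel" using finite_imp_null_set_lborel[OF Z] by auto
  define I where "I = (\<integral>z. norm (p z) \<partial>lborel)"
  have I: "(\<integral>\<^sup>+z. ennreal (norm (p z)) \<partial>lborel) = ennreal I" "I \<ge> 0"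
    unfolding I_def by (rule nn_integral_eq_integral[OF ip]) auto
  define A where "A = {z. z \<notin> Z \<and> f z \<ge> 1}"
  have [measurable]: "A \<in> sets borel" unfolding A_def by measurable
  obtain C where C: "C > 0" "\<And>(Z::complex set) e. finite Z \<Longrightarrow> e > 0 \<Longrightarrow> \<exists>c q.
     (\<forall>z. (c has_derivative (\<lambda>v. q z \<bullet> v)) (at z)) \<and> continuous_on UNIV q \<and> (\<forall>z. 0 \<le> c z \<and> c z \<le> 1) \<and>
     (\<forall>z. (\<exists>\<zeta>\<in>Z. dist z \<zeta> < e / 2) \<longrightarrow> c z = 0) \<and> (\<forall>z. (\<forall>\<zeta>\<in>Z. dist z \<zeta> \<ge> e) \<longrightarrow> c z = 1) \<and>
     (\<integral>\<^sup>+z. ennreal (norm (q z)) \<partial>lborel) \<le> ennreal (real (card Z) * (C * e))" using cutoff_family by blast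
  define n where "n = real (card Z)"
  have main: "4 * pi * measure lborel A \<le> (I + n * (C * e))\<^sup>2 + 4 * pi * (n * (pi * e\<^sup>2))" if e: "e > 0" for e
  proof -
    obtain c q where c: "\<And>z. (c has_derivative (\<lambda>v. q z \<bullet> v)) (at z)" "continuous_on UNIV q"
      "\<And>z. 0 \<le> c z" "\<And>z. c z \<le> 1" "\<And>z. (\<exists>\<zeta>\<in>Z. dist z \<zeta> < e / 2) \<Longrightarrow> c z = 0"
      "\<And>z. (\<forall>\<zeta>\<in>Z. dist z \<zeta> \<ge> e) \<Longrightarrow> c z = 1"
      "(\<integral>\<^sup>+z. ennreal (norm (q z)) \<partial>lborel) \<le> ennreal (n * (C * e))"
      using C(2)[OF Z e] unfolding n_def by blast
    have cc: "continuous_on UNIV c" by (intro continuous_at_imp_continuous_on ballI has_derivative_continuous[OF c(1)])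
    define N where "N = (\<Union>\<zeta>\<in>Z. ball \<zeta> (e / 2))"
    have N: "open N" "Z \<subseteq> N" "\<And>z. z \<in> N \<Longrightarrow> c z = 0"
      using e c(5) by (auto simp: N_def dist_commute)
    define F where "F = (\<lambda>z. c z * f z)"
    define P where "P = (\<lambda>z. if z \<in> N then 0 else c z *\<^sub>R p z + f z *\<^sub>R q z)"
    have q0: "q z = 0" if "z \<in> N" for z
    proof -
      have "((\<lambda>z. 0) has_derivative (\<lambda>v. q z \<bullet> v)) (at z)"
        by (rule has_derivative_transform_within_open[OF c(1) N(1) that]) (simp add: N)
      then have "(\<lambda>v. q z \<bullet> v) = (\<lambda>v. 0)" using has_derivative_unique has_derivative_const by blast
      then show ?thesis by (metis inner_eq_zero_iff)
    qed
    have P: "P z = c z *\<^sub>R p z + f z *\<^sub>R q z" for z using q0 N by (simp add: P_def)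
    have dF: "(F has_derivative (\<lambda>v. P z \<bullet> v)) (at z)" for z
    proof (cases "z \<in> N")
      case True
      have "((\<lambda>z. 0) has_derivative (\<lambda>v. 0)) (at z)" by simp
      then have "(F has_derivative (\<lambda>v. 0)) (at z)"
        by (rule has_derivative_transform_within_open[OF _ N(1) True]) (simp add: F_def N)
      then show ?thesis using True by (simp add: P_def)
    next
      case False
      then have "z \<notin> Z" using N by auto
      from has_derivative_mult[OF c(1) der[OF this]] False
      show ?thesis by (simp add: F_def[abs_def] P_def inner_add_left algebra_simps)
    qed
    have cP: "continuous_on UNIV P"
    proof -
      have "continuous_on N P" by (rule continuous_on_eq[of _ "\<lambda>_. 0"]) (auto simp: P_def)
      moreover have "continuous_on (- Z) P"
        unfolding P by (intro continuous_intros cp cf continuous_on_subset[OF cc] continuous_on_subset[OF c(2)]) auto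
      ultimately have "continuous_on (N \<union> - Z) P" using N(1) oZ by (intro continuous_on_open_Un)
      moreover have "N \<union> - Z = UNIV" using N(2) by auto
      ultimately show ?thesis by simp
    qed
    have F0: "F z = 0" if "norm z \<ge> R" for z
      using that bd[of z] N(2,3) by (cases "z \<in> Z") (auto simp: F_def)
    have iso: "ennreal (2 * sqrt (pi * measure lborel {z. F z \<ge> 1})) \<le> (\<integral>\<^sup>+z. ennreal (norm (P z)) \<partial>lborel)"
      by (rule isoperimetric_C1[OF dF cP _ F0]) (simp add: F_def c nn)
    have [measurable]: "q \<in> borel_measurable borel" using c(2) by (rule borel_measurable_continuous_onI)
    have "ennreal (norm (P z)) \<le> ennreal (norm (p z)) + ennreal (norm (q z))" for z
    proof -
      have "norm (P z) \<le> \<bar>c z\<bar> * norm (p z) + \<bar>f z\<bar> * norm (q z)"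
        unfolding P by (metis norm_scaleR norm_triangle_ineq)
      also have "\<dots> \<le> 1 * norm (p z) + 1 * norm (q z)" using c(3,4)[of z] nn[of z] by (intro add_mono mult_right_mono) auto
      finally show ?thesis by (simp add: ennreal_plus[symmetric] ennreal_leI del: ennreal_plus)
    qed
    then have "(\<integral>\<^sup>+z. ennreal (norm (P z)) \<partial>lborel) \<le> (\<integral>\<^sup>+z. ennreal (norm (p z)) + ennreal (norm (q z)) \<partial>lborel)"
      by (rule nn_integral_mono)
    also have "\<dots> = ennreal I + (\<integral>\<^sup>+z. ennreal (norm (q z)) \<partial>lborel)" by (subst nn_integral_add) (auto simp: I)
    also have "\<dots> \<le> ennreal I + ennreal (n * (C * e))" by (intro add_mono c) simp
    also have "\<dots> = ennreal (I + n * (C * e))" using I C e by (simp add: n_def)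
    finally have "ennreal (2 * sqrt (pi * measure lborel {z. F z \<ge> 1})) \<le> ennreal (I + n * (C * e))"
      by (rule order_trans[OF iso])
    moreover have "0 \<le> I + n * (C * e)" using I(2) C(1) e by (simp add: n_def)
    ultimately have "2 * sqrt (pi * measure lborel {z. F z \<ge> 1}) \<le> I + n * (C * e)"
      by (simp only: ennreal_le_iff)
    then have "(2 * sqrt (pi * measure lborel {z. F z \<ge> 1}))\<^sup>2 \<le> (I + n * (C * e))\<^sup>2"
      by (intro power_mono) auto
    then have i4: "4 * pi * measure lborel {z. F z \<ge> 1} \<le> (I + n * (C * e))\<^sup>2" by (simp add: power_mult_distrib)
    have "A \<subseteq> {z. F z \<ge> 1} \<union> (\<Union>\<zeta>\<in>Z. ball \<zeta> e)"
    proof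
      fix z assume z: "z \<in> A"
      show "z \<in> {z. F z \<ge> 1} \<union> (\<Union>\<zeta>\<in>Z. ball \<zeta> e)"
      proof (cases "\<exists>\<zeta>\<in>Z. dist z \<zeta> < e")
        case False
        then have "c z = 1" by (intro c) (auto simp: not_less)
        then show ?thesis using z by (auto simp: F_def A_def)
      qed (auto simp: dist_commute)
    qed
    moreover have "{z. F z \<ge> 1} \<subseteq> cball 0 R"
    proof
      fix z assume "z \<in> {z. F z \<ge> 1}"
      then show "z \<in> cball 0 R" using F0[of z] by (cases "norm z \<ge> R") auto
    qed
    then have bF: "bounded {z. F z \<ge> 1}" using bounded_cball bounded_subset by blast
    have Fm: "{z. F z \<ge> 1} \<in> sets borel"
    proof -
      have "F \<in> borel_measurable borel"
        by (intro borel_measurable_continuous_onI continuous_at_imp_continuous_on ballI has_derivative_continuous[OF dF])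
      then show ?thesis by measurable
    qed
    have [measurable]: "(\<Union>\<zeta>\<in>Z. ball \<zeta> e) \<in> sets borel" by (intro borel_open open_UN) auto
    have bU: "bounded (\<Union>\<zeta>\<in>Z. ball \<zeta> e)" using Z by auto
    have fmU: "{z. F z \<ge> 1} \<in> fmeasurable lborel" "(\<Union>\<zeta>\<in>Z. ball \<zeta> e) \<in> fmeasurable lborel"
      using emeasure_bounded_finite[OF bF] emeasure_bounded_finite[OF bU] Fm
      by (auto simp: fmeasurable_def)
    ultimately have "measure lborel A \<le> measure lborel ({z. F z \<ge> 1} \<union> (\<Union>\<zeta>\<in>Z. ball \<zeta> e))"
      by (intro measure_mono_fmeasurable fmeasurable.Un) auto
    also have "\<dots> \<le> measure lborel {z. F z \<ge> 1} + measure lborel (\<Union>\<zeta>\<in>Z. ball \<zeta> e)"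
      using fmU by (intro measure_Un_le) (auto simp: fmeasurable_def)
    also have "measure lborel (\<Union>\<zeta>\<in>Z. ball \<zeta> e) \<le> (\<Sum>\<zeta>\<in>Z. measure lborel (ball \<zeta> e))"
      using Z by (intro measure_UNION_le) auto
    also have "\<dots> = n * (pi * e\<^sup>2)" using e by (simp add: measure_ball_complex n_def)
    finally have "4 * pi * measure lborel A \<le> 4 * pi * (measure lborel {z. F z \<ge> 1} + n * (pi * e\<^sup>2))"
      by (intro mult_left_mono) auto
    then show ?thesis using i4 by (simp add: distrib_left)
  qed
  have "((\<lambda>e. (I + n * (C * e))\<^sup>2 + 4 * pi * (n * (pi * e\<^sup>2))) \<longlongrightarrow> (I + n * (C * 0))\<^sup>2 + 4 * pi * (n * (pi * 0\<^sup>2))) (at_right 0)"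
    by (intro tendsto_intros)
  then have "((\<lambda>e. (I + n * (C * e))\<^sup>2 + 4 * pi * (n * (pi * e\<^sup>2))) \<longlongrightarrow> I\<^sup>2) (at_right 0)" by simp
  then have "4 * pi * measure lborel A \<le> I\<^sup>2"
    by (rule tendsto_lowerbound) (use main in \<open>auto simp: eventually_at_filter\<close>)
  then show ?thesis by (simp add: A_def I_def)
qed

section \<open>Smoothed distribution functions and integrability of the area density\<close>

lemma spline_3_Lipschitz:
  obtains B where "B > 0" "\<And>x y. \<bar>spline 3 x - spline 3 y\<bar> \<le> B * \<bar>x - y\<bar>" "\<And>x. \<bar>spline 2 x\<bar> \<le> B"
proof -
  obtain B where B: "B > 0" "\<And>x. \<bar>spline 2 x\<bar> \<le> B" using spline_bounded[of 2] by auto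
  have "norm (spline 3 x - spline 3 y) \<le> B * norm (x - y)" for x y
    by (rule field_differentiable_bound[of UNIV "spline 3" "spline 2"]) (use B DERIV_spline_3 in auto)
  then show thesis using B that by auto
qed

text \<open>\<open>G t\<close> is the smoothed \<open>w\<close>-mass of the superlevel set
  \<open>{U > t}\<close>. The Lipschitz bound of the step dominates the difference quotients, so
  differentiation under the integral works for a merely measurable \<open>U\<close>.\<close>

lemma has_derivative_integral_spline:
  fixes U w :: "complex \<Rightarrow> real"
  assumes [measurable]: "U \<in> borel_measurable borel" and w: "integrable lborel w" and h: "h > 0"
  defines "G \<equiv> \<lambda>t. \<integral>z. spline 3 ((U z - t) / h) * w z \<partial>lborel"
  shows "(G has_real_derivative - (\<integral>z. spline 2 ((U z - t) / h) / h * w z \<partial>lborel)) (at t)"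
    "(G \<longlongrightarrow> 0) at_top" "(G \<longlongrightarrow> (\<integral>z. w z \<partial>lborel)) at_bot"
    "integrable lborel (\<lambda>z. spline 3 ((U z - t) / h) * w z)"
    "integrable lborel (\<lambda>z. spline 2 ((U z - t) / h) / h * w z)"
proof -
  have [measurable]: "w \<in> borel_measurable borel" using w by auto
  have sm[measurable]: "spline k \<in> borel_measurable borel" for k
    by (intro borel_measurable_continuous_onI continuous_spline continuous_on_id)
  obtain B where B: "B > 0" "\<And>x y. \<bar>spline 3 x - spline 3 y\<bar> \<le> B * \<bar>x - y\<bar>" "\<And>x. \<bar>spline 2 x\<bar> \<le> B"
    using spline_3_Lipschitz by blast
  have iw: "integrable lborel (\<lambda>z. c * \<bar>w z\<bar>)" for c using w by simp
  show i3: "integrable lborel (\<lambda>z. spline 3 ((U z - t) / h) * w z)" for t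
    by (rule Bochner_Integration.integrable_bound[OF iw[of 1]])
      (use spline_3_bounds in \<open>auto intro!: AE_I2 mult_left_le_one_le simp: abs_mult\<close>)
  show "integrable lborel (\<lambda>z. spline 2 ((U z - t) / h) / h * w z)" for t
    by (rule Bochner_Integration.integrable_bound[OF iw[of "B / h"]])
      (use B h in \<open>auto intro!: AE_I2 mult_right_mono divide_right_mono simp: abs_mult\<close>)
  show "(G has_real_derivative - (\<integral>z. spline 2 ((U z - t) / h) / h * w z \<partial>lborel)) (at t)"
    unfolding DERIV_def tendsto_at_iff_sequentially comp_def
  proof (intro allI impI)
    fix X :: "nat \<Rightarrow> real" assume X: "\<forall>i. X i \<in> UNIV - {0}" "X \<longlonglongrightarrow> 0"
    define q where "q = (\<lambda>n z. (spline 3 ((U z - (t + X n)) / h) - spline 3 ((U z - t) / h)) / X n * w z)"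
    have [measurable]: "q n \<in> borel_measurable lborel" for n unfolding q_def by measurable
    have lim: "(\<lambda>n. q n z) \<longlonglongrightarrow> - (spline 2 ((U z - t) / h) / h) * w z" for z
    proof -
      have d: "((\<lambda>s. (U z - s) / h) has_real_derivative - 1 / h) (at t)" using h by (auto intro!: derivative_eq_intros)
      have "((\<lambda>s. spline 3 ((U z - s) / h)) has_real_derivative spline 2 ((U z - t) / h) * (- 1 / h)) (at t)"
        by (rule DERIV_chain2[where f="spline 3", OF DERIV_spline_3 d])
      then have "(\<lambda>n. (spline 3 ((U z - (t + X n)) / h) - spline 3 ((U z - t) / h)) / X n) \<longlonglongrightarrow> spline 2 ((U z - t) / h) * (- 1 / h)"
        using X unfolding DERIV_def tendsto_at_iff_sequentially comp_def by blast
      then have "(\<lambda>n. q n z) \<longlonglongrightarrow> (spline 2 ((U z - t) / h) * (- 1 / h)) * w z"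
        unfolding q_def by (intro tendsto_mult tendsto_const)
      then show ?thesis by simp
    qed
    have bd: "norm (q n z) \<le> B / h * \<bar>w z\<bar>" for n z
    proof -
      have "\<bar>spline 3 ((U z - (t + X n)) / h) - spline 3 ((U z - t) / h)\<bar> \<le> B * \<bar>(U z - (t + X n)) / h - (U z - t) / h\<bar>"
        by (rule B)
      also have "(U z - (t + X n)) / h - (U z - t) / h = - (X n / h)" using h by (simp add: field_simps)
      finally have "\<bar>spline 3 ((U z - (t + X n)) / h) - spline 3 ((U z - t) / h)\<bar> / \<bar>X n\<bar> \<le> B / h"
        using X h by (simp add: field_simps)
      then show ?thesis unfolding q_def real_norm_def abs_mult abs_divide by (rule mult_right_mono) simp
    qed
    have "(\<lambda>n. \<integral>z. q n z \<partial>lborel) \<longlonglongrightarrow> (\<integral>z. - (spline 2 ((U z - t) / h) / h) * w z \<partial>lborel)"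
      by (rule integral_dominated_convergence[OF _ _ iw AE_I2[OF lim] AE_I2[OF bd]]) measurable
    moreover have "(\<integral>z. q n z \<partial>lborel) = (G (t + X n) - G t) / X n" for n
    proof -
      have "(\<integral>z. q n z \<partial>lborel) = (\<integral>z. (spline 3 ((U z - (t + X n)) / h) * w z - spline 3 ((U z - t) / h) * w z) / X n \<partial>lborel)"
        by (intro Bochner_Integration.integral_cong) (auto simp: q_def field_simps)
      also have "\<dots> = (G (t + X n) - G t) / X n" unfolding G_def using i3 by simp
      finally show ?thesis .
    qed
    ultimately show "(\<lambda>n. (G (t + X n) - G t) / X n) \<longlonglongrightarrow> - (\<integral>z. spline 2 ((U z - t) / h) / h * w z \<partial>lborel)"
      by simp
  qed
  have bd3: "norm (spline 3 ((U z - t) / h) * w z) \<le> 1 * \<bar>w z\<bar>" for t z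
    using spline_3_bounds[of "(U z - t) / h"] by (simp add: abs_mult mult_left_le_one_le)
  have ev: "\<forall>\<^sub>F t in at_top. AE z in lborel. norm (spline 3 ((U z - t) / h) * w z) \<le> 1 * \<bar>w z\<bar>"
    "\<forall>\<^sub>F t in at_top. AE z in lborel. norm (spline 3 ((U z - (-t)) / h) * w z) \<le> 1 * \<bar>w z\<bar>"
    by (intro always_eventually allI AE_I2 bd3)+
  have "((\<lambda>t. \<integral>z. spline 3 ((U z - t) / h) * w z \<partial>lborel) \<longlongrightarrow> (\<integral>(z::complex). 0 \<partial>lborel)) at_top"
  proof (rule integral_dominated_convergence_at_top[where w="\<lambda>z. 1 * \<bar>w z\<bar>"])
    show "AE z in lborel. ((\<lambda>t. spline 3 ((U z - t) / h) * w z) \<longlongrightarrow> 0) at_top"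
    proof (intro AE_I2 tendsto_eventually)
      fix z show "\<forall>\<^sub>F t in at_top. spline 3 ((U z - t) / h) * w z = 0"
        using eventually_ge_at_top[of "U z"] by eventually_elim (use h in \<open>simp add: spline_le_0 divide_nonpos_pos\<close>)
    qed
  qed (use ev iw[of 1] in auto)
  then show "(G \<longlongrightarrow> 0) at_top" by (simp add: G_def)
  have "((\<lambda>t. \<integral>z. spline 3 ((U z - (- t)) / h) * w z \<partial>lborel) \<longlongrightarrow> (\<integral>z. w z \<partial>lborel)) at_top"
  proof (rule integral_dominated_convergence_at_top[where w="\<lambda>z. 1 * \<bar>w z\<bar>"])
    show "AE z in lborel. ((\<lambda>t. spline 3 ((U z - (- t)) / h) * w z) \<longlongrightarrow> w z) at_top"
    proof (intro AE_I2 tendsto_eventually)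
      fix z show "\<forall>\<^sub>F t in at_top. spline 3 ((U z - (- t)) / h) * w z = w z"
        using eventually_ge_at_top[of "3 * h - U z"] by eventually_elim (use h in \<open>simp add: spline_ge_3 le_divide_eq\<close>)
    qed
  qed (use ev iw[of 1] in auto)
  then show "(G \<longlongrightarrow> (\<integral>z. w z \<partial>lborel)) at_bot"
    unfolding G_def at_bot_mirror filterlim_filtermap by simp
qed

lemma integrable_norm_powr:
  fixes e :: real
  shows "e > -1 \<Longrightarrow> integrable lborel (\<lambda>z::complex. indicator {0..1} ((norm z)\<^sup>2) * ((norm z)\<^sup>2) powr e)"
    "e < -1 \<Longrightarrow> integrable lborel (\<lambda>z::complex. indicator {1..} ((norm z)\<^sup>2) * ((norm z)\<^sup>2) powr e)"
proof -
  have *: "integrable lborel (\<lambda>z::complex. indicator A ((norm z)\<^sup>2) * ((norm z)\<^sup>2) powr e)"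
    if A: "A \<subseteq> {0..}" "A \<in> sets borel" and I: "((\<lambda>s. s powr e) has_integral I) A" for A I
  proof -
    have [measurable]: "A \<in> sets borel" by fact
    have "((\<lambda>s. indicator A s * s powr e) has_integral I) UNIV"
    proof -
      have "(\<lambda>s. indicator A s * s powr e) = (\<lambda>s. if s \<in> A then s powr e else 0)" by (auto simp: fun_eq_iff)
      then show ?thesis using has_integral_restrict_UNIV[of A "\<lambda>s. s powr e" I] I by simp
    qed
    from nn_integral_has_integral_lborel[OF _ _ this]
    have "(\<integral>\<^sup>+s. ennreal (indicator A s * s powr e) \<partial>lborel) = ennreal I" by simp
    then have "integrable lborel (\<lambda>s. indicator A s * s powr e)"
      by (intro integrableI_nonneg) auto
    moreover have "(\<lambda>s. indicator {0..} s * (indicator A s * s powr e)) = (\<lambda>s. indicator A s * s powr e)"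
      using A(1) by (auto simp: indicator_def fun_eq_iff)
    ultimately show ?thesis by (subst radial_integral) (simp_all only:, measurable)
  qed
  show "integrable lborel (\<lambda>z::complex. indicator {0..1} ((norm z)\<^sup>2) * ((norm z)\<^sup>2) powr e)" if "e > -1"
    using has_integral_powr_from_0[OF that, of 1] by (intro *) auto
  show "integrable lborel (\<lambda>z::complex. indicator {1..} ((norm z)\<^sup>2) * ((norm z)\<^sup>2) powr e)" if "e < -1"
    using has_integral_powr_to_inf[OF that, of 1] by (intro *) auto
qed

lemma norm_square_powr: "((norm (z::complex))\<^sup>2) powr e = (if z = 0 then 0 else exp (2 * (e * ln (norm z))))"
  by (simp add: powr_def ln_realpow)

text \<open>\<open>exp (2 U)\<close> behaves like \<open>|w - z|\<close> to the power
  \<open>2 e z\<close> near \<open>z\<close> and like \<open>|w|\<close> to the power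
  \<open>- 2 \<gamma>\<close> at infinity; \<open>e z > -1\<close> and \<open>\<gamma> > 1\<close>
  are the conditions for integrability in the plane. The majorant \<open>g\<close> adds these models
  to a constant on the remaining compact set.\<close>

lemma integrable_exp_singular:
  fixes Z :: "complex set" and U :: "complex \<Rightarrow> real"
  assumes Z: "finite Z" and cU: "continuous_on (- Z) U"
    and sing: "\<And>z. z \<in> Z \<Longrightarrow> ((\<lambda>w. U w - e z * ln (norm (w - z))) \<longlongrightarrow> L z) (at z)" and e: "\<And>z. z \<in> Z \<Longrightarrow> e z > -1"
    and inf: "((\<lambda>w. U w + \<gamma> * ln (norm w)) \<longlongrightarrow> Linf) at_infinity" and \<gamma>: "\<gamma> > 1"
  shows "integrable lborel (\<lambda>z. exp (2 * U z))"
proof -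
  have Um[measurable]: "U \<in> borel_measurable borel"
    by (rule borel_measurable_continuous_countable_exceptions[OF countable_finite[OF Z] cU])
  have aux: "x < \<bar>y\<bar> + 1" if "dist x y < 1" for x y :: real
    using that unfolding dist_real_def by linarith
  have "\<forall>z\<in>Z. \<exists>d>0. \<forall>w. w \<noteq> z \<and> dist w z < d \<longrightarrow> U w - e z * ln (norm (w - z)) < \<bar>L z\<bar> + 1"
  proof
    fix z assume "z \<in> Z"
    from tendstoD[OF sing[OF this], of 1] show "\<exists>d>0. \<forall>w. w \<noteq> z \<and> dist w z < d \<longrightarrow> U w - e z * ln (norm (w - z)) < \<bar>L z\<bar> + 1"
      unfolding eventually_at by (auto intro: aux)
  qed
  then obtain d0 where d0: "\<And>z. z \<in> Z \<Longrightarrow> d0 z > 0"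
    "\<And>z w. z \<in> Z \<Longrightarrow> w \<noteq> z \<Longrightarrow> dist w z < d0 z \<Longrightarrow> U w - e z * ln (norm (w - z)) < \<bar>L z\<bar> + 1"
    by metis
  define d where "d = (\<lambda>z. min (d0 z) 1)"
  from tendstoD[OF inf, of 1] obtain R0 where R0: "\<And>w. norm w \<ge> R0 \<Longrightarrow> U w + \<gamma> * ln (norm w) < \<bar>Linf\<bar> + 1"
    unfolding eventually_at_infinity by (auto intro: aux)
  define R where "R = max R0 1"
  define S where "S = cball 0 R - (\<Union>z\<in>Z. ball z (d z))"
  have "compact S" unfolding S_def by (intro compact_diff compact_cball open_UN) auto
  moreover have "S \<subseteq> - Z" using d0(1) by (auto simp: S_def d_def)
  ultimately obtain M where M: "\<forall>z\<in>S. norm (U z) \<le> M"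
    using continuous_on_compact_bounded[of S U] continuous_on_subset[OF cU] by blast
  define g where "g = (\<lambda>w. (\<Sum>z\<in>Z. exp (2 * (\<bar>L z\<bar> + 1)) * (indicator {0..1} ((norm (w - z))\<^sup>2) * ((norm (w - z))\<^sup>2) powr e z))
     + exp (2 * (\<bar>Linf\<bar> + 1)) * (indicator {1..} ((norm w)\<^sup>2) * ((norm w)\<^sup>2) powr (- \<gamma>)) + exp (2 * M) * indicator (cball 0 R) w)"
  have ig: "integrable lborel g"
  proof -
    have "integrable lborel (\<lambda>w::complex. indicator {0..1} ((norm (w - z))\<^sup>2) * ((norm (w - z))\<^sup>2) powr e z)" if "z \<in> Z" for z
    proof -
      have [measurable]: "(\<lambda>w::complex. indicator {0..1::real} ((norm w)\<^sup>2) * ((norm w)\<^sup>2) powr e z) \<in> borel_measurable borel"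
        by measurable
      have "integrable (distr lborel borel ((+) z)) (\<lambda>w::complex. indicator {0..1} ((norm (w - z))\<^sup>2) * ((norm (w - z))\<^sup>2) powr e z)"
        by (subst integrable_distr_eq) (auto intro: integrable_norm_powr(1)[OF e[OF that]])
      then show ?thesis by (simp only: lborel_distr_plus)
    qed
    then show ?thesis unfolding g_def using \<gamma> emeasure_lborel_cball_finite[of "0::complex" R]
      by (intro Bochner_Integration.integrable_add Bochner_Integration.integrable_sum integrable_mult_right integrable_norm_powr(2) integrable_real_indicator) auto
  qed
  have s0: "0 \<le> (\<Sum>z\<in>Z. exp (2 * (\<bar>L z\<bar> + 1)) * (indicator {0..1} ((norm (w - z))\<^sup>2) * ((norm (w - z))\<^sup>2) powr e z))" for w
    by (intro sum_nonneg) auto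
  have s1: "0 \<le> exp (2 * (\<bar>Linf\<bar> + 1)) * (indicator {1..} ((norm w)\<^sup>2) * ((norm w)\<^sup>2) powr (- \<gamma>))" for w :: complex by simp
  have s2: "0 \<le> exp (2 * M) * indicator (cball 0 R) w" for w :: complex by simp
  have bd: "exp (2 * U w) \<le> g w" if w: "w \<notin> Z" for w
  proof -
    consider z where "z \<in> Z" "dist w z < d z" | "norm w \<ge> R" | "w \<in> S"
      by (cases "\<exists>z\<in>Z. dist w z < d z"; cases "norm w \<ge> R") (auto simp: S_def dist_commute not_less)
    then show ?thesis
    proof cases
      case 1
      have wz: "w \<noteq> z" using 1 w by auto
      have n1: "(norm (w - z))\<^sup>2 \<le> 1" using 1 by (auto simp: d_def dist_norm intro!: power_le_one)
      have "U w < e z * ln (norm (w - z)) + (\<bar>L z\<bar> + 1)" using d0(2)[OF 1(1) wz] 1(2) by (simp add: d_def)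
      then have "exp (2 * U w) \<le> exp (2 * (\<bar>L z\<bar> + 1)) * exp (2 * (e z * ln (norm (w - z))))"
        by (simp add: exp_add[symmetric])
      also have "\<dots> = exp (2 * (\<bar>L z\<bar> + 1)) * (indicator {0..1} ((norm (w - z))\<^sup>2) * ((norm (w - z))\<^sup>2) powr e z)"
        using wz n1 by (subst norm_square_powr) simp
      also have "\<dots> \<le> (\<Sum>z\<in>Z. exp (2 * (\<bar>L z\<bar> + 1)) * (indicator {0..1} ((norm (w - z))\<^sup>2) * ((norm (w - z))\<^sup>2) powr e z))"
        by (rule member_le_sum[OF 1(1)]) (use Z in auto)
      finally show ?thesis unfolding g_def using s1[of w] s2[of w] by linarith
    next
      case 2
      then have n1: "1 \<le> (norm w)\<^sup>2" "w \<noteq> 0" "norm w \<ge> R0" by (auto simp: R_def one_le_power)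
      have "U w < - \<gamma> * ln (norm w) + (\<bar>Linf\<bar> + 1)" using R0[OF n1(3)] by simp
      then have "exp (2 * U w) \<le> exp (2 * (\<bar>Linf\<bar> + 1)) * exp (2 * (- \<gamma> * ln (norm w)))"
        by (simp add: exp_add[symmetric])
      also have "\<dots> = exp (2 * (\<bar>Linf\<bar> + 1)) * (indicator {1..} ((norm w)\<^sup>2) * ((norm w)\<^sup>2) powr (- \<gamma>))"
        using n1 by (subst norm_square_powr) simp
      finally show ?thesis unfolding g_def using s0[of w] s2[of w] by linarith
    next
      case 3
      then have "U w \<le> M" "w \<in> cball 0 R" using M by (auto simp: S_def abs_le_iff)
      then have "exp (2 * U w) \<le> exp (2 * M) * indicator (cball 0 R) w" by simp
      then show ?thesis unfolding g_def using s0[of w] s1[of w] by linarith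
    qed
  qed
  show ?thesis
  proof (rule Bochner_Integration.integrable_bound[OF ig])
    have "AE w in lborel. w \<notin> Z" by (rule AE_not_in[OF finite_imp_null_set_lborel[OF Z]])
    then show "AE w in lborel. norm (exp (2 * U w)) \<le> norm (g w)"
      by eventually_elim (use bd in \<open>auto intro: order_trans[OF _ abs_ge_self]\<close>)
  qed measurable
qed

lemma nn_integral_exp_atMost: "(\<integral>\<^sup>+t. ennreal (exp (2 * t)) * indicator {..u} t \<partial>lborel) = ennreal (exp (2 * u) / 2)"
proof -
  have "(\<integral>\<^sup>+t. ennreal (exp (2 * t)) * indicator {..u} t \<partial>lborel)
     = (\<integral>\<^sup>+s. ennreal (exp (2 * (0 + -1 * s))) * indicator {..u} (0 + -1 * s) \<partial>lborel)"
    by (subst nn_integral_real_affine[where c="-1" and t=0]) auto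
  also have "\<dots> = (\<integral>\<^sup>+s. ennreal (exp (- 2 * s)) * indicator {- u..} s \<partial>lborel)"
    by (intro nn_integral_cong) (auto simp: indicator_def)
  also have "\<dots> = ennreal (0 - - exp (- 2 * (- u)) / 2)"
  proof (rule nn_integral_FTC_atLeast)
    show "((\<lambda>s. - exp (- 2 * s) / 2) has_real_derivative exp (- 2 * x)) (at x)" for x :: real
      by (auto intro!: derivative_eq_intros)
    show "((\<lambda>s::real. - exp (- 2 * s) / 2) \<longlongrightarrow> 0) at_top" by real_asymp
  qed auto
  finally show ?thesis by simp
qed

lemma cauchy_schwarz_weighted:
  fixes w g :: "complex \<Rightarrow> real"
  assumes w: "integrable lborel w" and wg: "integrable lborel (\<lambda>z. w z * g z)" and wgg: "integrable lborel (\<lambda>z. w z * (g z)\<^sup>2)"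
    and nn: "\<And>z. w z \<ge> 0"
  shows "(\<integral>z. w z * g z \<partial>lborel)\<^sup>2 \<le> (\<integral>z. w z \<partial>lborel) * (\<integral>z. w z * (g z)\<^sup>2 \<partial>lborel)"
proof -
  define D I E where "D = (\<integral>z. w z \<partial>lborel)" and "I = (\<integral>z. w z * g z \<partial>lborel)" and "E = (\<integral>z. w z * (g z)\<^sup>2 \<partial>lborel)"
  have key: "0 \<le> E - 2 * l * I + l\<^sup>2 * D" for l
  proof -
    have "0 \<le> (\<integral>z. w z * (g z - l)\<^sup>2 \<partial>lborel)" using nn by (intro Bochner_Integration.integral_nonneg) auto
    also have "(\<lambda>z. w z * (g z - l)\<^sup>2) = (\<lambda>z. w z * (g z)\<^sup>2 - (2 * l) * (w z * g z) + l\<^sup>2 * w z)"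
      by (auto simp: power2_eq_square algebra_simps)
    finally show ?thesis using w wg wgg by (simp add: D_def I_def E_def)
  qed
  have D: "D \<ge> 0" unfolding D_def using nn by (intro Bochner_Integration.integral_nonneg) auto
  have "I\<^sup>2 \<le> D * E"
  proof (cases "D = 0")
    case True
    have "I = 0"
    proof (rule ccontr)
      \<comment> \<open>With \<open>D = 0\<close> the polynomial is affine in \<open>l\<close>, and
        \<open>l = (E + 1) / (2 I)\<close> would give it the value -1.\<close>
      assume "I \<noteq> 0"
      then have "2 * ((E + 1) / (2 * I)) * I = E + 1" by simp
      then show False using key[of "(E + 1) / (2 * I)"] True by simp
    qed
    then show ?thesis using True by simp
  next
    case False
    then have "D > 0" using D by simp
    have "0 \<le> D * (E - 2 * (I / D) * I + (I / D)\<^sup>2 * D)" using key[of "I / D"] D by simp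
    also have "\<dots> = D * E - I\<^sup>2" using \<open>D > 0\<close> by (simp add: field_simps power2_eq_square)
    finally show ?thesis by simp
  qed
  then show ?thesis by (simp add: D_def I_def E_def)
qed

section \<open>Conic metrics in the plane\<close>

text \<open>The cone point at infinity has order \<open>\<gamma> - 2\<close>, the one at \<open>z \<in> Z\<close> has order \<open>e z\<close>.\<close>

locale planar_conic =
  fixes Z :: "complex set" and e :: "complex \<Rightarrow> real" and \<gamma> :: real and U :: "complex \<Rightarrow> real"
    and p :: "complex \<Rightarrow> complex" and p' :: "complex \<Rightarrow> complex \<Rightarrow> complex" and a b :: real
  assumes Z: "finite Z" and C: "C2_grad (- Z) U p p'"
    and e: "\<And>z. z \<in> Z \<Longrightarrow> -1 < e z" "\<And>z. z \<in> Z \<Longrightarrow> e z \<le> 0" and \<gamma>: "\<gamma> > 1"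
    and sing: "\<And>z. z \<in> Z \<Longrightarrow> \<exists>L. ((\<lambda>w. U w - e z * ln (norm (w - z))) \<longlongrightarrow> L) (at z)"
    and inf: "\<exists>L. ((\<lambda>w. U w + \<gamma> * ln (norm w)) \<longlongrightarrow> L) at_infinity"
    and curv: "\<And>z. z \<notin> Z \<Longrightarrow> a * exp (2 * U z) \<le> - tr (p' z)" "\<And>z. z \<notin> Z \<Longrightarrow> - tr (p' z) \<le> b * exp (2 * U z)"
begin

definition \<rho> :: "complex \<Rightarrow> real" where "\<rho> z = exp (2 * U z)"
text \<open>Curvature times area density. The value on the null set \<open>Z\<close> is a convention
  under which the curvature bounds hold at every point.\<close>

definition k :: "complex \<Rightarrow> real" where "k z = (if z \<in> Z then a * \<rho> z else - tr (p' z))"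
definition V :: real where "V = (\<integral>z. \<rho> z \<partial>lborel)"
definition \<alpha> :: real where "\<alpha> = (\<Sum>z\<in>Z. e z)"

lemma \<rho>_nonneg: "0 \<le> \<rho> z"
  by (simp add: \<rho>_def)

lemma ab: "a \<le> b"
proof -
  obtain z where "z \<notin> Z" using Z ex_new_if_finite infinite_UNIV_char_0 by blast
  then have "a * exp (2 * U z) \<le> b * exp (2 * U z)" using curv[of z] by linarith
  then show ?thesis by simp
qed

lemma k_bounds: "a * \<rho> z \<le> k z" "k z \<le> b * \<rho> z"
  using curv[of z] ab by (auto simp: k_def \<rho>_def)

lemma measurable_Z [measurable]: "Z \<in> sets borel"
  using finite_imp_null_set_lborel[OF Z] by auto

lemma AE_Z: "AE z in lborel. z \<notin> Z"
  by (rule AE_not_in[OF finite_imp_null_set_lborel[OF Z]])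

lemma measurable_cont: "continuous_on (- Z) f \<Longrightarrow> f \<in> borel_measurable borel"
  for f :: "complex \<Rightarrow> 'b::topological_space"
  by (rule borel_measurable_continuous_countable_exceptions[OF countable_finite[OF Z]])

lemma measurable_U [measurable]: "U \<in> borel_measurable borel"
  and measurable_p [measurable]: "p \<in> borel_measurable borel"
  and measurable_tr [measurable]: "(\<lambda>z. tr (p' z)) \<in> borel_measurable borel"
  by (intro measurable_cont C2_gradD[OF C])+

lemma measurable_\<rho> [measurable]: "\<rho> \<in> borel_measurable borel"
  unfolding \<rho>_def by measurable

lemma measurable_k [measurable]: "k \<in> borel_measurable borel"
  unfolding k_def by measurable

lemma measurable_spline [measurable]: "spline n \<in> borel_measurable borel"
  by (intro borel_measurable_continuous_onI continuous_spline continuous_on_id)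

lemma sing_fun: "\<exists>L. \<forall>z\<in>Z. ((\<lambda>w. U w - e z * ln (norm (w - z))) \<longlongrightarrow> L z) (at z)"
  using sing by metis

lemma integrable_\<rho>: "integrable lborel \<rho>"
proof -
  obtain L Linf where "\<forall>z\<in>Z. ((\<lambda>w. U w - e z * ln (norm (w - z))) \<longlongrightarrow> L z) (at z)"
    "((\<lambda>w. U w + \<gamma> * ln (norm w)) \<longlongrightarrow> Linf) at_infinity" using sing_fun inf by blast
  then show ?thesis unfolding \<rho>_def
    by (intro integrable_exp_singular[OF Z C2_gradD(4)[OF C] _ e(1) _ \<gamma>]) auto
qed

lemma integrable_k: "integrable lborel k"
proof (rule Bochner_Integration.integrable_bound)
  show "integrable lborel (\<lambda>z. (\<bar>a\<bar> + \<bar>b\<bar>) * \<rho> z)" using integrable_\<rho> by simp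
  have "\<bar>k z\<bar> \<le> (\<bar>a\<bar> + \<bar>b\<bar>) * \<rho> z" for z
  proof -
    have r: "\<rho> z \<ge> 0" by (simp add: \<rho>_def)
    have "\<bar>a * \<rho> z\<bar> = \<bar>a\<bar> * \<rho> z" "\<bar>b * \<rho> z\<bar> = \<bar>b\<bar> * \<rho> z" using r by (simp_all add: abs_mult)
    then show ?thesis using k_bounds[of z] unfolding distrib_right by linarith
  qed
  then show "AE z in lborel. norm (k z) \<le> norm ((\<bar>a\<bar> + \<bar>b\<bar>) * \<rho> z)"
    by (intro AE_I2) (auto intro: order_trans[OF _ abs_ge_self])
qed measurable

text \<open>The flux theorem for \<open>U\<close> itself. As the order at infinity is
  \<open>\<gamma> - 2\<close>, the factor \<open>\<gamma> + \<alpha>\<close> is the Euler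
  characteristic 2 plus the degree of the divisor.\<close>

lemma gauss_bonnet: "(\<integral>z. k z \<partial>lborel) = 2 * pi * (\<gamma> + \<alpha>)"
proof -
  obtain L Linf where L: "\<forall>z\<in>Z. ((\<lambda>w. U w - e z * ln (norm (w - z))) \<longlongrightarrow> L z) (at z)"
    "((\<lambda>w. U w + \<gamma> * ln (norm w)) \<longlongrightarrow> Linf) at_infinity" using sing_fun inf by blast
  have "(\<integral>z. (0::real) \<partial>(lborel :: complex measure)) = (\<integral>z. k z \<partial>lborel) - 2 * pi * (\<gamma> + (\<Sum>z\<in>Z. e z))"
  proof (rule flux_theorem(2)[OF Z C _ L(2), where P="\<lambda>_. 0" and Q=k])
    show "integrable lborel k" by (rule integrable_k)
  qed (use L in \<open>auto simp: k_def\<close>)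
  then show ?thesis by (simp add: \<alpha>_def)
qed

text \<open>The logarithmic decay of \<open>U\<close> makes its superlevel sets bounded, so the
  isoperimetric inequality for compactly supported functions applies to truncations of
  \<open>U\<close>.\<close>

lemma U_small: "\<exists>R. \<forall>z. norm z \<ge> R \<longrightarrow> U z < t"
proof -
  obtain L where "((\<lambda>w. U w + \<gamma> * ln (norm w)) \<longlongrightarrow> L) at_infinity" using inf by blast
  from tendstoD[OF this, of 1] obtain R0 where R0: "\<And>w. norm w \<ge> R0 \<Longrightarrow> dist (U w + \<gamma> * ln (norm w)) L < 1"
    unfolding eventually_at_infinity by auto
  have "U z < t" if z: "norm z \<ge> max R0 (exp ((\<bar>L\<bar> + 1 - t) / \<gamma>))" for z
  proof -
    have "exp ((\<bar>L\<bar> + 1 - t) / \<gamma>) \<le> norm z" using z by simp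
    then have "(\<bar>L\<bar> + 1 - t) / \<gamma> \<le> ln (norm z)"
      by (metis exp_gt_zero ln_exp ln_le_cancel_iff order_less_le_trans)
    then have "\<bar>L\<bar> + 1 - t \<le> \<gamma> * ln (norm z)" using \<gamma> by (simp add: pos_divide_le_eq mult.commute)
    moreover have "dist (U z + \<gamma> * ln (norm z)) L < 1" using R0 z by simp
    ultimately show ?thesis unfolding dist_real_def by linarith
  qed
  then show ?thesis by blast
qed

text \<open>The flux theorem for \<open>\<phi>(U)\<close>, where \<open>\<phi>\<close> is convex,
  zero below \<open>t\<close> and equal to \<open>x - t - 3 h / 2\<close> above
  \<open>t + 3 h\<close>. The truncation removes the logarithm at infinity. It keeps every
  coefficient \<open>e z\<close>: if \<open>e z < 0\<close>, then \<open>U\<close> tends to infinity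
  at \<open>z\<close> and is changed only by a constant there; if \<open>e z = 0\<close>, then
  \<open>\<phi>(U)\<close> has a finite limit. This is where the orders must not be positive, since
  then \<open>U\<close> would tend to minus infinity and the coefficient would be lost.\<close>

lemma truncated_energy:
  assumes h: "h > 0"
  shows "integrable lborel (\<lambda>z. spline 2 ((U z - t) / h) / h * (norm (p z))\<^sup>2)"
    "(\<integral>z. spline 2 ((U z - t) / h) / h * (norm (p z))\<^sup>2 \<partial>lborel) = (\<integral>z. spline 3 ((U z - t) / h) * k z \<partial>lborel) - 2 * pi * \<alpha>"
proof -
  obtain L where L: "\<And>z. z \<in> Z \<Longrightarrow> ((\<lambda>w. U w - e z * ln (norm (w - z))) \<longlongrightarrow> L z) (at z)"
    using sing_fun by blast
  define \<phi> where "\<phi> = (\<lambda>x. h * spline 4 ((x - t) / h))"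
  have d: "((\<lambda>x. (x - t) / h) has_real_derivative 1 / h) (at x)" for x using h by (auto intro!: derivative_eq_intros)
  have d1: "(\<phi> has_real_derivative spline 3 ((x - t) / h)) (at x)" for x
    using DERIV_cmult[OF DERIV_chain2[where f="spline 4", OF DERIV_spline_4 d], of h x] h
    unfolding \<phi>_def by simp
  have d2: "((\<lambda>x. spline 3 ((x - t) / h)) has_real_derivative spline 2 ((x - t) / h) / h) (at x)" for x
    using DERIV_chain2[where f="spline 3", OF DERIV_spline_3 d] by simp
  have C': "C2_grad (- Z) (\<lambda>z. \<phi> (U z)) (\<lambda>z. spline 3 ((U z - t) / h) *\<^sub>R p z)
     (\<lambda>z v. (spline 2 ((U z - t) / h) / h * (p z \<bullet> v)) *\<^sub>R p z + spline 3 ((U z - t) / h) *\<^sub>R p' z v)"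
  proof (rule C2_grad_compose_real[OF C d1 d2])
    show "continuous_on (U ` (- Z)) (\<lambda>x. spline 2 ((x - t) / h) / h)"
      using h by (intro continuous_on_divide continuous_spline continuous_on_diff continuous_on_id continuous_on_const) (use h in simp_all)
  qed
  define L' where "L' = (\<lambda>z. if e z = 0 then \<phi> (L z) else L z - t - h * (3/2))"
  have s': "((\<lambda>w. \<phi> (U w) - e z * ln (norm (w - z))) \<longlongrightarrow> L' z) (at z)" if z: "z \<in> Z" for z
  proof (cases "e z = 0")
    case True
    have "isCont \<phi> (L z)" using d1 DERIV_isCont by blast
    moreover have "(U \<longlongrightarrow> L z) (at z)" using L[OF z] True by simp
    ultimately have "((\<lambda>w. \<phi> (U w)) \<longlongrightarrow> \<phi> (L z)) (at z)" by (rule isCont_tendsto_compose)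
    then show ?thesis using True by (simp add: L'_def)
  next
    case False
    then have ez: "e z < 0" using e(2)[OF z] by simp
    have "filterlim (\<lambda>w. norm (w - z)) (at_right 0) (at z)"
      unfolding filterlim_at by (auto simp: eventually_at_filter intro!: tendsto_eq_intros)
    from filterlim_compose[OF ln_at_0 this] have "filterlim (\<lambda>w. ln (norm (w - z))) at_bot (at z)" .
    then have "filterlim (\<lambda>w. - ln (norm (w - z))) at_top (at z)" by (simp add: filterlim_uminus_at_top)
    from filterlim_tendsto_pos_mult_at_top[OF tendsto_const _ this, of "- e z"] ez
    have "filterlim (\<lambda>w. e z * ln (norm (w - z))) at_top (at z)" by simp
    from filterlim_tendsto_add_at_top[OF L[OF z] this] have "filterlim U at_top (at z)" by simp
    then have "eventually (\<lambda>w. U w \<ge> t + 3 * h) (at z)" by (simp add: filterlim_at_top)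
    then have "eventually (\<lambda>w. U w - e z * ln (norm (w - z)) - t - h * (3/2) = \<phi> (U w) - e z * ln (norm (w - z))) (at z)"
    proof eventually_elim
      case (elim w)
      then have "(U w - t) / h \<ge> 3" using h by (simp add: le_divide_eq)
      then have "\<phi> (U w) = U w - t - h * (3/2)" using h by (simp add: \<phi>_def spline_ge_3 field_simps)
      then show ?case by simp
    qed
    moreover have "((\<lambda>w. U w - e z * ln (norm (w - z)) - t - h * (3/2)) \<longlongrightarrow> L' z) (at z)"
      using False unfolding L'_def by (auto intro!: tendsto_diff L z tendsto_const)
    ultimately show ?thesis by (rule Lim_transform_eventually[rotated])
  qed
  have i': "((\<lambda>w. \<phi> (U w) + 0 * ln (norm w)) \<longlongrightarrow> 0) at_infinity"
  proof (rule tendsto_eventually)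
    obtain R where "\<forall>z. norm z \<ge> R \<longrightarrow> U z < t" using U_small by blast
    then show "eventually (\<lambda>w. \<phi> (U w) + 0 * ln (norm w) = 0) at_infinity"
      unfolding eventually_at_infinity using h
      by (intro exI[of _ R]) (auto simp: \<phi>_def spline_le_0 divide_nonpos_pos)
  qed
  have PQ: "tr (\<lambda>v. (spline 2 ((U z - t) / h) / h * (p z \<bullet> v)) *\<^sub>R p z + spline 3 ((U z - t) / h) *\<^sub>R p' z v)
     = spline 2 ((U z - t) / h) / h * (norm (p z))\<^sup>2 - spline 3 ((U z - t) / h) * k z" if "z \<notin> Z" for z
    unfolding tr_compose_real using that by (simp add: k_def)
  have Pn: "0 \<le> spline 2 ((U z - t) / h) / h * (norm (p z))\<^sup>2" for z using h spline_2_nonneg by simp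
  have Q: "integrable lborel (\<lambda>z. spline 3 ((U z - t) / h) * k z)"
    by (rule has_derivative_integral_spline(4)[OF measurable_U integrable_k h])
  have Pm: "(\<lambda>z. spline 2 ((U z - t) / h) / h * (norm (p z))\<^sup>2) \<in> borel_measurable borel" by measurable
  note F = flux_theorem[OF Z C' s' i' PQ Pm Pn Q]
  show "integrable lborel (\<lambda>z. spline 2 ((U z - t) / h) / h * (norm (p z))\<^sup>2)"
    "(\<integral>z. spline 2 ((U z - t) / h) / h * (norm (p z))\<^sup>2 \<partial>lborel) = (\<integral>z. spline 3 ((U z - t) / h) * k z \<partial>lborel) - 2 * pi * \<alpha>"
    using F by (auto simp: \<alpha>_def)
qed

text \<open>The step function of \<open>U\<close> has gradient \<open>w p\<close>, where
  \<open>w\<close> is the smoothed density of the level. The isoperimetric inequality bounds the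
  integral of \<open>w |p|\<close> from below, Cauchy-Schwarz with weight \<open>w\<close> bounds it
  from above, and the integral of \<open>w |p|^2\<close> is the truncated energy. The shift
  \<open>3 * h\<close> is the width of the step.\<close>

lemma level_isoperimetric:
  assumes h: "h > 0"
  shows "4 * pi * measure lborel {z. z \<notin> Z \<and> t + 3 * h \<le> U z} \<le>
    (\<integral>z. spline 2 ((U z - t) / h) / h \<partial>lborel) * ((\<integral>z. spline 3 ((U z - t) / h) * k z \<partial>lborel) - 2 * pi * \<alpha>)"
    "integrable lborel (\<lambda>z. spline 2 ((U z - t) / h) / h)"
    "emeasure lborel {z. z \<notin> Z \<and> t + 3 * h \<le> U z} = ennreal (measure lborel {z. z \<notin> Z \<and> t + 3 * h \<le> U z})"
proof -
  obtain R where R: "\<And>z. norm z \<ge> R \<Longrightarrow> U z < t" using U_small by blast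
  obtain B where B: "B > 0" "\<And>x. \<bar>spline 2 x\<bar> \<le> B" using spline_bounded[of 2] by auto
  define w where "w = (\<lambda>z. spline 2 ((U z - t) / h) / h)"
  have w0: "w z \<ge> 0" for z using h spline_2_nonneg by (simp add: w_def)
  have wm[measurable]: "w \<in> borel_measurable borel" unfolding w_def by measurable
  have le: "(U z - t) / h \<le> 0" if "norm z \<ge> R" for z
    using R[OF that] h by (simp add: divide_nonpos_pos)
  show iw: "integrable lborel (\<lambda>z. spline 2 ((U z - t) / h) / h)"
  proof (rule Bochner_Integration.integrable_bound)
    show "integrable lborel (\<lambda>z::complex. B / h * indicator (cball 0 R) z)"
      using emeasure_lborel_cball_finite[of "0::complex" R]
      by (intro integrable_mult_right integrable_real_indicator) auto
    have "norm (spline 2 ((U z - t) / h) / h) \<le> B / h * indicator (cball 0 R) z" for z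
      using B(2)[of "(U z - t) / h"] h le[of z] by (cases "norm z \<le> R") (auto simp: divide_right_mono spline_le_0)
    then show "AE z in lborel. norm (spline 2 ((U z - t) / h) / h) \<le> norm (B / h * indicator (cball 0 R) z)"
      by (intro AE_I2) (metis abs_ge_self order_trans real_norm_def)
  qed measurable
  then have iw': "integrable lborel w" by (simp add: w_def)
  have iE: "integrable lborel (\<lambda>z. w z * (norm (p z))\<^sup>2)"
    using truncated_energy(1)[OF h] by (simp add: w_def)
  have iN: "integrable lborel (\<lambda>z. w z * norm (p z))"
  proof (rule Bochner_Integration.integrable_bound)
    show "integrable lborel (\<lambda>z. w z + w z * (norm (p z))\<^sup>2)" using iw' iE by simp
    \<comment> \<open>Integrability of \<open>w |p|\<close> is deduced from that of \<open>w\<close>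
      and \<open>w |p|^2\<close>.\<close>
    have "x \<le> 1 + x\<^sup>2" for x :: real using zero_le_power2[of "x - 1"] by (simp add: power2_eq_square algebra_simps) (smt (verit) zero_le_square)
    then have "w z * norm (p z) \<le> w z * (1 + (norm (p z))\<^sup>2)" for z by (intro mult_left_mono w0)
    then show "AE z in lborel. norm (w z * norm (p z)) \<le> norm (w z + w z * (norm (p z))\<^sup>2)"
      using w0 by (intro AE_I2) (auto simp: abs_mult distrib_left intro: order_trans[OF _ abs_ge_self])
  qed measurable
  have d: "((\<lambda>x. spline 3 ((x - t) / h)) has_real_derivative spline 2 ((x - t) / h) / h) (at x)" for x
  proof -
    have "((\<lambda>x. (x - t) / h) has_real_derivative 1 / h) (at x)" using h by (auto intro!: derivative_eq_intros)
    from DERIV_chain2[where f="spline 3", OF DERIV_spline_3 this] show ?thesis by simp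
  qed
  have der: "((\<lambda>z. spline 3 ((U z - t) / h)) has_derivative (\<lambda>v. (w z *\<^sub>R p z) \<bullet> v)) (at z)" if "z \<notin> Z" for z
    using has_derivative_compose[OF C2_gradD(1)[OF C] d[unfolded has_field_derivative_def], of z] that by (simp add: w_def)
  have cp: "continuous_on (- Z) (\<lambda>z. w z *\<^sub>R p z)"
    unfolding w_def by (intro continuous_intros C2_gradD[OF C]) (use h in simp_all)
  have s0: "spline 3 ((U z - t) / h) = 0" if "norm z \<ge> R" for z using le[OF that] by (simp add: spline_le_0)
  have "integrable lborel (\<lambda>z. norm (w z *\<^sub>R p z))" using iN w0 by simp
  from isoperimetric_singular[OF Z der cp spline_3_bounds s0 this]
  have i1: "4 * pi * measure lborel {z. z \<notin> Z \<and> spline 3 ((U z - t) / h) \<ge> 1} \<le> (\<integral>z. w z * norm (p z) \<partial>lborel)\<^sup>2"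
    using w0 by simp
  have "bounded {z. z \<notin> Z \<and> spline 3 ((U z - t) / h) \<ge> 1}"
  proof (rule bounded_subset[OF bounded_cball[of 0 R]], intro subsetI)
    fix z assume "z \<in> {z. z \<notin> Z \<and> spline 3 ((U z - t) / h) \<ge> 1}"
    then show "z \<in> cball 0 R" using s0[of z] by (cases "norm z \<ge> R") auto
  qed
  then have fin: "emeasure lborel {z. z \<notin> Z \<and> spline 3 ((U z - t) / h) \<ge> 1} < \<infinity>" by (rule emeasure_bounded_finite)
  have sub: "{z. z \<notin> Z \<and> t + 3 * h \<le> U z} \<subseteq> {z. z \<notin> Z \<and> spline 3 ((U z - t) / h) \<ge> 1}"
  proof
    fix z assume z: "z \<in> {z. z \<notin> Z \<and> t + 3 * h \<le> U z}"
    then have "(U z - t) / h \<ge> 3" using h by (simp add: le_divide_eq)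
    then show "z \<in> {z. z \<notin> Z \<and> spline 3 ((U z - t) / h) \<ge> 1}" using z by (simp add: spline_ge_3)
  qed
  have m1: "{z. z \<notin> Z \<and> spline 3 ((U z - t) / h) \<ge> 1} \<in> sets lborel" by measurable
  have m2: "{z. z \<notin> Z \<and> t + 3 * h \<le> U z} \<in> sets lborel" by measurable
  show "emeasure lborel {z. z \<notin> Z \<and> t + 3 * h \<le> U z} = ennreal (measure lborel {z. z \<notin> Z \<and> t + 3 * h \<le> U z})"
    using fin emeasure_mono[OF sub m1] by (intro emeasure_eq_ennreal_measure) auto
  have "measure lborel {z. z \<notin> Z \<and> t + 3 * h \<le> U z} \<le> measure lborel {z. z \<notin> Z \<and> spline 3 ((U z - t) / h) \<ge> 1}"
    using fin m1 m2 by (intro measure_mono_fmeasurable sub) (auto simp: fmeasurable_def)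
  then have "4 * pi * measure lborel {z. z \<notin> Z \<and> t + 3 * h \<le> U z} \<le> (\<integral>z. w z * norm (p z) \<partial>lborel)\<^sup>2"
    by (intro order_trans[OF _ i1] mult_left_mono) auto
  also have "\<dots> \<le> (\<integral>z. w z \<partial>lborel) * (\<integral>z. w z * (norm (p z))\<^sup>2 \<partial>lborel)"
    by (rule cauchy_schwarz_weighted[OF iw' iN iE w0])
  also have "(\<integral>z. w z * (norm (p z))\<^sup>2 \<partial>lborel) = (\<integral>z. spline 3 ((U z - t) / h) * k z \<partial>lborel) - 2 * pi * \<alpha>"
    using truncated_energy(2)[OF h] by (simp add: w_def)
  finally show "4 * pi * measure lborel {z. z \<notin> Z \<and> t + 3 * h \<le> U z} \<le>
    (\<integral>z. spline 2 ((U z - t) / h) / h \<partial>lborel) * ((\<integral>z. spline 3 ((U z - t) / h) * k z \<partial>lborel) - 2 * pi * \<alpha>)"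
    by (simp add: w_def)
qed

section \<open>The level inequality integrated over all levels\<close>

lemma measurable_levels [measurable]:
  "{x. snd x \<notin> Z \<and> fst x + c \<le> U (snd x)} \<in> sets (lborel \<Otimes>\<^sub>M lborel)"
proof -
  have "Measurable.pred (borel \<Otimes>\<^sub>M borel) (\<lambda>x. snd x \<notin> Z \<and> fst x + c \<le> U (snd x))" by measurable
  then show ?thesis by (simp add: pred_def space_pair_measure)
qed

text \<open>Fubini in \<open>(t, z)\<close>: for fixed \<open>z\<close> the levels run up to
  \<open>U z - 3 * h\<close>, and \<open>exp (2 * t)\<close> integrates to half of
  \<open>exp (2 * U z - 6 * h)\<close>. The width of the step thus costs the factor
  \<open>exp (- 6 * h)\<close>.\<close>

lemma nn_integral_levels:
  assumes h: "h > 0"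
  shows "(\<integral>\<^sup>+t. ennreal (exp (2 * t)) * emeasure lborel {z. z \<notin> Z \<and> t + 3 * h \<le> U z} \<partial>lborel) = ennreal (exp (- 6 * h) / 2 * V)"
proof -
  have "(\<integral>\<^sup>+t. ennreal (exp (2 * t)) * emeasure lborel {z. z \<notin> Z \<and> t + 3 * h \<le> U z} \<partial>lborel)
     = (\<integral>\<^sup>+t. \<integral>\<^sup>+z. ennreal (exp (2 * t)) * indicator {x. snd x \<notin> Z \<and> fst x + 3 * h \<le> U (snd x)} (t, z) \<partial>lborel \<partial>lborel)"
  proof (intro nn_integral_cong)
    fix t :: real
    have "(\<integral>\<^sup>+z. ennreal (exp (2 * t)) * indicator {x. snd x \<notin> Z \<and> fst x + 3 * h \<le> U (snd x)} (t, z) \<partial>lborel)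
      = (\<integral>\<^sup>+z. ennreal (exp (2 * t)) * indicator {z. z \<notin> Z \<and> t + 3 * h \<le> U z} z \<partial>lborel)"
      by (intro nn_integral_cong) (auto simp: indicator_def)
    also have "\<dots> = ennreal (exp (2 * t)) * emeasure lborel {z. z \<notin> Z \<and> t + 3 * h \<le> U z}"
      by (rule nn_integral_cmult_indicator) measurable
    finally show "ennreal (exp (2 * t)) * emeasure lborel {z. z \<notin> Z \<and> t + 3 * h \<le> U z}
      = (\<integral>\<^sup>+z. ennreal (exp (2 * t)) * indicator {x. snd x \<notin> Z \<and> fst x + 3 * h \<le> U (snd x)} (t, z) \<partial>lborel)" ..
  qed
  also have "\<dots> = (\<integral>\<^sup>+z. \<integral>\<^sup>+t. ennreal (exp (2 * t)) * indicator {x. snd x \<notin> Z \<and> fst x + 3 * h \<le> U (snd x)} (t, z) \<partial>lborel \<partial>lborel)"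
    by (rule lborel_pair.Fubini') measurable
  also have "\<dots> = (\<integral>\<^sup>+z. ennreal (exp (- 6 * h) / 2 * \<rho> z) \<partial>lborel)"
  proof (rule nn_integral_cong_AE)
    show "AE z in lborel. (\<integral>\<^sup>+t. ennreal (exp (2 * t)) * indicator {x. snd x \<notin> Z \<and> fst x + 3 * h \<le> U (snd x)} (t, z) \<partial>lborel)
      = ennreal (exp (- 6 * h) / 2 * \<rho> z)"
      using AE_Z
    proof eventually_elim
      case (elim z)
      have "(\<integral>\<^sup>+t. ennreal (exp (2 * t)) * indicator {x. snd x \<notin> Z \<and> fst x + 3 * h \<le> U (snd x)} (t, z) \<partial>lborel)
        = (\<integral>\<^sup>+t. ennreal (exp (2 * t)) * indicator {..U z - 3 * h} t \<partial>lborel)"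
        using elim by (intro nn_integral_cong) (auto simp: indicator_def)
      also have "\<dots> = ennreal (exp (- 6 * h) / 2 * \<rho> z)"
        unfolding nn_integral_exp_atMost by (simp add: \<rho>_def exp_add[symmetric] algebra_simps)
      finally show ?case .
    qed
  qed
  also have "\<dots> = ennreal (exp (- 6 * h) / 2 * V)"
    unfolding V_def using integrable_\<rho>
    by (subst nn_integral_eq_integral) (auto simp: \<rho>_nonneg)
  finally show ?thesis .
qed

text \<open>\<open>X\<close> is the total excess of curvature over \<open>a\<close>. The right-hand
  side is the total increase over all levels of a function \<open>R\<close> of the smoothed area
  \<open>P\<close> and excess \<open>Q\<close>; the term \<open>X^2 / 2\<close> comes from the bound
  \<open>Q \<le> (b - a) P\<close>.\<close>

lemma main_inequality_h:
  assumes h: "h > 0"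
  defines "X \<equiv> 2 * pi * (\<gamma> + \<alpha>) - a * V"
  shows "(b - a) * (2 * pi) * (exp (- 6 * h) * V) \<le> (b - a) * (a * V\<^sup>2 / 2 + V * X - 2 * pi * \<alpha> * V) - X\<^sup>2 / 2"
proof -
  define w where "w = (\<lambda>z. k z - a * \<rho> z)"
  have iw: "integrable lborel w" unfolding w_def using integrable_k integrable_\<rho> by simp
  have wX: "(\<integral>z. w z \<partial>lborel) = X"
    unfolding w_def X_def V_def using integrable_k integrable_\<rho> gauss_bonnet by simp
  have w0: "w z \<ge> 0" "w z \<le> (b - a) * \<rho> z" for z using k_bounds[of z] by (auto simp: w_def algebra_simps)
  define P where "P = (\<lambda>t. \<integral>z. spline 3 ((U z - t) / h) * \<rho> z \<partial>lborel)"
  define Q where "Q = (\<lambda>t. \<integral>z. spline 3 ((U z - t) / h) * w z \<partial>lborel)"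
  define P1 where "P1 = (\<lambda>t. \<integral>z. spline 2 ((U z - t) / h) / h * \<rho> z \<partial>lborel)"
  define Q1 where "Q1 = (\<lambda>t. \<integral>z. spline 2 ((U z - t) / h) / h * w z \<partial>lborel)"
  note hP = has_derivative_integral_spline[OF measurable_U integrable_\<rho> h, folded P_def P1_def V_def]
  note hQ = has_derivative_integral_spline[OF measurable_U iw h, folded Q_def Q1_def, unfolded wX]
  have dP: "(P has_real_derivative - P1 t) (at t)" and dQ: "(Q has_real_derivative - Q1 t) (at t)" for t
    unfolding P1_def Q1_def by (rule hP(1) hQ(1))+
  define \<Phi> where "\<Phi> = (\<lambda>t. a * P t + Q t - 2 * pi * \<alpha>)"
  have \<Phi>: "(\<integral>z. spline 3 ((U z - t) / h) * k z \<partial>lborel) - 2 * pi * \<alpha> = \<Phi> t" for t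
  proof -
    have "(\<lambda>z. spline 3 ((U z - t) / h) * k z) = (\<lambda>z. a * (spline 3 ((U z - t) / h) * \<rho> z) + spline 3 ((U z - t) / h) * w z)"
      by (auto simp: w_def algebra_simps)
    then show ?thesis using hP(4) hQ(4) by (simp add: \<Phi>_def P_def Q_def)
  qed
  have \<Phi>0: "\<Phi> t \<ge> 0" for t
  proof -
    have "0 \<le> (\<integral>z. spline 2 ((U z - t) / h) / h * (norm (p z))\<^sup>2 \<partial>lborel)"
      using h spline_2_nonneg by (intro Bochner_Integration.integral_nonneg) auto
    then show ?thesis unfolding truncated_energy(2)[OF h] \<Phi> .
  qed
  have Q10: "Q1 t \<ge> 0" for t unfolding Q1_def using h spline_2_nonneg w0 by (intro Bochner_Integration.integral_nonneg) auto
  have P10: "P1 t \<ge> 0" for t unfolding P1_def using h spline_2_nonneg by (intro Bochner_Integration.integral_nonneg) (auto simp: \<rho>_def)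
  have QP: "Q t \<le> (b - a) * P t" for t
  proof -
    have "spline 3 ((U z - t) / h) * w z \<le> (b - a) * (spline 3 ((U z - t) / h) * \<rho> z)" for z
      using mult_left_mono[OF w0(2) spline_3_bounds(1)] by (simp add: mult.left_commute)
    then have "Q t \<le> (\<integral>z. (b - a) * (spline 3 ((U z - t) / h) * \<rho> z) \<partial>lborel)"
      unfolding Q_def using hP(4) hQ(4) by (intro integral_mono) auto
    then show ?thesis by (simp add: P_def)
  qed
  \<comment> \<open>Where \<open>spline 2\<close> is nonzero one has \<open>U > t\<close>, so the
    area density is at least \<open>exp (2 * t)\<close>. After smoothing, the relation between the
    derivatives of Euclidean and Riemannian area survives as this inequality, in the direction that
    is needed.\<close>
  have DP: "exp (2 * t) * (\<integral>z. spline 2 ((U z - t) / h) / h \<partial>lborel) \<le> P1 t" for t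
  proof -
    have "exp (2 * t) * (spline 2 ((U z - t) / h) / h) \<le> spline 2 ((U z - t) / h) / h * \<rho> z" for z
    proof (cases "U z \<le> t")
      case True
      then have "(U z - t) / h \<le> 0" using h by (simp add: divide_nonpos_pos)
      then show ?thesis by (simp add: spline_le_0)
    next
      case False
      then have "exp (2 * t) \<le> \<rho> z" by (simp add: \<rho>_def)
      moreover have "0 \<le> spline 2 ((U z - t) / h) / h" using spline_2_nonneg h by simp
      ultimately show ?thesis by (subst mult.commute) (rule mult_left_mono)
    qed
    then have "(\<integral>z. exp (2 * t) * (spline 2 ((U z - t) / h) / h) \<partial>lborel) \<le> P1 t"
      unfolding P1_def by (intro integral_mono integrable_mult_right level_isoperimetric(2)[OF h] hP(5))
    then show ?thesis by simp
  qed
  \<comment> \<open>\<open>R' = (b - a) P1 \<Phi> + Q1 ((b - a) P - Q)\<close>: the second term compensates for \<open>P Q1\<close> in the product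
    rule, since the curvature density \<open>w\<close> is at most \<open>(b - a) \<rho>\<close>.\<close>
  define R where "R = (\<lambda>t. (b - a) * (2 * pi * \<alpha> * P t - a / 2 * (P t)\<^sup>2 - P t * Q t) + (Q t)\<^sup>2 / 2)"
  define R1 where "R1 = (\<lambda>t. (b - a) * (P1 t * \<Phi> t) + Q1 t * ((b - a) * P t - Q t))"
  have dR: "(R has_real_derivative R1 t) (at t)" for t
    unfolding R_def R1_def \<Phi>_def
    by (auto intro!: derivative_eq_intros dP dQ simp: power2_eq_square field_simps)
  have R10: "R1 t \<ge> 0" for t
    unfolding R1_def using ab P10 \<Phi>0 Q10 QP by simp
  define A where "A = (\<lambda>t. measure lborel {z. z \<notin> Z \<and> t + 3 * h \<le> U z})"
  have RA: "(b - a) * (4 * pi) * (exp (2 * t) * A t) \<le> R1 t" for t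
  proof -
    have "exp (2 * t) * (4 * pi * A t) \<le> exp (2 * t) * ((\<integral>z. spline 2 ((U z - t) / h) / h \<partial>lborel) * \<Phi> t)"
      using level_isoperimetric(1)[OF h, of t] unfolding \<Phi> A_def by (intro mult_left_mono) auto
    also have "\<dots> \<le> P1 t * \<Phi> t" using mult_right_mono[OF DP[of t] \<Phi>0[of t]] by (simp add: mult.assoc)
    finally have "(b - a) * (exp (2 * t) * (4 * pi * A t)) \<le> (b - a) * (P1 t * \<Phi> t)" using ab by (intro mult_left_mono) auto
    moreover have "0 \<le> Q1 t * ((b - a) * P t - Q t)" using Q10[of t] QP[of t] by simp
    moreover have "(b - a) * (exp (2 * t) * (4 * pi * A t)) = (b - a) * (4 * pi) * (exp (2 * t) * A t)" by simp
    ultimately show ?thesis unfolding R1_def by linarith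
  qed
  have [measurable]: "P1 \<in> borel_measurable borel" "Q1 \<in> borel_measurable borel" "P \<in> borel_measurable borel" "Q \<in> borel_measurable borel"
  proof -
    have [measurable]: "w \<in> borel_measurable borel" using iw by auto
    show "P1 \<in> borel_measurable borel" "Q1 \<in> borel_measurable borel" "P \<in> borel_measurable borel" "Q \<in> borel_measurable borel"
      unfolding P1_def Q1_def P_def Q_def by (rule lborel.borel_measurable_lebesgue_integral, measurable)+
  qed
  have R1m[measurable]: "R1 \<in> borel_measurable borel" unfolding R1_def \<Phi>_def by measurable
  \<comment> \<open>\<open>R\<close> tends to 0 at the top and to \<open>- Y\<close> at the
    bottom.\<close>
  define Y where "Y = (b - a) * (a * V\<^sup>2 / 2 + V * X - 2 * pi * \<alpha> * V) - X\<^sup>2 / 2"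
  have top: "(R \<longlongrightarrow> (b - a) * (2 * pi * \<alpha> * 0 - a / 2 * 0\<^sup>2 - 0 * 0) + 0\<^sup>2 / 2) at_top"
    unfolding R_def by (intro tendsto_intros hP(2) hQ(2)) auto
  have bot: "(R \<longlongrightarrow> (b - a) * (2 * pi * \<alpha> * V - a / 2 * V\<^sup>2 - V * X) + X\<^sup>2 / 2) at_bot"
    unfolding R_def by (intro tendsto_intros hP(3) hQ(3)) auto
  have lim: "(\<lambda>n. R (real n) - R (- real n)) \<longlonglongrightarrow> Y"
  proof -
    have 1: "(\<lambda>n. R (real n)) \<longlonglongrightarrow> 0" using filterlim_compose[OF top filterlim_real_sequentially] by simp
    have "filterlim (\<lambda>n. - real n) at_bot sequentially"
      using filterlim_real_sequentially by (simp add: filterlim_uminus_at_bot)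
    from filterlim_compose[OF bot this] have 2: "(\<lambda>n. R (- real n)) \<longlonglongrightarrow> - Y" by (simp add: Y_def algebra_simps)
    show ?thesis using tendsto_diff[OF 1 2] by simp
  qed
  have mono: "R (- real n) \<le> R (real n)" for n
    by (rule DERIV_nonneg_imp_nondecreasing) (use dR R10 in auto)
  have Y0: "Y \<ge> 0" by (rule LIMSEQ_le_const[OF lim]) (use mono in auto)
  \<comment> \<open>The lower bound for \<open>R1\<close> is kept as an \<open>ennreal\<close>
    function, so that it can be integrated over the intervals from \<open>- n\<close> to
    \<open>n\<close> and passed to the whole line by Fatou's lemma.\<close>
  define F where "F = (\<lambda>t. ennreal ((b - a) * (4 * pi)) * (ennreal (exp (2 * t)) * emeasure lborel {z. z \<notin> Z \<and> t + 3 * h \<le> U z}))"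
  have FA: "F t = ennreal ((b - a) * (4 * pi) * (exp (2 * t) * A t))" for t
    unfolding F_def A_def level_isoperimetric(3)[OF h] using ab by (simp add: ennreal_mult)
  have [measurable]: "F \<in> borel_measurable borel"
  proof -
    have "(\<lambda>t. emeasure lborel (Pair t -` {x. snd x \<notin> Z \<and> fst x + 3 * h \<le> U (snd x)})) \<in> borel_measurable lborel"
      by (rule lborel.measurable_emeasure_Pair) measurable
    then have [measurable]: "(\<lambda>t. emeasure lborel {z. z \<notin> Z \<and> t + 3 * h \<le> U z}) \<in> borel_measurable borel" by simp
    show ?thesis unfolding F_def by measurable
  qed
  have Fn: "(\<integral>\<^sup>+t. F t * indicator {- real n..real n} t \<partial>lborel) \<le> ennreal (R (real n) - R (- real n))" for n
  proof -
    have "(\<integral>\<^sup>+t. F t * indicator {- real n..real n} t \<partial>lborel) \<le> (\<integral>\<^sup>+t. ennreal (R1 t) * indicator {- real n..real n} t \<partial>lborel)"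
      unfolding FA by (intro nn_integral_mono mult_right_mono ennreal_leI RA) auto
    also have "\<dots> = ennreal (R (real n) - R (- real n))"
      by (rule nn_integral_FTC_Icc) (use dR R10 in \<open>auto intro: has_field_derivative_at_within\<close>)
    finally show ?thesis .
  qed
  have "(\<integral>\<^sup>+t. F t \<partial>lborel) = (\<integral>\<^sup>+t. liminf (\<lambda>n. F t * indicator {- real n..real n} t) \<partial>lborel)"
  proof (rule nn_integral_cong)
    fix t
    have "eventually (\<lambda>n. real n \<ge> \<bar>t\<bar>) sequentially"
      using filterlim_real_sequentially by (simp add: filterlim_at_top)
    then have "eventually (\<lambda>n. F t * indicator {- real n..real n} t = F t) sequentially"
      by eventually_elim (auto simp: indicator_def abs_le_iff)
    then have "(\<lambda>n. F t * indicator {- real n..real n} t) \<longlonglongrightarrow> F t" by (rule tendsto_eventually)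
    then show "F t = liminf (\<lambda>n. F t * indicator {- real n..real n} t)"
      using lim_imp_Liminf[OF sequentially_bot] by fastforce
  qed
  also have "\<dots> \<le> liminf (\<lambda>n. \<integral>\<^sup>+t. F t * indicator {- real n..real n} t \<partial>lborel)"
    by (rule nn_integral_liminf) measurable
  also have "\<dots> \<le> liminf (\<lambda>n. ennreal (R (real n) - R (- real n)))"
    by (rule Liminf_mono) (use Fn in auto)
  also have "\<dots> = ennreal Y"
    by (rule lim_imp_Liminf[OF sequentially_bot tendsto_ennrealI[OF lim]])
  finally have "(\<integral>\<^sup>+t. F t \<partial>lborel) \<le> ennreal Y" .
  moreover have "(\<integral>\<^sup>+t. F t \<partial>lborel) = ennreal ((b - a) * (4 * pi) * (exp (- 6 * h) / 2 * V))"
  proof -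
    have [measurable]: "(\<lambda>t. emeasure lborel {z. z \<notin> Z \<and> t + 3 * h \<le> U z}) \<in> borel_measurable borel"
      using lborel.measurable_emeasure_Pair[of "{x. snd x \<notin> Z \<and> fst x + 3 * h \<le> U (snd x)}" lborel] by simp
    have "(\<integral>\<^sup>+t. F t \<partial>lborel) = ennreal ((b - a) * (4 * pi)) * ennreal (exp (- 6 * h) / 2 * V)"
      unfolding F_def nn_integral_levels[OF h, symmetric] by (rule nn_integral_cmult) measurable
    also have "\<dots> = ennreal ((b - a) * (4 * pi) * (exp (- 6 * h) / 2 * V))"
      by (rule ennreal_mult'[symmetric]) (use ab in simp)
    finally show ?thesis .
  qed
  ultimately have "(b - a) * (4 * pi) * (exp (- 6 * h) / 2 * V) \<le> Y" using Y0 by simp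
  moreover have "(b - a) * (2 * pi) * (exp (- 6 * h) * V) = (b - a) * (4 * pi) * (exp (- 6 * h) / 2 * V)" by simp
  ultimately show ?thesis unfolding Y_def by (simp only:)
qed

text \<open>The factor \<open>exp (- 6 * h)\<close> disappears in the limit. Inserting
  \<open>X\<close>, which is affine in \<open>V\<close>, turns the estimate into a quadratic
  inequality for \<open>V\<close>.\<close>

theorem area_inequality:
  "a * b * V\<^sup>2 - 4 * pi * (b * (\<gamma> - 1) + a * (1 + \<alpha>)) * V + 4 * pi\<^sup>2 * (\<gamma> + \<alpha>)\<^sup>2 \<le> 0"
proof -
  define X where "X = 2 * pi * (\<gamma> + \<alpha>) - a * V"
  define Y where "Y = (b - a) * (a * V\<^sup>2 / 2 + V * X - 2 * pi * \<alpha> * V) - X\<^sup>2 / 2"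
  have "((\<lambda>h. (b - a) * (2 * pi) * (exp (- 6 * h) * V)) \<longlongrightarrow> (b - a) * (2 * pi) * (exp (- 6 * 0) * V)) (at_right 0)"
    by (intro tendsto_intros)
  then have "(b - a) * (2 * pi) * (exp (- 6 * 0) * V) \<le> Y"
    by (rule tendsto_upperbound) (use main_inequality_h in \<open>auto simp: eventually_at_filter Y_def X_def\<close>)
  moreover have "a * b * V\<^sup>2 - 4 * pi * (b * (\<gamma> - 1) + a * (1 + \<alpha>)) * V + 4 * pi\<^sup>2 * (\<gamma> + \<alpha>)\<^sup>2
      = 2 * ((b - a) * (2 * pi) * (exp (- 6 * 0) * V) - Y)"
    by (simp add: Y_def X_def power2_eq_square field_simps)
  moreover have "2 * (x - y) \<le> 0" if "x \<le> y" for x y :: real using that by simp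
  ultimately show ?thesis by (simp only:)
qed

text \<open>When the total curvature is positive, the second bound yields \<open>b > 0\<close> and
  \<open>V > 0\<close>, which fixes the signs in the divisions that extract the area bounds.\<close>

theorem total_curvature_bounds: "a * V \<le> 2 * pi * (\<gamma> + \<alpha>)" "2 * pi * (\<gamma> + \<alpha>) \<le> b * V"
proof -
  have "(\<integral>z. a * \<rho> z \<partial>lborel) \<le> (\<integral>z. k z \<partial>lborel)" "(\<integral>z. k z \<partial>lborel) \<le> (\<integral>z. b * \<rho> z \<partial>lborel)"
    by (intro integral_mono integrable_mult_right integrable_\<rho> integrable_k k_bounds)+
  then show "a * V \<le> 2 * pi * (\<gamma> + \<alpha>)" "2 * pi * (\<gamma> + \<alpha>) \<le> b * V"
    unfolding gauss_bonnet by (simp_all add: V_def)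
qed

end

section \<open>Inversion\<close>

lemma distr_vec2_complex: "distr lborel borel (\<lambda>x::real^2. Complex (x $ 1) (x $ 2)) = (lborel :: complex measure)"
proof (rule lborel_eqI[symmetric])
  have [measurable]: "(\<lambda>x::real^2. Complex (x $ 1) (x $ 2)) \<in> borel \<rightarrow>\<^sub>M borel"
    by (intro borel_measurable_continuous_onI) (auto simp: Complex_eq intro!: continuous_intros)
  fix l u :: complex assume le: "\<And>b. b \<in> Basis \<Longrightarrow> l \<bullet> b \<le> u \<bullet> b"
  have le': "Re l \<le> Re u" "Im l \<le> Im u" using le[of 1] le[of \<i>] by (auto simp: Basis_complex_def)
  have eq: "(\<lambda>x::real^2. Complex (x $ 1) (x $ 2)) -` box l u = box (vector [Re l, Im l]) (vector [Re u, Im u])"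
    by (auto simp: box_def Basis_complex_def Basis_vec_def inner_axis UNIV_2)
  have B: "(Basis :: (real^2) set) = {axis 1 1, axis 2 1}" by (auto simp: Basis_vec_def UNIV_2)
  have ne: "axis 1 1 \<noteq> (axis 2 1 :: real^2)" by (simp add: axis_eq_axis)
  have "emeasure (distr lborel borel (\<lambda>x::real^2. Complex (x $ 1) (x $ 2))) (box l u)
     = emeasure lborel (box (vector [Re l, Im l] :: real^2) (vector [Re u, Im u]))"
    by (subst emeasure_distr) (auto simp: eq)
  also have "\<dots> = (\<Prod>b\<in>Basis. (u - l) \<bullet> b)"
    using le' ne by (subst emeasure_lborel_box) (auto simp: Basis_complex_def B inner_axis)
  finally show "emeasure (distr lborel borel (\<lambda>x::real^2. Complex (x $ 1) (x $ 2))) (box l u) = (\<Prod>b\<in>Basis. (u - l) \<bullet> b)" .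
qed simp

text \<open>The library's change of variables is for \<open>real^'n\<close>, hence the detour through \<open>real^2\<close>.\<close>

lemma integral_inversion:
  fixes f :: "complex \<Rightarrow> real"
  assumes f: "integrable lborel f"
  shows "(\<integral>w. f (c + 1 / w) / norm w ^ 4 \<partial>lborel) = (\<integral>z. f z \<partial>lborel)"
proof -
  have [measurable]: "f \<in> borel_measurable borel" using f by auto
  define T where "T = (\<lambda>x::real^2. Complex (x $ 1) (x $ 2))"
  define J where "J = (\<lambda>z. vector [Re z, Im z] :: real^2)"
  have TJ [simp]: "T (J z) = z" for z by (simp add: T_def J_def)
  have JT [simp]: "J (T x) = x" for x by (simp add: T_def J_def vec_eq_iff forall_2)
  have Tm[measurable]: "T \<in> borel \<rightarrow>\<^sub>M borel" unfolding T_def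
    by (intro borel_measurable_continuous_onI) (auto simp: Complex_eq intro!: continuous_intros)
  have blJ: "bounded_linear J" unfolding J_def
    by (rule linear_conv_bounded_linear[THEN iffD1]) (auto intro!: linearI simp: vec_eq_iff forall_2)
  have blT: "bounded_linear T" unfolding T_def
    by (rule linear_conv_bounded_linear[THEN iffD1]) (auto intro!: linearI simp: complex_eq_iff)
  have dT: "distr lborel borel T = lborel" unfolding T_def by (rule distr_vec2_complex)
  \<comment> \<open>A dictionary between Lebesgue integrals over \<open>complex\<close> and the
    integrals over \<open>real^2\<close> in which the substitution theorem is phrased.\<close>
  have HK: "(\<lambda>x. h (T x)) absolutely_integrable_on UNIV \<longleftrightarrow> integrable lborel h" 
     "integrable lborel h \<Longrightarrow> integral UNIV (\<lambda>x. h (T x)) = (\<integral>z. h z \<partial>lborel)"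
    if [measurable]: "h \<in> borel_measurable borel" for h :: "complex \<Rightarrow> real"
  proof -
    have 1: "integrable lborel h \<longleftrightarrow> integrable lborel (\<lambda>x. h (T x))"
      by (subst dT[symmetric]) (simp add: integrable_distr_eq)
    have 2: "(\<integral>z. h z \<partial>lborel) = (\<integral>x. h (T x) \<partial>lborel)"
      by (subst dT[symmetric]) (simp add: integral_distr)
    show 3: "(\<lambda>x. h (T x)) absolutely_integrable_on UNIV \<longleftrightarrow> integrable lborel h"
      unfolding 1 by (simp add: set_integrable_def integrable_completion)
    assume "integrable lborel h"
    then have "(\<lambda>x. h (T x)) absolutely_integrable_on UNIV" using 3 by simp
    then have "integral UNIV (\<lambda>x. h (T x)) = (\<integral>x. h (T x) \<partial>lebesgue)"
      by (subst set_lebesgue_integral_eq_integral(2)[symmetric]) (auto simp: set_lebesgue_integral_def)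
    then show "integral UNIV (\<lambda>x. h (T x)) = (\<integral>z. h z \<partial>lborel)"
      unfolding 2 by (simp add: integral_completion)
  qed
  define S where "S = - {0 :: real^2}"
  define g where "g = (\<lambda>x. J (c + 1 / T x))"
  define g' where "g' = (\<lambda>x v. J (- (1 / (T x)\<^sup>2) * T v))"
  have T0: "T x = 0 \<longleftrightarrow> x = 0" for x by (metis JT TJ bounded_linear.axioms(1) blT linear_simps(3))
  have J0: "J 0 = 0" using T0 TJ by metis
  have der: "(g has_derivative g' x) (at x within S)" if "x \<in> S" for x
  proof -
    have "T x \<noteq> 0" using that T0 by (auto simp: S_def)
    then have "((\<lambda>z. c + 1 / z) has_field_derivative - (1 / (T x)\<^sup>2)) (at (T x))"
      by (auto intro!: derivative_eq_intros simp: power2_eq_square)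
    then have "((\<lambda>z. c + 1 / z) has_derivative (\<lambda>v. - (1 / (T x)\<^sup>2) * v)) (at (T x))"
      unfolding has_field_derivative_def .
    from has_derivative_compose[OF bounded_linear_imp_has_derivative[OF blT] this]
    have "((\<lambda>x. c + 1 / T x) has_derivative (\<lambda>v. - (1 / (T x)\<^sup>2) * T v)) (at x within S)" by blast
    from bounded_linear.has_derivative[OF blJ this] show ?thesis by (simp add: g_def g'_def)
  qed
  have inj: "inj_on g S"
  proof (rule inj_onI)
    fix x y assume "x \<in> S" "y \<in> S" "g x = g y"
    then have "T (g x) = T (g y)" "T x \<noteq> 0" "T y \<noteq> 0" using T0 by (auto simp: S_def)
    then have "T x = T y" by (simp add: g_def field_simps)
    then show "x = y" by (metis JT)
  qed
  have img: "g ` S = - {J c}"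
  proof (intro equalityI subsetI)
    fix y assume "y \<in> g ` S"
    then obtain x where x: "x \<in> S" "y = g x" by blast
    have "T x \<noteq> 0" using x T0 by (auto simp: S_def)
    then have "T y \<noteq> c" using x by (simp add: g_def)
    then show "y \<in> - {J c}" by auto
  next
    fix y assume "y \<in> - {J c}"
    then have ne: "T y - c \<noteq> 0" by auto
    define x where "x = J (1 / (T y - c))"
    have "T x \<noteq> 0" using ne by (simp add: x_def)
    then have "x \<in> S" using T0 by (auto simp: S_def)
    moreover have "y = g x" using ne by (simp add: g_def x_def)
    ultimately show "y \<in> g ` S" by blast
  qed
  have detg: "\<bar>det (matrix (g' x))\<bar> = 1 / norm (T x) ^ 4" for x
  proof -
    define m where "m = - (1 / (T x)\<^sup>2)"
    have g'm: "g' x = (\<lambda>v. J (m * T v))" by (simp add: g'_def m_def)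
    have Ta: "T (axis 1 1) = 1" "T (axis 2 1) = \<i>" by (simp_all add: T_def axis_def complex_eq_iff)
    have "det (matrix (g' x)) = (Re m)\<^sup>2 + (Im m)\<^sup>2"
      by (simp add: det_2 matrix_def g'm Ta J_def power2_eq_square)
    also have "\<dots> = (norm m)\<^sup>2" by (simp add: cmod_power2)
    also have "\<dots> = 1 / norm (T x) ^ 4" by (simp add: m_def norm_divide norm_power power_divide flip: power_mult)
    finally show ?thesis by simp
  qed
  define F where "F = (\<lambda>x. vec (f (T x)) :: real^1)"
  have neg: "negligible {x}" for x :: "real^2" by simp
  have fU: "(\<lambda>x. f (T x)) absolutely_integrable_on UNIV" using HK(1)[of f] f by simp
  \<comment> \<open>A single point is negligible, so the punctured planes produced by the
    substitution may be replaced by the whole plane.\<close>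
  have sp: "h absolutely_integrable_on (- {x}) \<longleftrightarrow> h absolutely_integrable_on UNIV" "integral (- {x}) h = integral UNIV h"
    for h :: "real^2 \<Rightarrow> real" and x
  proof -
    have "negligible {y \<in> - {x} - UNIV. h y \<noteq> 0}" by simp
    moreover have "negligible {y \<in> UNIV - - {x}. h y \<noteq> 0}" by (rule negligible_subset[OF neg[of x]]) auto
    ultimately show "h absolutely_integrable_on (- {x}) \<longleftrightarrow> h absolutely_integrable_on UNIV" "integral (- {x}) h = integral UNIV h"
      by (auto intro!: absolutely_integrable_spike_set_eq integral_spike_set)
  qed
  have "F absolutely_integrable_on (g ` S)" "integral (g ` S) F = vec (\<integral>z. f z \<partial>lborel)"
    unfolding img F_def using fU HK(2)[of f] f
    by (simp_all add: absolutely_integrable_on_1_iff integral_on_1_eq sp)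
  moreover have "S \<in> sets lebesgue" by (auto simp: S_def)
  ultimately have R: "(\<lambda>x. \<bar>det (matrix (g' x))\<bar> *\<^sub>R F (g x)) absolutely_integrable_on S"
     "integral S (\<lambda>x. \<bar>det (matrix (g' x))\<bar> *\<^sub>R F (g x)) = vec (\<integral>z. f z \<partial>lborel)"
    using has_absolute_integral_change_of_variables[OF _ der inj, of F "vec (\<integral>z. f z \<partial>lborel)"] by auto
  define h where "h = (\<lambda>w. f (c + 1 / w) / norm w ^ 4)"
  have [measurable]: "h \<in> borel_measurable borel" unfolding h_def by measurable
  have hF: "\<bar>det (matrix (g' x))\<bar> *\<^sub>R F (g x) = vec (h (T x))" for x
    by (simp add: detg F_def g_def h_def vec_eq_iff)
  have "(\<lambda>x. h (T x)) absolutely_integrable_on UNIV" "integral UNIV (\<lambda>x. h (T x)) = (\<integral>z. f z \<partial>lborel)"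
    using R unfolding hF S_def by (simp_all add: absolutely_integrable_on_1_iff integral_on_1_eq sp vec_eq_iff)
  then show ?thesis using HK[of h] by (simp add: h_def)
qed

context planar_conic
begin

text \<open>The map \<open>h w = c + 1 / w\<close> sends infinity to \<open>c\<close> and 0 to
  infinity. As \<open>|deriv h w| = |w|^(-2)\<close>, the pulled back metric has potential
  \<open>U (h w) - 2 ln |w|\<close>. The old order \<open>\<gamma> - 2\<close> at infinity becomes
  the order at 0, which must again be nonpositive; this is the condition
  \<open>\<gamma> \<le> 2\<close>.\<close>

lemma inversion:
  assumes c: "c \<in> Z" and \<gamma>2: "\<gamma> \<le> 2"
  obtains Z' e' U' q q' where "planar_conic Z' e' (2 + e c) U' q q' a b"
    "(\<Sum>z\<in>Z'. e' z) = (\<Sum>z\<in>Z. e z) - e c + (\<gamma> - 2)"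
    "(\<integral>z. exp (2 * U' z) \<partial>lborel) = (\<integral>z. exp (2 * U z) \<partial>lborel)"
proof -
  define h where "h = (\<lambda>w::complex. c + 1 / w)"
  define Z1 where "Z1 = (\<lambda>\<zeta>. 1 / (\<zeta> - c)) ` (Z - {c})"
  define Z' where "Z' = insert 0 Z1"
  define e' where "e' = (\<lambda>w. if w = 0 then \<gamma> - 2 else e (h w))"
  define U' where "U' = (\<lambda>w. U (h w) + (- 2) * ln (norm w))"
  have hZ: "h w \<notin> Z" if "w \<notin> Z'" for w
  proof
    assume "h w \<in> Z"
    moreover have "w \<noteq> 0" using that by (auto simp: Z'_def)
    then have "h w \<noteq> c" "w = 1 / (h w - c)" by (auto simp: h_def)
    ultimately have "w \<in> Z1" unfolding Z1_def by blast
    then show False using that by (simp add: Z'_def)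
  qed
  have Z1: "w \<noteq> 0" "h w \<in> Z" "h w \<noteq> c" if "w \<in> Z1" for w
    using that by (auto simp: Z1_def h_def)
  have fin: "finite Z'" using Z by (simp add: Z'_def Z1_def)
  have op: "open (- Z')" using fin by (simp add: finite_imp_closed open_Compl)
  have d1: "(h has_field_derivative - (1 / w\<^sup>2)) (at w)" if "w \<noteq> 0" for w
    unfolding h_def using that by (auto intro!: derivative_eq_intros simp: power2_eq_square)
  have hol: "h holomorphic_on (- Z')"
    unfolding h_def by (intro holomorphic_intros) (auto simp: Z'_def)
  have dh: "deriv h w = - (1 / w\<^sup>2)" if "w \<noteq> 0" for w using DERIV_imp_deriv[OF d1[OF that]] .
  note C1 = C2_grad_compose_holo[OF C hol op]
  have "h ` (- Z') \<subseteq> - Z" using hZ by auto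
  note C1 = C1[OF this]
  have C2: "C2_grad (- Z') (\<lambda>w. (- 2) * ln (norm w)) (\<lambda>w. (- 2) *\<^sub>R inverse (cnj w)) (\<lambda>w v. (- 2) *\<^sub>R (- (inverse (cnj w) * cnj v * inverse (cnj w))))"
    by (rule C2_grad_subset[OF C2_grad_cmult[OF C2_grad_ln_norm]]) (auto simp: Z'_def)
  note C' = C2_grad_add[OF C1 C2, folded U'_def]
  define q' where "q' = (\<lambda>z v. cnj (deriv (deriv h) z * v) * p (h z) + cnj (deriv h z) * p' (h z) (deriv h z * v) +
      (- 2) *\<^sub>R (- (inverse (cnj z) * cnj v * inverse (cnj z))))"
  have trq: "tr (q' w) = tr (p' (h w)) / norm w ^ 4" "exp (2 * U' w) = exp (2 * U (h w)) / norm w ^ 4" if "w \<notin> Z'" for w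
  proof -
    have w0: "w \<noteq> 0" using that by (auto simp: Z'_def)
    have "linear (p' (h w))" using C2_gradD(7)[OF C] hZ[OF that] by simp
    then have "tr (\<lambda>v. cnj (deriv (deriv h) w * v) * p (h w) + cnj (deriv h w) * p' (h w) (deriv h w * v))
       = (norm (deriv h w))\<^sup>2 * tr (p' (h w))" by (rule tr_compose_holo)
    moreover have "tr (q' w) = tr (\<lambda>v. cnj (deriv (deriv h) w * v) * p (h w) + cnj (deriv h w) * p' (h w) (deriv h w * v))
       + tr (\<lambda>v. (- 2) *\<^sub>R (- (inverse (cnj w) * cnj v * inverse (cnj w))))"
      unfolding q'_def by (rule tr_add)
    ultimately have "tr (q' w) = (norm (deriv h w))\<^sup>2 * tr (p' (h w))"
      by (simp only: tr_scale tr_ln_norm mult_zero_right add_0_right)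
    also have "(norm (deriv h w))\<^sup>2 = 1 / norm w ^ 4"
      using w0 by (simp add: dh norm_divide norm_power power_divide flip: power_mult)
    finally show "tr (q' w) = tr (p' (h w)) / norm w ^ 4" by simp
    have "exp (2 * U' w) = exp (2 * U (h w)) / exp (ln (norm w ^ 4))"
      using w0 by (simp add: U'_def ln_realpow exp_diff[symmetric])
    then show "exp (2 * U' w) = exp (2 * U (h w)) / norm w ^ 4" using w0 by simp
  qed
  have eh: "e' w = e (h w)" if "w \<in> Z1" for w using Z1[OF that] by (simp add: e'_def)
  have PC: "planar_conic Z' e' (2 + e c) U' (\<lambda>z. cnj (deriv h z) * p (h z) + (- 2) *\<^sub>R inverse (cnj z)) q' a b"
  proof
    show "finite Z'" by fact
    show "C2_grad (- Z') U' (\<lambda>z. cnj (deriv h z) * p (h z) + (- 2) *\<^sub>R inverse (cnj z)) q'"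
      unfolding q'_def by (rule C')
    show "-1 < e' z" "e' z \<le> 0" if "z \<in> Z'" for z
      using that e Z1(2) \<gamma> \<gamma>2 by (auto simp: e'_def Z'_def)
    show "2 + e c > 1" using e(1)[OF c] by simp
    show "a * exp (2 * U' z) \<le> - tr (q' z)" "- tr (q' z) \<le> b * exp (2 * U' z)" if "z \<notin> Z'" for z
    proof -
      have n: "0 \<le> norm z ^ 4" by simp
      show "a * exp (2 * U' z) \<le> - tr (q' z)"
        unfolding trq[OF that] using divide_right_mono[OF curv(1)[OF hZ[OF that]] n] by simp
      show "- tr (q' z) \<le> b * exp (2 * U' z)"
        unfolding trq[OF that] using divide_right_mono[OF curv(2)[OF hZ[OF that]] n] by simp
    qed
    show "\<exists>L. ((\<lambda>w. U' w + (2 + e c) * ln (norm w)) \<longlongrightarrow> L) at_infinity"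
    proof -
      obtain L where L: "((\<lambda>w. U w - e c * ln (norm (w - c))) \<longlongrightarrow> L) (at c)" using sing[OF c] by blast
      have "((\<lambda>w. 1 / w) \<longlongrightarrow> 0) (at_infinity :: complex filter)" by (rule tendsto_divide_0[OF tendsto_const filterlim_ident])
      then have "(h \<longlongrightarrow> c + 0) at_infinity" unfolding h_def by (intro tendsto_intros)
      moreover have "eventually (\<lambda>w::complex. w \<noteq> 0) at_infinity" by (rule eventually_not_equal_at_infinity)
      ultimately have "filterlim h (at c) at_infinity"
        unfolding filterlim_at by (auto simp: h_def elim: eventually_mono)
      from filterlim_compose[OF L this] have l: "((\<lambda>w. U (h w) - e c * ln (norm (h w - c))) \<longlongrightarrow> L) at_infinity" .
      have "eventually (\<lambda>w. U (h w) - e c * ln (norm (h w - c)) = U' w + (2 + e c) * ln (norm w)) at_infinity"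
        using \<open>eventually (\<lambda>w::complex. w \<noteq> 0) at_infinity\<close>
        by eventually_elim (simp add: h_def U'_def norm_divide ln_div algebra_simps)
      from Lim_transform_eventually[OF l this] show ?thesis by (rule exI)
    qed
    show "\<exists>L. ((\<lambda>w. U' w - e' z * ln (norm (w - z))) \<longlongrightarrow> L) (at z)" if z: "z \<in> Z'" for z
    proof (cases "z = 0")
      case True
      obtain L where L: "((\<lambda>w. U w + \<gamma> * ln (norm w)) \<longlongrightarrow> L) at_infinity" using inf by blast
      have "h = (\<lambda>w. c + inverse w)" by (simp add: h_def inverse_eq_divide)
      then have hi: "filterlim h at_infinity (at 0)"
        by (simp only:) (rule tendsto_add_filterlim_at_infinity[OF tendsto_const filterlim_inverse_at_infinity])
      from filterlim_compose[OF L this] have l: "((\<lambda>w. U (h w) + \<gamma> * ln (norm (h w))) \<longlongrightarrow> L) (at 0)" .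
      \<comment> \<open>As \<open>w * h w = c * w + 1\<close> tends to 1,
        \<open>ln (norm (h w))\<close> may be replaced by \<open>- ln (norm w)\<close> up to a
        vanishing error.\<close>
      have "((\<lambda>w. ln (norm (c * w + 1))) \<longlongrightarrow> ln (norm (c * 0 + 1))) (at 0)" by (intro tendsto_intros) simp
      from tendsto_diff[OF l tendsto_mult_left[OF this, of \<gamma>]]
      have l2: "((\<lambda>w. U (h w) + \<gamma> * ln (norm (h w)) - \<gamma> * ln (norm (c * w + 1))) \<longlongrightarrow> L) (at 0)" by simp
      have "eventually (\<lambda>w. h w \<noteq> 0) (at 0)"
        using filterlim_compose[OF _ hi] hi eventually_not_equal_at_infinity[of "0::complex"] by (auto simp: filterlim_iff)
      moreover have "eventually (\<lambda>w::complex. w \<noteq> 0) (at 0)" by (simp add: eventually_at_filter)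
      ultimately have "eventually (\<lambda>w. U (h w) + \<gamma> * ln (norm (h w)) - \<gamma> * ln (norm (c * w + 1)) = U' w - e' 0 * ln (norm (w - 0))) (at 0)"
      proof eventually_elim
        case (elim w)
        have "c * w + 1 = w * h w" using elim by (simp add: h_def field_simps)
        then have "ln (norm (c * w + 1)) = ln (norm w) + ln (norm (h w))" using elim by (simp add: norm_mult ln_mult)
        then show ?case by (simp add: U'_def e'_def algebra_simps)
      qed
      from Lim_transform_eventually[OF l2 this] show ?thesis unfolding True by (rule exI)
    next
      case False
      then have z1: "z \<in> Z1" using z by (simp add: Z'_def)
      obtain L where L: "((\<lambda>w. U w - e (h z) * ln (norm (w - h z))) \<longlongrightarrow> L) (at (h z))" using sing[OF Z1(2)[OF z1]] by blast
      have hw: "h w - h z = (z - w) / (w * z)" if "w \<noteq> 0" for w using that False by (simp add: h_def field_simps)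
      have "(h \<longlongrightarrow> h z) (at z)" using DERIV_isCont[OF d1[OF False]] by (simp add: isCont_def)
      moreover have ev0: "eventually (\<lambda>w::complex. w \<noteq> 0 \<and> w \<noteq> z) (at z)"
        by (intro eventually_conj tendsto_imp_eventually_ne[OF tendsto_ident_at False] eventually_neq_at_within)
      moreover have "eventually (\<lambda>w. h w \<noteq> h z) (at z)" using ev0
        by eventually_elim (use hw False in \<open>metis divide_eq_0_iff eq_iff_diff_eq_0 mult_eq_0_iff\<close>)
      ultimately have "filterlim h (at (h z)) (at z)" unfolding filterlim_at by auto
      from filterlim_compose[OF L this] have l: "((\<lambda>w. U (h w) - e (h z) * ln (norm (h w - h z))) \<longlongrightarrow> L) (at z)" .
      have l0: "((\<lambda>w. ln (norm w)) \<longlongrightarrow> ln (norm z)) (at z)" using False by (intro tendsto_intros) simp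
      define K where "K = (\<lambda>w. U (h w) - e (h z) * ln (norm (h w - h z)) - e (h z) * (ln (norm w) + ln (norm z)) - 2 * ln (norm w))"
      have l2: "(K \<longlongrightarrow> L - e (h z) * (ln (norm z) + ln (norm z)) - 2 * ln (norm z)) (at z)"
        unfolding K_def by (intro tendsto_intros l l0)
      have "eventually (\<lambda>w. K w = U' w - e' z * ln (norm (w - z))) (at z)" using ev0
      proof eventually_elim
        case (elim w)
        then have "ln (norm (h w - h z)) = ln (norm (w - z)) - (ln (norm w) + ln (norm z))"
          using False by (simp add: hw norm_divide norm_mult ln_div ln_mult norm_minus_commute)
        then have lw: "ln (norm (w - z)) = ln (norm (h w - h z)) + (ln (norm w) + ln (norm z))" by simp
        show ?case unfolding K_def U'_def eh[OF z1] lw by (simp add: algebra_simps)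
      qed
      from Lim_transform_eventually[OF l2 this] show ?thesis by (rule exI)
    qed
  qed
  have S: "(\<Sum>z\<in>Z'. e' z) = (\<Sum>z\<in>Z. e z) - e c + (\<gamma> - 2)"
  proof -
    have "(\<Sum>z\<in>Z'. e' z) = (\<gamma> - 2) + (\<Sum>z\<in>Z1. e' z)"
      using fin Z1(1) unfolding Z'_def by (subst sum.insert) (auto simp: e'_def)
    also have "(\<Sum>z\<in>Z1. e' z) = (\<Sum>z\<in>Z1. e (h z))" by (intro sum.cong eh) auto
    also have "\<dots> = (\<Sum>\<zeta>\<in>Z - {c}. e (h (1 / (\<zeta> - c))))"
      unfolding Z1_def by (subst sum.reindex) (auto intro!: inj_onI)
    also have "\<dots> = (\<Sum>\<zeta>\<in>Z - {c}. e \<zeta>)" by (intro sum.cong) (auto simp: h_def)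
    also have "\<dots> = (\<Sum>z\<in>Z. e z) - e c" using Z c by (subst sum_diff1) auto
    finally show ?thesis by simp
  qed
  have I: "(\<integral>z. exp (2 * U' z) \<partial>lborel) = (\<integral>z. exp (2 * U z) \<partial>lborel)"
  proof -
    have i: "integrable lborel (\<lambda>z. exp (2 * U z))" using integrable_\<rho> by (simp add: \<rho>_def[abs_def])
    interpret pc: planar_conic Z' e' "2 + e c" U' "\<lambda>z. cnj (deriv h z) * p (h z) + (- 2) *\<^sub>R inverse (cnj z)" q' a b by (rule PC)
    have "(\<integral>z. exp (2 * U' z) \<partial>lborel) = (\<integral>w. exp (2 * U (c + 1 / w)) / norm w ^ 4 \<partial>lborel)"
    proof (rule integral_cong_AE)
      show "(\<lambda>w. exp (2 * U (c + 1 / w)) / norm w ^ 4) \<in> borel_measurable lborel" by measurable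
      show "(\<lambda>z. exp (2 * U' z)) \<in> borel_measurable lborel" by measurable
      show "AE w in lborel. exp (2 * U' w) = exp (2 * U (c + 1 / w)) / norm w ^ 4"
        using pc.AE_Z by eventually_elim (simp add: trq h_def)
    qed
    also have "\<dots> = (\<integral>z. exp (2 * U z) \<partial>lborel)" by (rule integral_inversion[OF i])
    finally show ?thesis .
  qed
  show thesis by (rule that[OF PC S I])
qed

end

section \<open>Holomorphic charts and stereographic coordinates\<close>

lemma C2_grad_if_Ck_on_2:
  assumes S: "open S" and C: "Ck_on 2 f S"
  shows "\<exists>p p'. C2_grad S f p p'"
proof -
  have C: "z \<in> S \<Longrightarrow> f differentiable (at z)" "z \<in> S \<Longrightarrow> (\<lambda>z. frechet_derivative f (at z) v) differentiable (at z)"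
    "continuous_on S (\<lambda>z. frechet_derivative (\<lambda>z. frechet_derivative f (at z) v) (at z) w)" for z v w
    using C by (auto simp: numeral_2_eq_2)
  define D where "D = (\<lambda>v z. frechet_derivative f (at z) v)"
  define p where "p = (\<lambda>z. complex_of_real (D 1 z) + complex_of_real (D \<i> z) * \<i>)"
  define p' where "p' = (\<lambda>z w. complex_of_real (frechet_derivative (D 1) (at z) w) + complex_of_real (frechet_derivative (D \<i>) (at z) w) * \<i>)"
  have "(f has_derivative (\<lambda>v. p z \<bullet> v)) (at z)" if "z \<in> S" for z
  proof -
    have d: "(f has_derivative frechet_derivative f (at z)) (at z)" using C(1)[OF that] frechet_derivative_works by blast
    have "frechet_derivative f (at z) = (\<lambda>v. p z \<bullet> v)"
    proof
      fix v show "frechet_derivative f (at z) v = p z \<bullet> v"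
        using linear_complex_decomp[OF has_derivative_linear[OF d], of v]
        by (simp add: p_def D_def inner_complex_def mult.commute)
    qed
    from d[unfolded this] show ?thesis .
  qed
  moreover have "(p has_derivative p' z) (at z)" if "z \<in> S" for z
  proof -
    have "(D v has_derivative frechet_derivative (D v) (at z)) (at z)" for v
      using C(2)[OF that, of v] frechet_derivative_works unfolding D_def by blast
    then show ?thesis unfolding p_def p'_def
      by (intro has_derivative_add has_derivative_mult_left has_derivative_of_real)
  qed
  moreover have "continuous_on S (\<lambda>z. p' z v)" for v
    unfolding p'_def D_def by (intro continuous_intros C(3))
  ultimately show ?thesis unfolding C2_grad_def by blast
qed

lemma laplacian_C2_grad:
  assumes C: "C2_grad S f p p'" and S: "open S" "z \<in> S"
  shows "laplacian f z = tr (p' z)"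
proof -
  have fr: "frechet_derivative f (at w) v = p w \<bullet> v" if "w \<in> S" for w v
    using frechet_derivative_at[OF C2_gradD(1)[OF C that]] by metis
  have "((\<lambda>w. frechet_derivative f (at w) v) has_derivative (\<lambda>w. p' z w \<bullet> v)) (at z)" for v
  proof -
    have "((\<lambda>w. p w \<bullet> v) has_derivative (\<lambda>w. p' z w \<bullet> v)) (at z)"
      by (rule has_derivative_inner_left[OF C2_gradD(2)[OF C S(2)]])
    then show ?thesis by (rule has_derivative_transform_within_open[OF _ S]) (simp add: fr)
  qed
  from frechet_derivative_at[OF this]
  have "frechet_derivative (\<lambda>w. frechet_derivative f (at w) v) (at z) v = p' z v \<bullet> v" for v by metis
  then show ?thesis unfolding laplacian_def by (simp add: tr_def inner_complex_def)
qed

text \<open>Gradients and their derivatives are unique on open sets, so the global choice through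
  \<open>frechet_derivative\<close> agrees with every local one.\<close>

lemma C2_grad_local:
  assumes loc: "\<And>z. z \<in> S \<Longrightarrow> \<exists>D p p'. open D \<and> z \<in> D \<and> C2_grad D f p p'"
  shows "\<exists>p p'. C2_grad S f p p'"
proof -
  define P where "P = (\<lambda>z. complex_of_real (frechet_derivative f (at z) 1) + complex_of_real (frechet_derivative f (at z) \<i>) * \<i>)"
  define P' where "P' = (\<lambda>z. frechet_derivative P (at z))"
  have key: "(\<forall>w\<in>D. P w = p w) \<and> (\<forall>w\<in>D. P' w = p' w)" if D: "open D" "C2_grad D f p p'" for D p p'
  proof -
    have 1: "P w = p w" if "w \<in> D" for w
    proof -
      have "frechet_derivative f (at w) v = p w \<bullet> v" for v
        using frechet_derivative_at[OF C2_gradD(1)[OF D(2) that]] by metis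
      then show ?thesis by (simp add: P_def complex_eq_iff inner_complex_def)
    qed
    have "P' w = p' w" if "w \<in> D" for w
    proof -
      have "(P has_derivative p' w) (at w)"
        by (rule has_derivative_transform_within_open[OF C2_gradD(2)[OF D(2) that] D(1) that]) (simp add: 1)
      then show ?thesis unfolding P'_def using frechet_derivative_at by metis
    qed
    then show ?thesis using 1 by blast
  qed
  have "C2_grad S f P P'" unfolding C2_grad_def
  proof (intro conjI ballI allI)
    fix z assume "z \<in> S"
    then obtain D p p' where D: "open D" "z \<in> D" "C2_grad D f p p'" using loc by blast
    show "(f has_derivative (\<lambda>v. P z \<bullet> v)) (at z)" using C2_gradD(1)[OF D(3,2)] key[OF D(1,3)] D(2) by simp
    have "(P has_derivative p' z) (at z)"
      by (rule has_derivative_transform_within_open[OF C2_gradD(2)[OF D(3,2)] D(1,2)]) (use key[OF D(1,3)] in simp)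
    then show "(P has_derivative P' z) (at z)" using key[OF D(1,3)] D(2) by simp
  next
    fix v
    show "continuous_on S (\<lambda>z. P' z v)"
    proof (rule continuous_at_imp_continuous_on, rule ballI)
      fix z assume "z \<in> S"
      then obtain D p p' where D: "open D" "z \<in> D" "C2_grad D f p p'" using loc by blast
      have "continuous_on D (\<lambda>z. P' z v)"
        by (rule continuous_on_eq[OF C2_gradD(3)[OF D(3)]]) (use key[OF D(1,3)] in simp)
      then show "isCont (\<lambda>z. P' z v) z" using D continuous_on_eq_continuous_at by blast
    qed
  qed
  then show ?thesis by blast
qed

section \<open>The stereographic parametrisations\<close>

lemma one_plus_norm_square_ne: "1 + (norm (z::complex))\<^sup>2 \<noteq> 0" "(norm z)\<^sup>2 + 1 \<noteq> 0"
  using zero_le_power2[of "norm z"] by linarith+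

lemma differentiable_norm_square: "(\<lambda>z::complex. (norm z)\<^sup>2) differentiable (at z)"
  using C2_gradD(1)[OF C2_grad_norm_square, of z UNIV] by (auto intro: differentiableI)

lemma differentiable_cnj: "cnj differentiable (at z)"
  using bounded_linear_imp_has_derivative[OF bounded_linear_cnj] by (rule differentiableI)

lemma differentiable_stereo_inv: "stereoN_inv differentiable (at z)" "stereoS_inv differentiable (at z)"
  unfolding stereoN_inv_def[abs_def] stereoS_inv_def[abs_def]
  by (intro differentiable_Pair differentiable_scaleR differentiable_divide differentiable_add differentiable_diff
      differentiable_const differentiable_ident differentiable_norm_square differentiable_cnj one_plus_norm_square_ne)+

lemma S2_iff: "q \<in> S2 \<longleftrightarrow> (norm (fst q))\<^sup>2 + (snd q)\<^sup>2 = 1"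
  by (auto simp: S2_def norm_prod_def)

lemma stereoN_stereoN_inv [simp]: "stereoN (stereoN_inv z) = z"
proof -
  have e: "1 - ((norm z)\<^sup>2 - 1) / ((norm z)\<^sup>2 + 1) = 2 / (1 + (norm z)\<^sup>2)"
    using one_plus_norm_square_ne[of z] by (simp add: field_simps)
  have ne: "2 / (1 + (norm z)\<^sup>2) \<noteq> 0" using one_plus_norm_square_ne[of z] by simp
  show ?thesis by (simp only: stereoN_def stereoN_inv_def fst_conv snd_conv e scaleR_scaleR left_inverse[OF ne] scaleR_one)
qed

lemma stereoS_stereoS_inv [simp]: "stereoS (stereoS_inv z) = z"
proof -
  have e: "1 + (1 - (norm z)\<^sup>2) / ((norm z)\<^sup>2 + 1) = 2 / (1 + (norm z)\<^sup>2)"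
    using one_plus_norm_square_ne[of z] by (simp add: field_simps)
  have ne: "2 / (1 + (norm z)\<^sup>2) \<noteq> 0" using one_plus_norm_square_ne[of z] by simp
  show ?thesis by (simp only: stereoS_def stereoS_inv_def fst_conv snd_conv e complex_cnj_scaleR complex_cnj_cnj
      scaleR_scaleR left_inverse[OF ne] scaleR_one)
qed

lemma stereo_inv_S2: "stereoN_inv z \<in> S2" "stereoS_inv z \<in> S2"
proof -
  have *: "(2 / (1 + t) * sqrt t)\<^sup>2 + ((t - 1) / (t + 1))\<^sup>2 = 1" if "t \<ge> 0" for t :: real
  proof -
    have "(2 / (1 + t) * sqrt t)\<^sup>2 = 4 * t / (1 + t)\<^sup>2" using that by (simp add: power_mult_distrib power_divide)
    moreover have "((t - 1) / (t + 1))\<^sup>2 = (t - 1)\<^sup>2 / (1 + t)\<^sup>2" by (simp add: power_divide add.commute)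
    moreover have "4 * t + (t - 1)\<^sup>2 = (1 + t)\<^sup>2" by (simp add: power2_eq_square algebra_simps)
    ultimately show ?thesis using that by (simp add: add_divide_distrib[symmetric])
  qed
  have **: "((1 - (norm z)\<^sup>2) / ((norm z)\<^sup>2 + 1))\<^sup>2 = (((norm z)\<^sup>2 - 1) / ((norm z)\<^sup>2 + 1))\<^sup>2"
    by (simp add: power_divide power2_commute)
  have n: "norm ((2 / (1 + (norm z)\<^sup>2)) *\<^sub>R w) = 2 / (1 + (norm z)\<^sup>2) * sqrt ((norm z)\<^sup>2)" if "norm w = norm z" for w :: complex
    using that zero_le_power2[of "norm z"] by (simp add: abs_of_nonneg)
  show "stereoN_inv z \<in> S2" "stereoS_inv z \<in> S2"
    unfolding S2_iff stereoN_inv_def stereoS_inv_def fst_conv snd_conv ** using *[of "(norm z)\<^sup>2"]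
    by (simp_all only: n[of z, OF refl] n[of "cnj z", OF complex_mod_cnj] zero_le_power2 simp_thms)
qed

lemma stereoN_inv_neq: "stereoN_inv z \<noteq> north_pole" and stereoS_inv_neq: "stereoS_inv z \<noteq> south_pole"
  using one_plus_norm_square_ne[of z] by (auto simp: stereoN_inv_def stereoS_inv_def north_pole_def south_pole_def field_simps)

lemma stereoN_inv_stereoN:
  assumes "q \<in> S2" "q \<noteq> north_pole"
  shows "stereoN_inv (stereoN q) = q"
proof -
  obtain x t where q: "q = (x, t)" by (cases q)
  have e: "(norm x)\<^sup>2 = 1 - t\<^sup>2" using assms(1) by (simp add: S2_iff q)
  have t: "t \<noteq> 1" using assms(2) e by (auto simp: q north_pole_def)
  have n: "(norm (stereoN q))\<^sup>2 = (1 + t) / (1 - t)"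
  proof -
    have "(norm (stereoN q))\<^sup>2 = (norm x)\<^sup>2 / (1 - t)\<^sup>2" by (simp add: stereoN_def q power_mult_distrib divide_inverse power_inverse)
    also have "\<dots> = ((1 + t) * (1 - t)) / ((1 - t) * (1 - t))" unfolding e by (simp add: power2_eq_square algebra_simps)
    finally show ?thesis using t by simp
  qed
  have a: "2 / (1 + (1 + t) / (1 - t)) = 1 - t" "((1 + t) / (1 - t) - 1) / ((1 + t) / (1 - t) + 1) = t"
    using t by (simp_all add: field_simps)
  show ?thesis unfolding stereoN_inv_def n a using t by (simp add: stereoN_def q)
qed

lemma stereoS_inv_eq_stereoN_inv:
  assumes "z \<noteq> 0"
  shows "stereoN_inv z = stereoS_inv (1 / z)"
proof -
  have n: "norm z \<noteq> 0" using assms by simp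
  have c: "cnj (1 / z) = (1 / (norm z)\<^sup>2) *\<^sub>R z"
    using assms complex_norm_square[of z] by (simp add: scaleR_conv_of_real field_simps)
  define m where "m = (norm z)\<^sup>2"
  have m: "m > 0" "(norm (1 / z))\<^sup>2 = 1 / m" using n by (simp_all add: m_def norm_divide power_divide)
  have "1 - 1 / m = (m - 1) / m" "1 / m + 1 = (m + 1) / m" "1 + 1 / m = (1 + m) / m"
    using m(1) by (simp_all add: field_simps)
  then have "2 / (1 + 1 / m) * (1 / m) = 2 / (1 + m)" "(1 - 1 / m) / (1 / m + 1) = (m - 1) / (m + 1)"
    using m(1) by simp_all
  then show ?thesis unfolding stereoN_inv_def stereoS_inv_def c m(2) m_def[symmetric] scaleR_scaleR by simp
qed

lemma stereoS_inv_0: "stereoS_inv 0 = north_pole"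
  by (simp add: stereoS_inv_def north_pole_def)

section \<open>Conformal factors and potentials in holomorphic charts\<close>

lemma chart_domain:
  assumes "holomorphic_chart U \<phi>"
  shows "stereoN ` (U - {north_pole}) = {z. stereoN_inv z \<in> U}" "open {z. stereoN_inv z \<in> U}"
    "(\<lambda>z. \<phi> (stereoN_inv z)) holomorphic_on {z. stereoN_inv z \<in> U}"
    "stereoS ` (U - {south_pole}) = {z. stereoS_inv z \<in> U}" "open {z. stereoS_inv z \<in> U}"
    "(\<lambda>z. \<phi> (stereoS_inv z)) holomorphic_on {z. stereoS_inv z \<in> U}"
    "inj_on \<phi> U"
proof -
  have U: "openin (top_of_set S2) U" and inj: "inj_on \<phi> U" 
    and h: "(\<phi> \<circ> stereoN_inv) holomorphic_on (stereoN ` (U - {north_pole}))"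
    "(\<phi> \<circ> stereoS_inv) holomorphic_on (stereoS ` (U - {south_pole}))"
    using assms by (auto simp: holomorphic_chart_def)
  obtain T where T: "open T" "U = S2 \<inter> T" using U by (auto simp: openin_open)
  show "inj_on \<phi> U" by fact
  have c: "continuous_on UNIV stereoN_inv" "continuous_on UNIV stereoS_inv"
    by (auto intro!: continuous_at_imp_continuous_on differentiable_imp_continuous_within differentiable_stereo_inv)
  have "{z. stereoN_inv z \<in> U} = stereoN_inv -` T" "{z. stereoS_inv z \<in> U} = stereoS_inv -` T"
    using stereo_inv_S2 T by auto
  then show "open {z. stereoN_inv z \<in> U}" "open {z. stereoS_inv z \<in> U}"
    using open_vimage[OF T(1) c(1)] open_vimage[OF T(1) c(2)] by simp_all
  show N: "stereoN ` (U - {north_pole}) = {z. stereoN_inv z \<in> U}"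
  proof (intro equalityI subsetI)
    fix z assume "z \<in> stereoN ` (U - {north_pole})"
    then show "z \<in> {z. stereoN_inv z \<in> U}" using stereoN_inv_stereoN T by auto
  next
    fix z assume "z \<in> {z. stereoN_inv z \<in> U}"
    then have "stereoN_inv z \<in> U - {north_pole}" using stereoN_inv_neq by auto
    from imageI[OF this, of stereoN] show "z \<in> stereoN ` (U - {north_pole})" by simp
  qed
  \<comment> \<open>The reflection \<open>(x, t) \<mapsto> (cnj x, - t)\<close> exchanges the two
    projections, so the northern identity is reused.\<close>
  have inS: "stereoS_inv (stereoS q) = q" if "q \<in> S2" "q \<noteq> south_pole" for q
  proof -
    define r where "r = (cnj (fst q), - snd q)"
    have r: "r \<in> S2" "r \<noteq> north_pole" using that by (auto simp: r_def S2_iff north_pole_def south_pole_def prod_eq_iff)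
    have "stereoN r = stereoS q" by (simp add: r_def stereoN_def stereoS_def)
    then have "stereoN_inv (stereoS q) = r" using stereoN_inv_stereoN[OF r] by simp
    then have "(cnj (fst (stereoN_inv (stereoS q))), - snd (stereoN_inv (stereoS q))) = q" by (simp add: r_def)
    moreover have "(cnj (fst (stereoN_inv w)), - snd (stereoN_inv w)) = stereoS_inv w" for w
      by (simp add: stereoN_inv_def stereoS_inv_def minus_divide_left)
    ultimately show ?thesis by simp
  qed
  show S: "stereoS ` (U - {south_pole}) = {z. stereoS_inv z \<in> U}"
  proof (intro equalityI subsetI)
    fix z assume "z \<in> stereoS ` (U - {south_pole})"
    then show "z \<in> {z. stereoS_inv z \<in> U}" using inS T by auto
  next
    fix z assume "z \<in> {z. stereoS_inv z \<in> U}"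
    then have "stereoS_inv z \<in> U - {south_pole}" using stereoS_inv_neq by auto
    from imageI[OF this, of stereoS] show "z \<in> stereoS ` (U - {south_pole})" by simp
  qed
  show "(\<lambda>z. \<phi> (stereoN_inv z)) holomorphic_on {z. stereoN_inv z \<in> U}"
    "(\<lambda>z. \<phi> (stereoS_inv z)) holomorphic_on {z. stereoS_inv z \<in> U}"
    using h unfolding N S by (simp_all add: o_def)
qed

lemma pullback_metric_chart:
  assumes \<psi>: "\<And>z. \<psi> differentiable (at z)" "inj_on \<psi> D" and D: "open D" "\<psi> ` D \<subseteq> U"
    and hol: "(\<lambda>z. \<phi> (\<psi> z)) holomorphic_on D" and inj: "inj_on \<phi> U"
    and g: "metric_eq_in_chart g U \<phi> W \<rho>" and z: "z \<in> D"
  defines "\<sigma> \<equiv> \<lambda>z. \<phi> (\<psi> z)"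
  shows "deriv \<sigma> z \<noteq> 0" "inj_on \<sigma> D"
    "\<sigma> z \<in> W \<Longrightarrow> pullback_metric \<psi> g z h k = \<rho> (\<sigma> z) * (norm (deriv \<sigma> z))\<^sup>2 * (h \<bullet> k)"
proof -
  have hs: "\<sigma> holomorphic_on D" using hol by (simp add: \<sigma>_def)
  show js: "inj_on \<sigma> D"
    unfolding \<sigma>_def using comp_inj_on[OF \<psi>(2) inj_on_subset[OF inj D(2)]] by (simp add: o_def)
  show d0: "deriv \<sigma> z \<noteq> 0" by (rule holomorphic_injective_imp_regular[OF hs D(1) js z])
  obtain \<tau> where \<tau>: "\<tau> holomorphic_on \<sigma> ` D" "\<And>z. z \<in> D \<Longrightarrow> deriv \<sigma> z * deriv \<tau> (\<sigma> z) = 1" "\<And>z. z \<in> D \<Longrightarrow> \<tau> (\<sigma> z) = z"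
    using holomorphic_has_inverse[OF hs D(1) js] by metis
  have op: "open (\<sigma> ` D)" by (rule open_mapping_thm3[OF hs D(1) js])
  define F where "F = frechet_derivative \<psi> (at z)"
  have F: "(\<psi> has_derivative F) (at (\<tau> (\<sigma> z)))" using iffD1[OF frechet_derivative_works \<psi>(1)[of z]] by (simp only: \<tau>(3)[OF z] F_def)
  have inv: "inv_into U \<phi> y = \<psi> (\<tau> y)" if y: "y \<in> \<sigma> ` D" for y
  proof -
    obtain x where x: "x \<in> D" "y = \<sigma> x" using y by blast
    have "inv_into U \<phi> (\<phi> (\<psi> x)) = \<psi> x" by (rule inv_into_f_f[OF inj]) (use x D(2) in blast)
    then show ?thesis using \<tau>(3)[OF x(1)] x(2) by (simp add: \<sigma>_def)
  qed
  have dt: "(\<tau> has_derivative (\<lambda>v. deriv \<tau> (\<sigma> z) * v)) (at (\<sigma> z))"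
    using holomorphic_derivI[OF \<tau>(1) op] z by (simp add: has_field_derivative_def)
  have "((\<lambda>y. \<psi> (\<tau> y)) has_derivative (\<lambda>v. F (deriv \<tau> (\<sigma> z) * v))) (at (\<sigma> z))"
    by (rule has_derivative_compose[OF dt F])
  then have "(inv_into U \<phi> has_derivative (\<lambda>v. F (deriv \<tau> (\<sigma> z) * v))) (at (\<sigma> z))"
    by (rule has_derivative_transform_within_open[OF _ op]) (use z inv in auto)
  from frechet_derivative_at[OF this]
  have fr: "frechet_derivative (inv_into U \<phi>) (at (\<sigma> z)) = (\<lambda>v. F (deriv \<tau> (\<sigma> z) * v))" by simp
  assume W: "\<sigma> z \<in> W"
  have ca: "deriv \<tau> (\<sigma> z) * (deriv \<sigma> z * v) = v" for v
    using \<tau>(2)[OF z] by (metis mult.assoc mult.commute mult_1)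
  have "pullback_metric (inv_into U \<phi>) g (\<sigma> z) (deriv \<sigma> z * h) (deriv \<sigma> z * k) = \<rho> (\<sigma> z) * ((deriv \<sigma> z * h) \<bullet> (deriv \<sigma> z * k))"
    using g W unfolding metric_eq_in_chart_def by blast
  moreover have "inv_into U \<phi> (\<sigma> z) = \<psi> z" using inv[OF imageI[OF z]] by (simp only: \<tau>(3)[OF z])
  ultimately have "g (\<psi> z) (F h) (F k) = \<rho> (\<sigma> z) * ((deriv \<sigma> z * h) \<bullet> (deriv \<sigma> z * k))"
    by (simp only: pullback_metric_def fr ca)
  also have "(deriv \<sigma> z * h) \<bullet> (deriv \<sigma> z * k) = (norm (deriv \<sigma> z))\<^sup>2 * (h \<bullet> k)"
    by (simp add: inner_complex_def cmod_power2) (simp add: power2_eq_square algebra_simps)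
  finally show "pullback_metric \<psi> g z h k = \<rho> (\<sigma> z) * (norm (deriv \<sigma> z))\<^sup>2 * (h \<bullet> k)"
    by (simp add: pullback_metric_def F_def)
qed

text \<open>Changing coordinates by \<open>\<sigma>\<close> adds \<open>ln |deriv \<sigma>|\<close>
  to the potential, and this is \<open>C^2\<close> because an injective holomorphic map has no
  critical points.\<close>

lemma smooth_chart_potential:
  assumes \<psi>: "\<And>z. \<psi> differentiable (at z)" "inj_on \<psi> D" and D: "open D" "\<psi> ` D \<subseteq> U"
    and hol: "(\<lambda>z. \<phi> (\<psi> z)) holomorphic_on D" and inj: "inj_on \<phi> U"
    and u: "smooth_on u (\<phi> ` U)" and g: "metric_eq_in_chart g U \<phi> (\<phi> ` U) (\<lambda>z. exp (2 * u z))"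
  obtains v p p' where "C2_grad D v p p'" "\<And>z h k. z \<in> D \<Longrightarrow> pullback_metric \<psi> g z h k = exp (2 * v z) * (h \<bullet> k)"
proof -
  define \<sigma> where "\<sigma> = (\<lambda>z. \<phi> (\<psi> z))"
  note ch = pullback_metric_chart[OF \<psi> D hol inj g, folded \<sigma>_def]
  have hs: "\<sigma> holomorphic_on D" using hol by (simp add: \<sigma>_def)
  define v where "v = (\<lambda>z. u (\<sigma> z) + ln (norm (deriv \<sigma> z)))"
  have pm: "pullback_metric \<psi> g z h k = exp (2 * v z) * (h \<bullet> k)" if z: "z \<in> D" for z h k
  proof -
    have "\<sigma> z \<in> \<phi> ` U" using D z by (auto simp: \<sigma>_def)
    moreover have "(norm (deriv \<sigma> z))\<^sup>2 = exp (2 * ln (norm (deriv \<sigma> z)))" using ch(1)[OF z]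
      by (simp add: exp_double)
    ultimately show ?thesis using ch(3)[OF z, of h k] by (simp add: v_def exp_add distrib_left \<sigma>_def)
  qed
  have "\<exists>p p'. C2_grad D v p p'"
  proof (cases "D = {}")
    case True then show ?thesis by (auto simp: C2_grad_def)
  next
    case False
    then have i: "inj_on \<sigma> D" using ch(2) by blast
    have op: "open (\<sigma> ` D)" by (rule open_mapping_thm3[OF hs D(1) i])
    have sub: "\<sigma> ` D \<subseteq> \<phi> ` U" using D by (auto simp: \<sigma>_def)
    have "Ck_on 2 u (\<phi> ` U)" using u by (simp add: smooth_on_def)
    then have "Ck_on 2 u (\<sigma> ` D)" using sub
      unfolding numeral_2_eq_2 Ck_on.simps by (meson continuous_on_subset subsetD)
    then obtain p p' where C: "C2_grad (\<sigma> ` D) u p p'" using C2_grad_if_Ck_on_2[OF op] by blast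
    note C1 = C2_grad_compose_holo[OF C hs D(1) subset_refl]
    have "deriv \<sigma> ` D \<subseteq> - {0}" using ch(1) by auto
    note C2 = C2_grad_compose_holo[OF C2_grad_ln_norm holomorphic_deriv[OF hs D(1)] D(1) this]
    show ?thesis using C2_grad_add[OF C1 C2] unfolding v_def by blast
  qed
  then show thesis using pm that by blast
qed

text \<open>The order does not depend on the coordinate: \<open>\<sigma>\<close> has a simple zero
  at \<open>z0\<close>, so \<open>ln |\<sigma> z| - ln |z - z0|\<close> is the logarithm of a
  difference quotient and converges to \<open>ln |deriv \<sigma> z0|\<close>.\<close>

lemma conic_chart_potential:
  assumes \<psi>: "\<And>z. \<psi> differentiable (at z)" "inj_on \<psi> D" and D: "open D" "\<psi> ` D \<subseteq> U"
    and hol: "(\<lambda>z. \<phi> (\<psi> z)) holomorphic_on D" and inj: "inj_on \<phi> U"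
    and u: "continuous_on (\<phi> ` U) u" and z0: "z0 \<in> D" "\<phi> (\<psi> z0) = 0"
    and g: "metric_eq_in_chart g U \<phi> (\<phi> ` U - {0}) (\<lambda>z. exp (2 * u z) * norm z powr (2 * \<beta>))"
  obtains v L where "((\<lambda>z. v z - \<beta> * ln (norm (z - z0))) \<longlongrightarrow> L) (at z0)"
    "\<And>z h k. z \<in> D - {z0} \<Longrightarrow> pullback_metric \<psi> g z h k = exp (2 * v z) * (h \<bullet> k)"
proof -
  define \<sigma> where "\<sigma> = (\<lambda>z. \<phi> (\<psi> z))"
  note ch = pullback_metric_chart[OF \<psi> D hol inj g, folded \<sigma>_def]
  have hs: "\<sigma> holomorphic_on D" using hol by (simp add: \<sigma>_def)
  have s0: "\<sigma> z0 = 0" using z0 by (simp add: \<sigma>_def)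
  have i: "inj_on \<sigma> D" using ch(2)[OF z0(1)] .
  have sn: "\<sigma> z \<noteq> 0" if "z \<in> D - {z0}" for z using inj_onD[OF i, of z z0] that z0 s0 by auto
  define v where "v = (\<lambda>z. u (\<sigma> z) + \<beta> * ln (norm (\<sigma> z)) + ln (norm (deriv \<sigma> z)))"
  have pm: "pullback_metric \<psi> g z h k = exp (2 * v z) * (h \<bullet> k)" if z: "z \<in> D - {z0}" for z h k
  proof -
    have "\<sigma> z \<in> \<phi> ` U - {0}" using D z sn[OF z] by (auto simp: \<sigma>_def)
    moreover have "(norm (deriv \<sigma> z))\<^sup>2 = exp (2 * ln (norm (deriv \<sigma> z)))" using ch(1)[of z] z
      by (simp add: exp_double)
    moreover have "norm (\<sigma> z) powr (2 * \<beta>) = exp (2 * (\<beta> * ln (norm (\<sigma> z))))" using sn[OF z] by (simp add: powr_def)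
    ultimately show ?thesis using ch(3)[of z h k] z by (simp add: v_def exp_add distrib_left \<sigma>_def)
  qed
  have cs: "continuous_on D \<sigma>" and cd: "continuous_on D (deriv \<sigma>)"
    using hs D(1) by (auto intro!: holomorphic_on_imp_continuous_on holomorphic_deriv)
  have ts: "(\<sigma> \<longlongrightarrow> \<sigma> z0) (at z0)" and td: "(deriv \<sigma> \<longlongrightarrow> deriv \<sigma> z0) (at z0)"
    using cs cd D(1) z0(1) by (auto simp: continuous_on_eq_continuous_at isCont_def)
  have evD: "eventually (\<lambda>z. z \<in> D - {z0}) (at z0)"
    using eventually_at_in_open[OF D(1) z0(1)] .
  have "continuous_on D (\<lambda>z. u (\<sigma> z))"
    by (rule continuous_on_compose2[OF u cs]) (use D in \<open>auto simp: \<sigma>_def\<close>)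
  then have tu: "((\<lambda>z. u (\<sigma> z)) \<longlongrightarrow> u (\<sigma> z0)) (at z0)"
    using D(1) z0(1) by (auto simp: continuous_on_eq_continuous_at isCont_def)
  have "(\<sigma> has_field_derivative deriv \<sigma> z0) (at z0)" by (rule holomorphic_derivI[OF hs D(1) z0(1)])
  then have tq: "((\<lambda>z. (\<sigma> z - \<sigma> z0) / (z - z0)) \<longlongrightarrow> deriv \<sigma> z0) (at z0)"
    by (simp add: has_field_derivative_iff)
  have d0: "deriv \<sigma> z0 \<noteq> 0" by (rule ch(1)[OF z0(1)])
  define K where "K = (\<lambda>z. u (\<sigma> z) + \<beta> * ln (norm ((\<sigma> z - \<sigma> z0) / (z - z0))) + ln (norm (deriv \<sigma> z)))"
  have tK: "(K \<longlongrightarrow> u (\<sigma> z0) + \<beta> * ln (norm (deriv \<sigma> z0)) + ln (norm (deriv \<sigma> z0))) (at z0)"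
    unfolding K_def using d0 by (intro tendsto_intros tu tq td) auto
  have "eventually (\<lambda>z. K z = v z - \<beta> * ln (norm (z - z0))) (at z0)"
    using evD by eventually_elim (use sn in \<open>simp add: K_def v_def s0 norm_divide ln_div algebra_simps\<close>)
  from Lim_transform_eventually[OF tK this] show thesis using pm by (rule that)
qed

section \<open>The area bounds\<close>

lemma frechet_derivative_eq: "(f has_derivative F) (at z) \<Longrightarrow> frechet_derivative f (at z) = F"
  using frechet_derivative_at by metis

text \<open>The transition map \<open>1 / z\<close> stretches lengths by \<open>|z|^(-2)\<close>.
  This translates information near the north pole into behaviour at infinity, where it contributes
  the 2 in \<open>2 + \<beta>N\<close>.\<close>

lemma pullback_stereoN_inv:
  assumes z: "z \<noteq> 0" and g: "\<And>h k. pullback_metric stereoS_inv g (1 / z) h k = c * (h \<bullet> k)"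
  shows "pullback_metric stereoN_inv g z h k = c / norm z ^ 4 * (h \<bullet> k)"
proof -
  define m where "m = - (1 / z\<^sup>2)"
  define F where "F = frechet_derivative stereoS_inv (at (1 / z))"
  have F: "(stereoS_inv has_derivative F) (at (1 / z))"
    using iffD1[OF frechet_derivative_works differentiable_stereo_inv(2)[of "1 / z"]] by (simp only: F_def)
  have "((\<lambda>z. 1 / z) has_field_derivative m) (at z)"
    using z by (auto intro!: derivative_eq_intros simp: m_def power2_eq_square)
  then have d: "((\<lambda>z. 1 / z) has_derivative (\<lambda>v. m * v)) (at z)" unfolding has_field_derivative_def .
  have "((\<lambda>z. stereoS_inv (1 / z)) has_derivative (\<lambda>v. F (m * v))) (at z)"
    by (rule has_derivative_compose[OF d F])
  then have "(stereoN_inv has_derivative (\<lambda>v. F (m * v))) (at z)"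
    by (rule has_derivative_transform_within_open[OF _ open_delete[OF open_UNIV, of 0]])
       (use z stereoS_inv_eq_stereoN_inv in auto)
  then have fr: "frechet_derivative stereoN_inv (at z) = (\<lambda>v. F (m * v))" by (rule frechet_derivative_eq)
  have "pullback_metric stereoN_inv g z h k = pullback_metric stereoS_inv g (1 / z) (m * h) (m * k)"
    unfolding pullback_metric_def fr stereoS_inv_eq_stereoN_inv[OF z] F_def ..
  also have "\<dots> = c * ((norm m)\<^sup>2 * (h \<bullet> k))"
    unfolding g by (simp add: inner_complex_def cmod_power2) (simp add: power2_eq_square algebra_simps)
  also have "(norm m)\<^sup>2 = 1 / norm z ^ 4" by (simp add: m_def norm_divide norm_power power_divide flip: power_mult)
  finally show ?thesis by simp
qed

text \<open>Completing the square in the quadratic inequality reduces everything to comparing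
  \<open>a * b * V - 2 * pi * m\<close> with \<open>2 * pi * d\<close>. The sign of
  \<open>a * b\<close> decides whether \<open>V\<close> lies between the two roots or outside
  them.\<close>

lemma area_bounds_algebra:
  fixes a b V r p :: real
  assumes r: "r > 0" and S: "r + p > 0" and V: "V \<ge> 0" and bV: "2 * pi * (r + p) \<le> b * V"
    and Q: "a * b * V\<^sup>2 - 4 * pi * (b * r + a * p) * V + 4 * pi\<^sup>2 * (r + p)\<^sup>2 \<le> 0" and ab: "a \<le> b"
  defines "d \<equiv> sqrt ((b - a) * (b * r\<^sup>2 - a * p\<^sup>2))"
  shows "a = 0 \<Longrightarrow> V \<ge> pi * (r + p)\<^sup>2 / (b * r)"
    "a < 0 \<Longrightarrow> V \<ge> 2 * pi * (r / a + p / b - d / (a * b))"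
    "a > 0 \<Longrightarrow> 2 * pi * (r / a + p / b - d / (a * b)) \<le> V"
    "a > 0 \<Longrightarrow> V \<le> 2 * pi * (r / a + p / b + d / (a * b))"
proof -
  have "b * V > 0" using bV S by (smt (verit) mult_pos_pos pi_gt_zero)
  then have b: "b > 0" and V0: "V > 0" using V by (auto simp: zero_less_mult_iff)
  define m where "m = b * r + a * p"
  define disc where "disc = (b - a) * (b * r\<^sup>2 - a * p\<^sup>2)"
  have dm: "disc = m\<^sup>2 - a * b * (r + p)\<^sup>2" by (simp add: disc_def m_def power2_eq_square algebra_simps)
  have sq: "(a * b * V - 2 * pi * m)\<^sup>2 = a * b * (a * b * V\<^sup>2 - 4 * pi * (b * r + a * p) * V + 4 * pi\<^sup>2 * (r + p)\<^sup>2) + 4 * pi\<^sup>2 * disc"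
    by (simp add: dm m_def power2_eq_square algebra_simps)
  show "V \<ge> pi * (r + p)\<^sup>2 / (b * r)" if "a = 0"
  proof -
    have "4 * pi * (pi * (r + p)\<^sup>2) \<le> 4 * pi * (V * (b * r))" using Q that by (simp add: power2_eq_square algebra_simps)
    then have "pi * (r + p)\<^sup>2 \<le> V * (b * r)" by simp
    then show ?thesis using b r by (simp add: pos_divide_le_eq)
  qed
  have form: "2 * pi * (r / a + p / b - s / (a * b)) = (2 * pi * m - 2 * pi * s) / (a * b)"
    "2 * pi * (r / a + p / b + s / (a * b)) = (2 * pi * m + 2 * pi * s) / (a * b)" if "a \<noteq> 0" for s
    using that b by (simp_all add: m_def field_simps)
  show "V \<ge> 2 * pi * (r / a + p / b - d / (a * b))" if a: "a < 0"
  proof -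
    have abn: "a * b < 0" using a b by (simp add: mult_neg_pos)
    have "0 \<le> b * r\<^sup>2 - a * p\<^sup>2" using b a by (simp add: mult_nonpos_nonneg add_nonneg_nonneg diff_conv_add_uminus del: add_uminus_conv_diff)
    then have disc0: "disc \<ge> 0" using ab by (simp add: disc_def)
    have dd: "d \<ge> 0" "d\<^sup>2 = disc" using disc0 by (simp_all add: d_def disc_def)
    have "0 \<le> a * b * (a * b * V\<^sup>2 - 4 * pi * (b * r + a * p) * V + 4 * pi\<^sup>2 * (r + p)\<^sup>2)"
      using abn Q by (intro mult_nonpos_nonpos) auto
    then have "(2 * pi * d)\<^sup>2 \<le> (a * b * V - 2 * pi * m)\<^sup>2" unfolding sq by (simp add: power_mult_distrib dd)
    then have "\<bar>2 * pi * d\<bar> \<le> \<bar>a * b * V - 2 * pi * m\<bar>" by (simp only: abs_le_square_iff)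
    then have or: "2 * pi * d \<le> \<bar>a * b * V - 2 * pi * m\<bar>" using dd by simp
    \<comment> \<open>As \<open>a * b < 0\<close>, the discriminant is at least \<open>m^2\<close>,
      so \<open>2 pi (m + d)\<close> is nonnegative while \<open>a * b * V\<close> is negative. This
      excludes one of the two alternatives left by the square: the roots have opposite signs, and
      \<open>V\<close> lies beyond the positive one.\<close>
    have "m\<^sup>2 \<le> d\<^sup>2" unfolding dd dm using abn by (simp add: mult_nonpos_nonneg)
    then have "\<bar>m\<bar> \<le> d" using dd(1) by (simp add: abs_le_square_iff[symmetric])
    then have "2 * pi * \<bar>m\<bar> \<le> 2 * pi * d" by (intro mult_left_mono) auto
    then have "0 \<le> 2 * pi * m + 2 * pi * d" by (cases "m \<ge> 0") (simp_all add: abs_if)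
    moreover have "a * b * V < 0" using abn V0 by (simp add: mult_neg_pos)
    ultimately have "a * b * V \<le> 2 * pi * m - 2 * pi * d" using or by linarith
    then show ?thesis using abn a unfolding form(1)[OF less_imp_neq[OF a]] by (simp add: neg_divide_le_eq mult.commute)
  qed
  have pos: "\<bar>a * b * V - 2 * pi * m\<bar> \<le> 2 * pi * d \<and> a * b > 0" if a: "a > 0"
  proof -
    have abn: "a * b > 0" using a b by simp
    have "a * b * (a * b * V\<^sup>2 - 4 * pi * (b * r + a * p) * V + 4 * pi\<^sup>2 * (r + p)\<^sup>2) \<le> 0"
      using abn Q by (intro mult_nonneg_nonpos) auto
    then have le: "(a * b * V - 2 * pi * m)\<^sup>2 \<le> 4 * pi\<^sup>2 * disc" unfolding sq by simp
    \<comment> \<open>Here the nonnegativity of the discriminant is forced by the existence of a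
      \<open>V\<close> satisfying the inequality.\<close>
    then have "0 \<le> 4 * pi\<^sup>2 * disc" by (meson order_trans zero_le_power2)
    then have "disc \<ge> 0" by (simp add: zero_le_mult_iff)
    then have dd: "d \<ge> 0" "d\<^sup>2 = disc" by (simp_all add: d_def disc_def)
    have "(a * b * V - 2 * pi * m)\<^sup>2 \<le> (2 * pi * d)\<^sup>2" using le by (simp add: power_mult_distrib dd)
    then have "\<bar>a * b * V - 2 * pi * m\<bar> \<le> \<bar>2 * pi * d\<bar>" by (simp only: abs_le_square_iff)
    then show ?thesis using dd abn by simp
  qed
  show "2 * pi * (r / a + p / b - d / (a * b)) \<le> V" if a: "a > 0"
  proof -
    have "2 * pi * m - 2 * pi * d \<le> V * (a * b)" "a * b > 0" using pos[OF a] by (auto simp: mult.commute mult.left_commute abs_le_iff)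
    then show ?thesis unfolding form(1)[OF less_imp_neq[OF a, THEN not_sym]] by (simp add: pos_divide_le_eq)
  qed
  show "V \<le> 2 * pi * (r / a + p / b + d / (a * b))" if a: "a > 0"
  proof -
    have "V * (a * b) \<le> 2 * pi * m + 2 * pi * d" "a * b > 0" using pos[OF a] by (auto simp: mult.commute mult.left_commute abs_le_iff)
    then show ?thesis unfolding form(2)[OF less_imp_neq[OF a, THEN not_sym]] by (simp add: pos_le_divide_eq)
  qed
qed

text \<open>Stereographic coordinates from the north pole turn the conic sphere into the planar
  setting. Since the points are distinct, the sum \<open>\<beta>N\<close> has at most one term: it
  is the order at the north pole, and 0 if the metric is smooth there.\<close>

lemma planar_conic_of_represents_divisor:
  fixes g :: metric_tensor and p :: "nat \<Rightarrow> space3" and \<beta>s :: "nat \<Rightarrow> real"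
  assumes R: "represents_divisor g n p \<beta>s" and neg: "\<And>i. i \<in> {1..n} \<Longrightarrow> \<beta>s i \<le> 0"
    and K: "\<forall>q\<in>S2 - p ` {1..n}. a \<le> gauss_curvature g q \<and> gauss_curvature g q \<le> b"
  defines "I \<equiv> {i \<in> {1..n}. p i \<noteq> north_pole}"
  defines "\<beta>N \<equiv> \<Sum>i\<in>{i \<in> {1..n}. p i = north_pole}. \<beta>s i"
  obtains e U P P' where "planar_conic ((\<lambda>i. stereoN (p i)) ` I) e (2 + \<beta>N) U P P' a b"
    "inj_on (\<lambda>i. stereoN (p i)) I" "\<And>i. i \<in> I \<Longrightarrow> e (stereoN (p i)) = \<beta>s i"
    "area g = (\<integral>z. exp (2 * U z) \<partial>lborel)" "-1 < \<beta>N" "\<beta>N \<le> 0"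
proof -
  have inj: "inj_on p {1..n}" and pS: "p ` {1..n} \<subseteq> S2"
    and con: "\<And>i. i \<in> {1..n} \<Longrightarrow> conic_singularity g (p i) (\<beta>s i)"
    and smo: "\<And>q. q \<in> S2 - p ` {1..n} \<Longrightarrow> smooth_metric_at g q"
    using R by (auto simp: represents_divisor_def)
  define s where "s = (\<lambda>i. stereoN (p i))"
  define Z where "Z = s ` I"
  have Zfin: "finite Z" by (simp add: Z_def I_def)
  have sN: "stereoN_inv (s i) = p i" if "i \<in> I" for i
    using that pS by (auto simp: s_def I_def intro!: stereoN_inv_stereoN)
  have sinj: "inj_on s I"
  proof (rule inj_onI)
    fix i j assume ij: "i \<in> I" "j \<in> I" "s i = s j"
    then have "p i = p j" using sN[of i] sN[of j] by simp
    then show "i = j" by (rule inj_onD[OF inj]) (use ij in \<open>auto simp: I_def\<close>)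
  qed
  define e where "e = (\<lambda>z. \<beta>s (the_inv_into I s z))"
  have es: "e (s i) = \<beta>s i" if "i \<in> I" for i using the_inv_into_f_f[OF sinj that] by (simp add: e_def)
  have b1: "-1 < \<beta>s i" if "i \<in> {1..n}" for i using con[OF that] by (simp add: conic_singularity_def)
  have \<beta>N1: "\<beta>N = \<beta>s i" if i: "i \<in> {1..n}" "p i = north_pole" for i
  proof -
    have "j = i" if "j \<in> {1..n}" "p j = north_pole" for j
      by (rule inj_onD[OF inj _ that(1) i(1)]) (simp only: that i)
    then have "{j \<in> {1..n}. p j = north_pole} = {i}" using i by blast
    then show ?thesis unfolding \<beta>N_def by simp
  qed
  have \<beta>N0: "\<beta>N = 0" if "\<not> (\<exists>i\<in>{1..n}. p i = north_pole)"
  proof -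
    have "{j \<in> {1..n}. p j = north_pole} = {}" using that by blast
    then show ?thesis unfolding \<beta>N_def by (simp only: sum.empty)
  qed
  have \<beta>Nb: "-1 < \<beta>N \<and> \<beta>N \<le> 0"
  proof (cases "\<exists>i\<in>{1..n}. p i = north_pole")
    case True
    then obtain i where i: "i \<in> {1..n}" "p i = north_pole" by blast
    show ?thesis unfolding \<beta>N1[OF i] using b1[OF i(1)] neg[OF i(1)] ..
  next
    case False
    show ?thesis unfolding \<beta>N0[OF False] by simp
  qed
  have notZ: "stereoN_inv z \<in> S2 - p ` {1..n}" if "z \<notin> Z" for z
  proof -
    have "stereoN_inv z \<noteq> p i" if i: "i \<in> {1..n}" for i
    proof
      assume eq: "stereoN_inv z = p i"
      then have "p i \<noteq> north_pole" using stereoN_inv_neq[of z] by simp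
      then have "i \<in> I" using i unfolding I_def by blast
      moreover have "s i = z" unfolding s_def eq[symmetric] by simp
      ultimately show False using \<open>z \<notin> Z\<close> unfolding Z_def by blast
    qed
    then show ?thesis using stereo_inv_S2(1)[of z] by blast
  qed
  \<comment> \<open>The potential \<open>U\<close> is read off from one metric coefficient instead
    of being glued from charts. \<open>Uv\<close> identifies it with every local potential, so the
    charts only have to supply regularity.\<close>
  define lam where "lam = (\<lambda>z. pullback_metric stereoN_inv g z 1 1)"
  define U where "U = (\<lambda>z. ln (lam z) / 2)"
  have Uv: "U z = v" if "\<And>h k. pullback_metric stereoN_inv g z h k = exp (2 * v) * (h \<bullet> k)" for z v
    using that[of 1 1] by (simp add: U_def lam_def)
  have injN: "inj_on stereoN_inv D" for D by (rule inj_on_inverseI[where g=stereoN]) simp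
  have injS: "inj_on stereoS_inv D" for D by (rule inj_on_inverseI[where g=stereoS]) simp
  have loc: "\<exists>D v q q'. open D \<and> z \<in> D \<and> C2_grad D v q q' \<and> (\<forall>w\<in>D. \<forall>h k. pullback_metric stereoN_inv g w h k = exp (2 * v w) * (h \<bullet> k))"
    if z: "z \<notin> Z" for z
  proof -
    obtain Uc \<phi> u where c: "holomorphic_chart Uc \<phi>" "stereoN_inv z \<in> Uc" "smooth_on u (\<phi> ` Uc)"
        "metric_eq_in_chart g Uc \<phi> (\<phi> ` Uc) (\<lambda>z. exp (2 * u z))"
      using smo[OF notZ[OF z]] by (auto simp: smooth_metric_at_def)
    note cd = chart_domain[OF c(1)]
    obtain v q q' where "C2_grad {z. stereoN_inv z \<in> Uc} v q q'"
      "\<And>w h k. w \<in> {z. stereoN_inv z \<in> Uc} \<Longrightarrow> pullback_metric stereoN_inv g w h k = exp (2 * v w) * (h \<bullet> k)"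
      by (rule smooth_chart_potential[OF differentiable_stereo_inv(1) injN cd(2) _ cd(3,7) c(3,4)]) auto
    then show ?thesis using cd(2) c(2) by (intro exI[of _ "{z. stereoN_inv z \<in> Uc}"]) blast
  qed
  have conf: "pullback_metric stereoN_inv g z h k = exp (2 * U z) * (h \<bullet> k)" if z: "z \<notin> Z" for z h k
  proof -
    obtain D v q q' where D: "open D" "z \<in> D" "C2_grad D v q q'"
      "\<forall>w\<in>D. \<forall>h k. pullback_metric stereoN_inv g w h k = exp (2 * v w) * (h \<bullet> k)" using loc[OF z] by blast
    have "U z = v z" by (rule Uv) (rule D(4)[rule_format, OF D(2)])
    then show ?thesis using D(4)[rule_format, OF D(2), of h k] by (simp only:)
  qed
  have "\<exists>D q q'. open D \<and> z \<in> D \<and> C2_grad D U q q'" if z: "z \<in> - Z" for z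
  proof -
    obtain D v q q' where D: "open D" "z \<in> D" "C2_grad D v q q'"
      "\<forall>w\<in>D. \<forall>h k. pullback_metric stereoN_inv g w h k = exp (2 * v w) * (h \<bullet> k)" using loc[OF ComplD[OF z]] by blast
    have "U w = v w" if "w \<in> D" for w by (rule Uv) (rule D(4)[rule_format, OF that])
    then have "C2_grad D U q q'" by (rule C2_grad_transform[OF D(3,1)])
    then show ?thesis using D(1,2) by blast
  qed
  from C2_grad_local[OF this] obtain P P' where C: "C2_grad (- Z) U P P'" by blast
  have op: "open (- Z)" using Zfin by (simp add: finite_imp_closed open_Compl)
  have lamU: "lam z = exp (2 * U z)" if "z \<notin> Z" for z using conf[OF that, of 1 1] by (simp add: lam_def)
  have curv: "gauss_curvature g (stereoN_inv z) * exp (2 * U z) = - tr (P' z)" if z: "z \<notin> Z" for z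
  proof -
    have "(\<lambda>w. ln (pullback_metric stereoN_inv g w 1 1)) = (\<lambda>w. 2 * U w)" by (simp add: U_def lam_def)
    moreover have "laplacian (\<lambda>w. 2 * U w) z = tr (\<lambda>v. 2 *\<^sub>R P' z v)"
      by (rule laplacian_C2_grad[OF C2_grad_cmult[OF C] op]) (use z in simp)
    ultimately have "gauss_curvature g (stereoN_inv z) = - (2 * tr (P' z)) / (2 * lam z)"
      using stereoN_inv_neq[of z] by (simp add: gauss_curvature_def curvature_in_coord_def lam_def tr_scale)
    then show ?thesis using lamU[OF z] by simp
  qed
  have PC: "planar_conic Z e (2 + \<beta>N) U P P' a b"
  proof
    show "finite Z" by (rule Zfin)
    show "C2_grad (- Z) U P P'" by (rule C)
    show "-1 < e z" "e z \<le> 0" if "z \<in> Z" for z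
    proof -
      obtain i where i: "i \<in> I" "z = s i" using \<open>z \<in> Z\<close> unfolding Z_def by blast
      then have "i \<in> {1..n}" by (simp add: I_def)
      then show "-1 < e z" "e z \<le> 0" unfolding i(2) es[OF i(1)] by (rule b1 neg)+
    qed
    show "2 + \<beta>N > 1" using conjunct1[OF \<beta>Nb] by simp
    show "a * exp (2 * U z) \<le> - tr (P' z)" "- tr (P' z) \<le> b * exp (2 * U z)" if "z \<notin> Z" for z
      unfolding curv[OF that, symmetric] using bspec[OF K notZ[OF that]] by (simp_all add: mult_right_mono)
    show "\<exists>L. ((\<lambda>w. U w - e z * ln (norm (w - z))) \<longlongrightarrow> L) (at z)" if z: "z \<in> Z" for z
    proof -
      obtain i where i: "i \<in> I" "z = s i" using z by (auto simp: Z_def)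
      then have iI: "i \<in> {1..n}" by (simp add: I_def)
      obtain Uc \<phi> u where c: "holomorphic_chart Uc \<phi>" "p i \<in> Uc" "\<phi> (p i) = 0" "continuous_on (\<phi> ` Uc) u"
        "metric_eq_in_chart g Uc \<phi> (\<phi> ` Uc - {0}) (\<lambda>z. exp (2 * u z) * norm z powr (2 * \<beta>s i))"
        using con[OF iI] by (auto simp: conic_singularity_def)
      note cd = chart_domain[OF c(1)]
      have zi: "stereoN_inv z = p i" using sN i by simp
      obtain v L where v: "((\<lambda>w. v w - \<beta>s i * ln (norm (w - z))) \<longlongrightarrow> L) (at z)"
        "\<And>w h k. w \<in> {z. stereoN_inv z \<in> Uc} - {z} \<Longrightarrow> pullback_metric stereoN_inv g w h k = exp (2 * v w) * (h \<bullet> k)"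
        by (rule conic_chart_potential[OF differentiable_stereo_inv(1) injN cd(2) _ cd(3,7) c(4) _ _ c(5), of z])
          (use c(2,3) zi in \<open>simp_all add: image_subset_iff\<close>)
      have "eventually (\<lambda>w. w \<in> {z. stereoN_inv z \<in> Uc} - {z}) (at z)"
        by (rule eventually_at_in_open[OF cd(2)]) (use c zi in simp)
      then have "eventually (\<lambda>w. v w - \<beta>s i * ln (norm (w - z)) = U w - e z * ln (norm (w - z))) (at z)"
      proof eventually_elim
        case (elim w)
        have "U w = v w" by (rule Uv) (rule v(2)[OF elim])
        then show ?case unfolding i(2) es[OF i(1)] by (simp only:)
      qed
      from Lim_transform_eventually[OF v(1) this] show ?thesis by (rule exI)
    qed
    show "\<exists>L. ((\<lambda>w. U w + (2 + \<beta>N) * ln (norm w)) \<longlongrightarrow> L) at_infinity"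
    proof -
      \<comment> \<open>Behaviour at infinity is read off from a potential \<open>v\<close> in the
        coordinate \<open>1 / w\<close>. A smooth north pole is treated as a cone point of order
        \<open>\<beta>N = 0\<close>.\<close>
      have "\<exists>D v L. open D \<and> 0 \<in> D \<and> ((\<lambda>w. v w - \<beta>N * ln (norm (w - 0))) \<longlongrightarrow> L) (at 0) \<and>
         (\<forall>w\<in>D - {0}. \<forall>h k. pullback_metric stereoS_inv g w h k = exp (2 * v w) * (h \<bullet> k))"
      proof (cases "\<exists>i\<in>{1..n}. p i = north_pole")
        case True
        then obtain i where i: "i \<in> {1..n}" "p i = north_pole" by blast
        obtain Uc \<phi> u where c: "holomorphic_chart Uc \<phi>" "p i \<in> Uc" "\<phi> (p i) = 0" "continuous_on (\<phi> ` Uc) u"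
          "metric_eq_in_chart g Uc \<phi> (\<phi> ` Uc - {0}) (\<lambda>z. exp (2 * u z) * norm z powr (2 * \<beta>s i))"
          using con[OF i(1)] by (auto simp: conic_singularity_def)
        note cd = chart_domain[OF c(1)]
        obtain v L where v: "((\<lambda>w. v w - \<beta>s i * ln (norm (w - 0))) \<longlongrightarrow> L) (at 0)"
          "\<And>w h k. w \<in> {z. stereoS_inv z \<in> Uc} - {0} \<Longrightarrow> pullback_metric stereoS_inv g w h k = exp (2 * v w) * (h \<bullet> k)"
          by (rule conic_chart_potential[OF differentiable_stereo_inv(2) injS cd(5) _ cd(6,7) c(4) _ _ c(5), of 0])
            (use c(2,3) i(2) in \<open>simp_all add: image_subset_iff stereoS_inv_0\<close>)
        have "0 \<in> {z. stereoS_inv z \<in> Uc}" using c i by (simp add: stereoS_inv_0)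
        then show ?thesis unfolding \<beta>N1[OF i] using cd(5) v by blast
      next
        case False
        have "north_pole \<in> S2" by (simp add: S2_iff north_pole_def)
        then have "north_pole \<in> S2 - p ` {1..n}" using False by force
        then have "smooth_metric_at g north_pole" by (rule smo)
        then obtain Uc \<phi> u where c: "holomorphic_chart Uc \<phi>" "north_pole \<in> Uc" "smooth_on u (\<phi> ` Uc)"
          "metric_eq_in_chart g Uc \<phi> (\<phi> ` Uc) (\<lambda>z. exp (2 * u z))"
          unfolding smooth_metric_at_def by blast
        note cd = chart_domain[OF c(1)]
        obtain v q q' where v: "C2_grad {z. stereoS_inv z \<in> Uc} v q q'"
          "\<And>w h k. w \<in> {z. stereoS_inv z \<in> Uc} \<Longrightarrow> pullback_metric stereoS_inv g w h k = exp (2 * v w) * (h \<bullet> k)"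
          by (rule smooth_chart_potential[OF differentiable_stereo_inv(2) injS cd(5) _ cd(6,7) c(3,4)]) auto
        have D0: "0 \<in> {z. stereoS_inv z \<in> Uc}" using c by (simp add: stereoS_inv_0)
        have "isCont v 0" using C2_gradD(4)[OF v(1)] cd(5) D0 continuous_on_eq_continuous_at by blast
        then have "((\<lambda>w. v w - \<beta>N * ln (norm (w - 0))) \<longlongrightarrow> v 0) (at 0)" by (simp add: \<beta>N0[OF False] isCont_def)
        then show ?thesis using cd(5) D0 v(2) by blast
      qed
      then obtain D v L where D: "open D" "0 \<in> D" and L: "((\<lambda>w. v w - \<beta>N * ln (norm (w - 0))) \<longlongrightarrow> L) (at 0)"
        and v: "\<And>w h k. w \<in> D - {0} \<Longrightarrow> pullback_metric stereoS_inv g w h k = exp (2 * v w) * (h \<bullet> k)" by blast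
      have "((\<lambda>w. 1 / w) \<longlongrightarrow> 0) (at_infinity :: complex filter)" by (rule tendsto_divide_0[OF tendsto_const filterlim_ident])
      moreover have nz: "eventually (\<lambda>w::complex. w \<noteq> 0) at_infinity" by (rule eventually_not_equal_at_infinity)
      ultimately have fl: "filterlim (\<lambda>w::complex. 1 / w) (at 0) at_infinity"
        unfolding filterlim_at by (auto elim: eventually_mono)
      have l: "((\<lambda>w. v (1 / w) - \<beta>N * ln (norm (1 / w - 0))) \<longlongrightarrow> L) at_infinity" by (rule filterlim_compose[OF L fl])
      have "eventually (\<lambda>w. w \<in> D - {0}) (at 0)" by (rule eventually_at_in_open[OF D])
      from filterlim_iff[THEN iffD1, OF fl, rule_format, OF this]
      have "eventually (\<lambda>w. 1 / w \<in> D - {0}) at_infinity" .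
      then have "eventually (\<lambda>w. v (1 / w) - \<beta>N * ln (norm (1 / w - 0)) = U w + (2 + \<beta>N) * ln (norm w)) at_infinity"
        using nz
      proof eventually_elim
        case (elim w)
        have "exp (2 * v (1 / w)) / norm w ^ 4 = exp (2 * v (1 / w)) / exp (ln (norm w ^ 4))" using elim by simp
        also have "\<dots> = exp (2 * (v (1 / w) - 2 * ln (norm w)))" using elim by (simp add: exp_diff[symmetric] ln_realpow algebra_simps)
        finally have ee: "exp (2 * v (1 / w)) / norm w ^ 4 = exp (2 * (v (1 / w) - 2 * ln (norm w)))" .
        have "U w = v (1 / w) - 2 * ln (norm w)"
          by (rule Uv) (use pullback_stereoN_inv[OF elim(2) v[OF elim(1)]] in \<open>simp only: ee\<close>)
        then show ?case using elim by (simp add: norm_divide ln_div algebra_simps)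
      qed
      from Lim_transform_eventually[OF l this] show ?thesis by (rule exI)
    qed
  qed
  have ar: "area g = (\<integral>z. exp (2 * U z) \<partial>lborel)"
  proof -
    interpret pc: planar_conic Z e "2 + \<beta>N" U P P' a b by (rule PC)
    define G where "G = (\<lambda>z. sqrt (pullback_metric stereoN_inv g z 1 1 * pullback_metric stereoN_inv g z \<i> \<i>
      - (pullback_metric stereoN_inv g z 1 \<i>)\<^sup>2))"
    have eq: "G z = exp (2 * U z)" if "z \<notin> Z" for z
      by (simp add: G_def conf[OF that])
    have cG: "continuous_on (- Z) G"
      by (rule continuous_on_eq[of _ "\<lambda>z. exp (2 * U z)"]) (use eq in \<open>auto intro!: continuous_intros C2_gradD(4)[OF C]\<close>)
    have "(\<integral>z. G z \<partial>lborel) = (\<integral>z. exp (2 * U z) \<partial>lborel)"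
    proof (rule integral_cong_AE)
      show "G \<in> borel_measurable lborel" using pc.measurable_cont[OF cG] by simp
      show "(\<lambda>z. exp (2 * U z)) \<in> borel_measurable lborel" by measurable
      show "AE z in lborel. G z = exp (2 * U z)" using pc.AE_Z by eventually_elim (rule eq)
    qed
    then show ?thesis by (simp add: area_def G_def)
  qed
  show thesis
    by (rule that[of e U P P']) (use PC sinj es ar \<beta>Nb in \<open>simp_all add: Z_def s_def\<close>)
qed

theorem theorem1p1:
  fixes n :: nat and p :: "nat \<Rightarrow> space3" and \<beta>s :: "nat \<Rightarrow> real"
    and g :: metric_tensor and a b degD \<beta> \<alpha> :: real
  defines "degD \<equiv> \<Sum>i=1..n. \<beta>s i"
    and "\<beta> \<equiv> Min (\<beta>s ` {1..n})"
    and "\<alpha> \<equiv> degD - Min (\<beta>s ` {1..n})"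
  assumes "n \<ge> 1"
    and "-1 < \<beta>s 1" and "mono_on {1..n} \<beta>s" and "\<beta>s n \<le> 0"
    and "represents_divisor g n p \<beta>s"
    and "\<beta> \<le> \<alpha>"
    and "\<forall>q\<in>S2 - p ` {1..n}. a \<le> gauss_curvature g q \<and> gauss_curvature g q \<le> b"
  shows
    "(a = 0 \<longrightarrow> area g \<ge> pi * (2 + degD)\<^sup>2 / (b * (1 + \<beta>))) \<and>
     (a < 0 \<longrightarrow> area g \<ge> 2 * pi * ((\<beta> + 1) / a + (\<alpha> + 1) / b
        - sqrt ((b - a) * (b * (\<beta> + 1)\<^sup>2 - a * (\<alpha> + 1)\<^sup>2)) / (a * b))) \<and>
     (a > 0 \<longrightarrow>
        2 * pi * ((\<beta> + 1) / a + (\<alpha> + 1) / b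
          - sqrt ((b - a) * (b * (\<beta> + 1)\<^sup>2 - a * (\<alpha> + 1)\<^sup>2)) / (a * b)) \<le> area g \<and>
        area g \<le> 2 * pi * ((\<beta> + 1) / a + (\<alpha> + 1) / b
          + sqrt ((b - a) * (b * (\<beta> + 1)\<^sup>2 - a * (\<alpha> + 1)\<^sup>2)) / (a * b)))"
proof -
  have i1: "1 \<in> {1..n}" "n \<in> {1..n}" using \<open>n \<ge> 1\<close> by auto
  have le1: "\<beta>s 1 \<le> \<beta>s i" "\<beta>s i \<le> 0" if "i \<in> {1..n}" for i
    using that i1 mono_onD[OF \<open>mono_on {1..n} \<beta>s\<close>, of 1 i] mono_onD[OF \<open>mono_on {1..n} \<beta>s\<close>, of i n] \<open>\<beta>s n \<le> 0\<close> by auto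
  have \<beta>: "\<beta> = \<beta>s 1" unfolding \<beta>_def by (rule Min_eqI) (use le1 i1 in auto)
  have \<alpha>: "\<alpha> = degD - \<beta>s 1" using \<beta> by (simp add: \<alpha>_def \<beta>_def)
  define I where "I = {i \<in> {1..n}. p i \<noteq> north_pole}"
  define \<beta>N where "\<beta>N = (\<Sum>i\<in>{i \<in> {1..n}. p i = north_pole}. \<beta>s i)"
  obtain e U P P' where PC: "planar_conic ((\<lambda>i. stereoN (p i)) ` I) e (2 + \<beta>N) U P P' a b"
    and inj: "inj_on (\<lambda>i. stereoN (p i)) I" and es: "\<And>i. i \<in> I \<Longrightarrow> e (stereoN (p i)) = \<beta>s i"
    and ar: "area g = (\<integral>z. exp (2 * U z) \<partial>lborel)" and \<beta>N: "-1 < \<beta>N" "\<beta>N \<le> 0"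
    by (rule planar_conic_of_represents_divisor[OF \<open>represents_divisor g n p \<beta>s\<close> le1(2)
        \<open>\<forall>q\<in>S2 - p ` {1..n}. a \<le> gauss_curvature g q \<and> gauss_curvature g q \<le> b\<close>]) (auto simp: I_def \<beta>N_def)
  have sumZ: "(\<Sum>z\<in>(\<lambda>i. stereoN (p i)) ` I. e z) = (\<Sum>i\<in>I. \<beta>s i)"
    using inj es by (simp add: sum.reindex)
  have split: "(\<Sum>i\<in>I. \<beta>s i) + \<beta>N = degD"
  proof -
    have "I \<union> {i \<in> {1..n}. p i = north_pole} = {1..n}" by (auto simp: I_def)
    moreover have "sum \<beta>s (I \<union> {i \<in> {1..n}. p i = north_pole}) = sum \<beta>s I + \<beta>N"
      unfolding \<beta>N_def by (rule sum.union_disjoint) (auto simp: I_def)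
    ultimately show ?thesis by (simp only: degD_def)
  qed
  \<comment> \<open>The point of smallest order either is the north pole, hence already at infinity,
    or is moved there by inversion. The remaining orders then sum to
    \<open>\<alpha>\<close>.\<close>
  have "\<exists>Z e U q q'. planar_conic Z e (2 + \<beta>s 1) U q q' a b \<and> (\<Sum>z\<in>Z. e z) = \<alpha> \<and> (\<integral>z. exp (2 * U z) \<partial>lborel) = area g"
  proof (cases "p 1 = north_pole")
    case True
    have "inj_on p {1..n}" using \<open>represents_divisor g n p \<beta>s\<close> by (simp add: represents_divisor_def)
    then have "i = 1" if "i \<in> {1..n}" "p i = north_pole" for i
      using inj_onD[of p "{1..n}" i 1] that True i1 by simp
    then have "{i \<in> {1..n}. p i = north_pole} = {1}" using True i1(1) by blast
    then have "\<beta>N = \<beta>s 1" by (simp add: \<beta>N_def)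
    then show ?thesis using PC sumZ split ar \<alpha> by (metis add_diff_cancel_right')
  next
    case False
    then have I1: "1 \<in> I" using i1 by (simp add: I_def)
    then have c: "stereoN (p 1) \<in> (\<lambda>i. stereoN (p i)) ` I" by blast
    have "2 + \<beta>N \<le> 2" using \<beta>N by simp
    from planar_conic.inversion[OF PC c this] obtain Z' e' U' q q' where
      "planar_conic Z' e' (2 + e (stereoN (p 1))) U' q q' a b"
      "(\<Sum>z\<in>Z'. e' z) = (\<Sum>z\<in>(\<lambda>i. stereoN (p i)) ` I. e z) - e (stereoN (p 1)) + (2 + \<beta>N - 2)"
      "(\<integral>z. exp (2 * U' z) \<partial>lborel) = (\<integral>z. exp (2 * U z) \<partial>lborel)" by metis
    moreover from this(2) have "(\<Sum>z\<in>Z'. e' z) = \<alpha>" unfolding sumZ es[OF I1] using split \<alpha> by simp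
    ultimately show ?thesis unfolding es[OF I1] ar by blast
  qed
  then obtain Z e' U' q q' where PC': "planar_conic Z e' (2 + \<beta>s 1) U' q q' a b"
    and sum': "(\<Sum>z\<in>Z. e' z) = \<alpha>" and ar': "(\<integral>z. exp (2 * U' z) \<partial>lborel) = area g" by blast
  interpret pc: planar_conic Z e' "2 + \<beta>s 1" U' q q' a b by (rule PC')
  have V: "pc.V = area g" using ar' by (simp add: pc.V_def pc.\<rho>_def)
  have A: "pc.\<alpha> = \<alpha>" using sum' by (simp add: pc.\<alpha>_def)
  have V0: "area g \<ge> 0" unfolding V[symmetric] pc.V_def by (intro Bochner_Integration.integral_nonneg pc.\<rho>_nonneg)
  have r: "\<beta> + 1 > 0" using \<open>-1 < \<beta>s 1\<close> \<beta> by simp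
  \<comment> \<open>This is \<open>2 + |D| > 0\<close>: by \<open>\<beta> \<le> \<alpha>\<close>
    both summands are positive, so the total curvature is positive.\<close>
  have S: "\<beta> + 1 + (\<alpha> + 1) > 0" using r \<open>\<beta> \<le> \<alpha>\<close> by simp
  have s2: "2 + \<beta>s 1 + \<alpha> = \<beta> + 1 + (\<alpha> + 1)" "2 + \<beta>s 1 - 1 = \<beta> + 1" "1 + \<alpha> = \<alpha> + 1" using \<beta> by auto
  have bV: "2 * pi * (\<beta> + 1 + (\<alpha> + 1)) \<le> b * area g"
    using pc.total_curvature_bounds(2) unfolding V A s2 .
  have Q: "a * b * (area g)\<^sup>2 - 4 * pi * (b * (\<beta> + 1) + a * (\<alpha> + 1)) * area g + 4 * pi\<^sup>2 * (\<beta> + 1 + (\<alpha> + 1))\<^sup>2 \<le> 0"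
    using pc.area_inequality unfolding V A s2 .
  have deg: "2 + degD = \<beta> + 1 + (\<alpha> + 1)" "1 + \<beta> = \<beta> + 1" using \<alpha> \<beta> by auto
  show ?thesis unfolding deg using area_bounds_algebra[OF r S V0 bV Q pc.ab] by blast
qed

end
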